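(* Let $\Omega=(-R,R)$, $s\ge0$, $u\in G^s(\bar\Omega)$, $m\in\mathbb N$ and $1\le p\le\infty$. Let $\{\phi_j\}_{j=1}^J\subset W^{m,\infty}(\Omega)$ satisfy the partition-of-unity assumption in the context, with patches $\Omega_j$ of center $x_j$ and size $r_j$ and constants $M,C_\phi$. For each $j$, let $k_{j,1},\dots,k_{j,N_j}$ be i.i.d. with a law satisfying the sampling assumption in the context with parameters $\mu_j$ and $\varpi$. Put $A_j=\varpi\max(C_{u,\bar\Omega_j},\mu_j)\,r_j$ and assume $A_j\le e^{-2}$ for all $j$ and $m\le\min_jN_j-1$. Then, for a suitable choice of the parameters $c_j>2$, the function $$u_{RF}=\sum_{j=1}^J\phi_jv_j,\qquad v_j(x)=\bigl(\mathcal R_{N_j}[\{k_{j,q}\}_{q=1}^{N_j},\mu_j,C_{u,\bar\Omega_j},c_j]\,u(\cdot+x_j)\bigr)(x-x_j),$$ satisfies $$\mathbb E\|u-u_{RF}\|_{W^{m,p}(\Omega)}\lesssim M_u\max_{1\le j\le J}\Bigl(r_j^{1/p-m-1}A_j^{N_j}|\ln A_j|^{N_j-1}\Bigr),$$ where the implied constant depends only on $m,p,s,C_\phi,M,R$ and $\mathbf N=(N_1,\dots,N_J)$.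
   Context: Gevrey class: for $s\ge0$ and a compact interval $I$, $G^s(I)$ is the set of $f\in C^\infty(I)$ for which there are $M_{f,I},C_{f,I}>0$ with $\max_I|f^{(n)}|\le M_{f,I}C_{f,I}^{\,n}(n!)^s$ for all $n\in\mathbb N=\{0,1,2,\dots\}$. $M_u=M_{u,\bar\Omega}$, and $C_{u,\bar\Omega_j}$ is the constant on $\bar\Omega_j$, used with $M_{u,\bar\Omega_j}\le M_u$. Partition-of-unity assumption: $\Omega_j:=(\operatorname{supp}\phi_j)^\circ$ are open intervals in $\Omega$, $r_j:=\operatorname{diam}(\Omega_j)/2$, $x_j$ the center of $\Omega_j$; (1) $\sum_j\phi_j\equiv1$ on $\Omega$; (2) $\sup_{x\in\Omega}\operatorname{card}\{j:x\in\Omega_j\}\le M$; (3) $\|D^k\phi_j\|_{L^\infty(\Omega_j)}\le C_\phi r_j^{-k}$ for integers $0\le k\le m$, with $C_\phi$ independent of $j$. Sampling assumption with parameters $\mu,\varpi$: the law of $k_1$ is a Borel probability measure on $\mathbb R$, absolutely continuous with respect to Lebesgue measure, $\mu:=\sqrt{\mathbb E|k_1|^2}<\infty$, and, with $\pi$ the density of $|k_1|/\mu$, $\varpi:=\max\{1,\sup_{x>0}\max(1,x^3)\pi(x)\}<\infty$. The function $\mathcal Q$: for $k>0$, $w\ge0$, $c>2$, with $a=\max(k-1/2,0)$, $b=a+1$, put $\mathcal Q(k;w)=\varpi^{\frac{c}{c-1}}\max\bigl(\frac{1+w^2}{2(k^2-1)}+\frac{w^2}{2k^2},\frac{28(1+w^2)}{23k^2}\bigr)$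 if $k>4/3$, and $\mathcal Q(k;w)=2\varpi^{\frac{c}{c-1}}\max\bigl(\frac{w^2+a^2}{k+a},\frac{w^2+b^2}{k+b},\frac{w^2+1}{k+1}\bigr)$ if $k\le4/3$. The random operator $\mathcal R_N[\{k_i\},\mu,C,c]$ ($C\ge0$, $c>2$): let $E_i=\bigl\{\prod_{j\ne i}\frac{C^2+k_j^2}{|k_i^2-k_j^2|}<[e^c\mathcal Q(|k_i|/\mu;C/\mu)]^{N-1}\bigr\}$ and $E=\bigcap_{i=1}^NE_i$ (for $N=1$, $E$ is the sure event). Let $\mathbf V_N=((-k_j^2)^{i-1})_{1\le i,j\le N}$, $\mathbf K=\mathrm{diag}(k_1,\dots,k_N)$ (almost surely invertible), and for $v$ smooth near $0$ let $(\mathscr T_ev)_i=v^{(2i-2)}(0)$, $(\mathscr T_ov)_i=v^{(2i-1)}(0)$, $1\le i\le N$. Put $X=\mathbf V_N^{-1}\mathscr T_ev$, $Y=\mathbf K^{-1}\mathbf V_N^{-1}\mathscr T_ov$. Then $$(\mathcal R_N[\{k_i\},\mu,C,c]v)(x)=\mathbf 1_{E}\sum_{i=1}^N\bigl(X_i\cos(k_ix)+Y_i\sin(k_ix)\bigr).$$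
   Formalization: Each φ_j is also assumed to vanish a.e. outside Ω_j: automatic for m≥1; for m=0 the claim fails without it (supp φ_j may include a fat Cantor set off Ω_j). The constant is stated per underlying sample set; passing to the joint law of the k_{j,q} gives one for all. *)

theory Defs
  imports
    "HOL-Probability.Probability"
    "Jordan_Normal_Form.Gauss_Jordan_Elimination"
begin

section \<open>Gevrey classes\<close>

text \<open>On a compact interval \<open>I\<close> the derivative is taken within \<open>I\<close>, hence one-sided at the endpoints.\<close>

definition deriv_on :: "real set \<Rightarrow> (real \<Rightarrow> real) \<Rightarrow> real \<Rightarrow> real" where
  "deriv_on I f = (\<lambda>x. vector_derivative f (at x within I))"

definition smooth_on :: "real set \<Rightarrow> (real \<Rightarrow> real) \<Rightarrow> bool" where
  "smooth_on I f \<longleftrightarrow> (\<forall>n. (deriv_on I ^^ n) f differentiable_on I)"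

definition gevrey_const :: "real \<Rightarrow> real set \<Rightarrow> (real \<Rightarrow> real) \<Rightarrow> real \<Rightarrow> real \<Rightarrow> bool" where
  "gevrey_const s I f M C \<longleftrightarrow> M > 0 \<and> C > 0 \<and>
     (\<forall>n. \<forall>x\<in>I. \<bar>(deriv_on I ^^ n) f x\<bar> \<le> M * C ^ n * fact n powr s)"

definition gevrey :: "real \<Rightarrow> real set \<Rightarrow> (real \<Rightarrow> real) set" where
  "gevrey s I = {f. smooth_on I f \<and> (\<exists>M C. gevrey_const s I f M C)}"

section \<open>Sobolev spaces\<close>

definition test_function :: "real set \<Rightarrow> (real \<Rightarrow> real) \<Rightarrow> bool" where
  "test_function S \<psi> \<longleftrightarrow> (\<forall>n. (deriv ^^ n) \<psi> differentiable_on UNIV) \<and>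
     (\<exists>K. compact K \<and> K \<subseteq> S \<and> (\<forall>x. x \<notin> K \<longrightarrow> \<psi> x = 0))"

definition locally_integrable_on :: "real set \<Rightarrow> (real \<Rightarrow> real) \<Rightarrow> bool" where
  "locally_integrable_on S f \<longleftrightarrow> (\<forall>K. compact K \<and> K \<subseteq> S \<longrightarrow> integrable (lebesgue_on K) f)"

definition has_weak_deriv :: "real set \<Rightarrow> nat \<Rightarrow> (real \<Rightarrow> real) \<Rightarrow> (real \<Rightarrow> real) \<Rightarrow> bool" where
  "has_weak_deriv S k f g \<longleftrightarrow> locally_integrable_on S f \<and> locally_integrable_on S g \<and>
     (\<forall>\<psi>. test_function S \<psi> \<longrightarrow>
        (LINT x|lebesgue_on S. f x * (deriv ^^ k) \<psi> x) = (-1) ^ k * (LINT x|lebesgue_on S. g x * \<psi> x))"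

text \<open>Weak derivatives are unique up to null sets, so the choice does not affect the norms below.\<close>

definition weak_deriv :: "real set \<Rightarrow> nat \<Rightarrow> (real \<Rightarrow> real) \<Rightarrow> real \<Rightarrow> real" where
  "weak_deriv S k f = (SOME g. has_weak_deriv S k f g)"

definition Linf_norm :: "real set \<Rightarrow> (real \<Rightarrow> real) \<Rightarrow> ennreal" where
  "Linf_norm S f = esssup (lebesgue_on S) (\<lambda>x. ennreal \<bar>f x\<bar>)"

definition ennreal_root :: "real \<Rightarrow> ennreal \<Rightarrow> ennreal" where
  "ennreal_root q z = (if z = \<top> then \<top> else ennreal (enn2real z powr (1 / q)))"

text \<open>The norm of \<open>W\<^sup>m\<^sup>,\<^sup>p(S)\<close>, with value \<open>\<top>\<close> outside of the space; \<open>p = \<top>\<close> encodes \<open>p = \<infinity>\<close>.\<close>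

definition sobolev_norm :: "nat \<Rightarrow> ennreal \<Rightarrow> real set \<Rightarrow> (real \<Rightarrow> real) \<Rightarrow> ennreal" where
  "sobolev_norm m p S f =
     (if \<forall>k\<le>m. \<exists>g. has_weak_deriv S k f g then
        if p = \<top> then Max ((\<lambda>k. Linf_norm S (weak_deriv S k f)) ` {..m})
        else ennreal_root (enn2real p)
          (\<Sum>k\<le>m. \<integral>\<^sup>+ x. ennreal (\<bar>weak_deriv S k f x\<bar> powr enn2real p) \<partial>lebesgue_on S)
      else \<top>)"

definition sobolev_space :: "nat \<Rightarrow> ennreal \<Rightarrow> real set \<Rightarrow> (real \<Rightarrow> real) set" where
  "sobolev_space m p S = {f. sobolev_norm m p S f < \<top>}"

section \<open>Partition of unity\<close>

text \<open>
  For \<open>m \<ge> 1\<close> the third clause follows from \<open>\<phi> j \<in> W\<^sup>m\<^sup>,\<^sup>\<infinity>(\<Omega>)\<close>, as \<open>\<phi> j\<close> then has a continuous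
  representative. For \<open>m = 0\<close> it excludes that the support of \<open>\<phi> j\<close> is, outside of the patch, a nowhere
  dense set of positive measure (e.g. a fat Cantor set), where \<open>\<phi> j\<close> would not be controlled at all.
\<close>

definition partition_of_unity_assumption ::
  "nat \<Rightarrow> real set \<Rightarrow> nat \<Rightarrow> (nat \<Rightarrow> real \<Rightarrow> real) \<Rightarrow> (nat \<Rightarrow> real set) \<Rightarrow> (nat \<Rightarrow> real) \<Rightarrow> (nat \<Rightarrow> real)
    \<Rightarrow> nat \<Rightarrow> real \<Rightarrow> bool" where
  "partition_of_unity_assumption m \<Omega> J \<phi> patch ctr r M C\<^sub>\<phi> \<longleftrightarrow>
     (\<forall>j<J. \<phi> j \<in> sobolev_space m \<top> \<Omega>) \<and>
     (\<forall>j<J. patch j = interior (closure {x \<in> \<Omega>. \<phi> j x \<noteq> 0}) \<and> patch j \<noteq> {} \<and>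
            r j = diameter (patch j) / 2 \<and> patch j = ball (ctr j) (r j)) \<and>
     (\<forall>j<J. AE x in lebesgue_on \<Omega>. x \<notin> patch j \<longrightarrow> \<phi> j x = 0) \<and>
     (\<forall>x\<in>\<Omega>. (\<Sum>j<J. \<phi> j x) = 1) \<and>
     (\<forall>x\<in>\<Omega>. card {j. j < J \<and> x \<in> patch j} \<le> M) \<and>
     (\<forall>j<J. \<forall>k\<le>m. Linf_norm (patch j) (weak_deriv \<Omega> k (\<phi> j)) \<le> ennreal (C\<^sub>\<phi> / r j ^ k))"

section \<open>Sampling\<close>

text \<open>
  A density is only determined up to null sets; the condition asks for some version \<open>\<pi>\<close> of it for which the
  supremum defining \<open>varpi\<close> has the stated value. It forces this supremum to be finite.
\<close>

definition sampling_assumption :: "real measure \<Rightarrow> real \<Rightarrow> real \<Rightarrow> bool" where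
  "sampling_assumption D \<mu> varpi \<longleftrightarrow>
     prob_space D \<and> sets D = sets borel \<and> absolutely_continuous lborel D \<and>
     integrable D (\<lambda>k. k\<^sup>2) \<and> \<mu> = sqrt (LINT k|D. k\<^sup>2) \<and>
     (\<exists>\<pi>. distributed D lborel (\<lambda>k. \<bar>k\<bar> / \<mu>) \<pi> \<and>
          ennreal varpi = max 1 (SUP x\<in>{0<..}. ennreal (max 1 (x ^ 3)) * \<pi> x))"

section \<open>The random operator\<close>

definition Q_fun :: "real \<Rightarrow> real \<Rightarrow> real \<Rightarrow> real \<Rightarrow> real" where
  "Q_fun varpi c k w =
     (let a = max (k - 1/2) 0; b = a + 1 in
      if k > 4/3 then
        varpi powr (c / (c - 1)) *
          max ((1 + w\<^sup>2) / (2 * (k\<^sup>2 - 1)) + w\<^sup>2 / (2 * k\<^sup>2)) (28 * (1 + w\<^sup>2) / (23 * k\<^sup>2))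
      else
        2 * varpi powr (c / (c - 1)) *
          max ((w\<^sup>2 + a\<^sup>2) / (k + a)) (max ((w\<^sup>2 + b\<^sup>2) / (k + b)) ((w\<^sup>2 + 1) / (k + 1))))"

text \<open>Indices start at \<open>0\<close> from here on, so the exponents \<open>i - 1\<close>, \<open>2i - 2\<close>, \<open>2i - 1\<close> of the
  one-based notation become \<open>i\<close>, \<open>2i\<close>, \<open>2i + 1\<close>.\<close>

definition good_event :: "real \<Rightarrow> nat \<Rightarrow> (nat \<Rightarrow> real) \<Rightarrow> real \<Rightarrow> real \<Rightarrow> real \<Rightarrow> bool" where
  "good_event varpi N k \<mu> C c \<longleftrightarrow> N = 1 \<or>
     (\<forall>i<N. (\<Prod>j\<in>{..<N} - {i}. (C\<^sup>2 + (k j)\<^sup>2) / \<bar>(k i)\<^sup>2 - (k j)\<^sup>2\<bar>)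
              < (exp c * Q_fun varpi c (\<bar>k i\<bar> / \<mu>) (C / \<mu>)) ^ (N - 1))"

text \<open>Singular matrices occur with probability zero only. They get the inverse \<open>0\<close>; in particular the
  operator vanishes at ties \<open>(k i)\<^sup>2 = (k j)\<^sup>2\<close>, where the quotient in the event is a division by zero.\<close>

definition mat_inv :: "real mat \<Rightarrow> real mat" where
  "mat_inv A = (case mat_inverse A of Some B \<Rightarrow> B | None \<Rightarrow> 0\<^sub>m (dim_row A) (dim_row A))"

definition V_mat :: "nat \<Rightarrow> (nat \<Rightarrow> real) \<Rightarrow> real mat" where
  "V_mat N k = Matrix.mat N N (\<lambda>(i, j). (- (k j)\<^sup>2) ^ i)"

definition K_mat :: "nat \<Rightarrow> (nat \<Rightarrow> real) \<Rightarrow> real mat" where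
  "K_mat N k = mat_diag N k"

definition T_even :: "nat \<Rightarrow> (real \<Rightarrow> real) \<Rightarrow> real Matrix.vec" where
  "T_even N v = Matrix.vec N (\<lambda>i. (deriv ^^ (2 * i)) v 0)"

definition T_odd :: "nat \<Rightarrow> (real \<Rightarrow> real) \<Rightarrow> real Matrix.vec" where
  "T_odd N v = Matrix.vec N (\<lambda>i. (deriv ^^ (2 * i + 1)) v 0)"

definition X_coeff :: "nat \<Rightarrow> (nat \<Rightarrow> real) \<Rightarrow> (real \<Rightarrow> real) \<Rightarrow> real Matrix.vec" where
  "X_coeff N k v = mat_inv (V_mat N k) *\<^sub>v T_even N v"

definition Y_coeff :: "nat \<Rightarrow> (nat \<Rightarrow> real) \<Rightarrow> (real \<Rightarrow> real) \<Rightarrow> real Matrix.vec" where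
  "Y_coeff N k v = mat_inv (K_mat N k) *\<^sub>v (mat_inv (V_mat N k) *\<^sub>v T_odd N v)"

definition rf_operator ::
  "real \<Rightarrow> nat \<Rightarrow> (nat \<Rightarrow> real) \<Rightarrow> real \<Rightarrow> real \<Rightarrow> real \<Rightarrow> (real \<Rightarrow> real) \<Rightarrow> real \<Rightarrow> real" where
  "rf_operator varpi N k \<mu> C c v x =
     (if good_event varpi N k \<mu> C c then
        (\<Sum>i<N. vec_index (X_coeff N k v) i * cos (k i * x) + vec_index (Y_coeff N k v) i * sin (k i * x))
      else 0)"

definition u_RF ::
  "nat \<Rightarrow> (nat \<Rightarrow> real \<Rightarrow> real) \<Rightarrow> (nat \<Rightarrow> real) \<Rightarrow> real \<Rightarrow> (nat \<Rightarrow> nat) \<Rightarrow> (nat \<Rightarrow> nat \<Rightarrow> real)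
    \<Rightarrow> (nat \<Rightarrow> real) \<Rightarrow> (nat \<Rightarrow> real) \<Rightarrow> (nat \<Rightarrow> real) \<Rightarrow> (real \<Rightarrow> real) \<Rightarrow> real \<Rightarrow> real" where
  "u_RF J \<phi> ctr varpi N k \<mu> C c u x =
     (\<Sum>j<J. \<phi> j x *
        rf_operator varpi (N j) (k j) (\<mu> j) (C j) (c j) (\<lambda>y. u (y + ctr j)) (x - ctr j))"

end

theory Submission
  imports Defs "Jordan_Normal_Form.Determinant"
begin

text \<open>
  On the good event the random feature function interpolates the derivatives of \<open>u\<close> at the center of a
  patch up to order \<open>2N - 1\<close>. Its coefficients are sums against the coefficients of the Lagrange polynomials
  for the nodes \<open>- k\<^sub>j\<^sup>2\<close>; these have constant sign up to a common factor, so the sum of their moduli is a value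
  of the polynomial, namely the product that defines the good event. Hence the event bounds the
  coefficients, and Taylor's theorem bounds the error. The bound has finite expectation because \<open>Q\<close> decays
  quadratically. The complement of the event is estimated by Markov's inequality for the power
  \<open>q = 1 - 1 / c\<close> of the product: given one frequency the factors are independent, and the moment of order
  \<open>q\<close> of a factor is at most a multiple of \<open>c Q ^ q\<close>, where \<open>c = 1 / (1 - q)\<close> comes from the integral of
  \<open>\<bar>t\<bar> powr (- q)\<close>. The patches are put together by Leibniz' rule for weak derivatives, whose uniqueness
  also shows that the norm is a measurable function of the sample.
\<close>

section \<open>Smooth functions and Leibniz' rule\<close>

text \<open>A factor of the node product has a pole of order one, which is not integrable in
  general. So Markov's inequality is applied with an exponent \<open>q < 1\<close>, and
  \<open>1 / (1 - q)\<close> is the price of approaching \<open>1\<close>. The exponent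
  \<open>c / (c - 1)\<close> of \<open>varpi\<close> in \<open>Q\<close> equals
  \<open>1 / q\<close>: the power \<open>q\<close> leaves one factor \<open>varpi\<close>, which
  cancels the bound on the density. Up to constants depending on \<open>N\<close>, the complement of
  the event then has probability \<open>(c * exp (- c)) ^ (N - 1)\<close>, and the error on the
  event is \<open>exp (c * (N - 1)) * A ^ (2 * N)\<close>. The equation
  \<open>exp (c * (N - 1)) = A powr (- N)\<close> brings both to \<open>A ^ N\<close>, except for
  \<open>c ^ (N - 1)\<close>, which is the source of the power of \<open>|ln A|\<close>. The
  condition \<open>A \<le> exp (-2)\<close> yields \<open>c > 2\<close>. The weight
  \<open>t ^ 3\<close> in the definition of \<open>varpi\<close> serves large frequencies: near the
  pole it gives a density of order \<open>k powr (- 3)\<close>, and integration over an interval of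
  length comparable to \<open>k\<close> then matches the decay of \<open>Q\<close>.\<close>

text \<open>All derivatives are carried as one family, so that products and translations are treated
  for all orders at once, without computing \<open>deriv ^^ n\<close>. The derivative is taken at
  \<open>x\<close>, not within \<open>S\<close>, hence is two-sided.\<close>

definition deriv_seq :: "real set \<Rightarrow> (nat \<Rightarrow> real \<Rightarrow> real) \<Rightarrow> bool" where
  "deriv_seq S f \<longleftrightarrow> (\<forall>n. \<forall>x\<in>S. (f n has_real_derivative f (Suc n) x) (at x))"

lemma deriv_seqD: "deriv_seq S f \<Longrightarrow> x \<in> S \<Longrightarrow> (f n has_real_derivative f (Suc n) x) (at x)"
  by (simp add: deriv_seq_def)

lemma deriv_seq_subset: "deriv_seq S f \<Longrightarrow> T \<subseteq> S \<Longrightarrow> deriv_seq T f"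
  by (auto simp: deriv_seq_def)

lemma deriv_seq_shift: "deriv_seq S f \<Longrightarrow> deriv_seq S (\<lambda>n. f (n + l))"
  by (auto simp: deriv_seq_def)

lemma deriv_seq_continuous_on: "deriv_seq S f \<Longrightarrow> continuous_on S (f n)"
  by (meson DERIV_isCont continuous_at_imp_continuous_on deriv_seqD)

text \<open>\<open>deriv\<close> at a point depends only on nearby values, so \<open>g\<close> may
  differ from \<open>f 0\<close> outside the open set.\<close>

lemma deriv_seq_iterate:
  assumes S: "open S" and f: "deriv_seq S f" and g: "\<And>x. x \<in> S \<Longrightarrow> f 0 x = g x" and "x \<in> S"
  shows "(deriv ^^ n) g x = f n x"
  using assms(4)
proof (induction n arbitrary: x)
  case (Suc n)
  have "((deriv ^^ n) g has_real_derivative f (Suc n) x) (at x)"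
    by (rule has_field_derivative_transform_within_open[OF deriv_seqD[OF f Suc.prems] S Suc.prems])
       (simp add: Suc.IH)
  then show ?case by (simp add: DERIV_imp_deriv)
qed (simp add: g)

lemma deriv_seq_deriv:
  assumes "open S" "\<And>n. (deriv ^^ n) f differentiable_on S"
  shows "deriv_seq S (\<lambda>n. (deriv ^^ n) f)"
  unfolding deriv_seq_def
proof (intro allI ballI)
  fix n x assume x: "x \<in> S"
  have "(deriv ^^ n) f differentiable at x"
    using assms x by (simp add: differentiable_on_eq_differentiable_at)
  then show "((deriv ^^ n) f has_real_derivative (deriv ^^ Suc n) f x) (at x)"
    by (simp add: DERIV_deriv_iff_real_differentiable)
qed

section \<open>Leibniz' rule and its inversion\<close>

text \<open>Pascal's rule. With \<open>a p l\<close> read as a product carrying \<open>p\<close>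
  derivatives on one factor and \<open>l\<close> on the other, it is the induction step shared by
  Leibniz' rule and its inversion.\<close>

lemma sum_binomial_Suc:
  fixes a :: "nat \<Rightarrow> nat \<Rightarrow> real"
  shows "(\<Sum>l\<le>n. real (n choose l) * (a (Suc (n - l)) l + a (n - l) (Suc l)))
       = (\<Sum>l\<le>Suc n. real (Suc n choose l) * a (Suc n - l) l)"
proof -
  have "(\<Sum>l\<le>Suc n. real (Suc n choose l) * a (Suc n - l) l)
      = a (Suc n) 0 + (\<Sum>l\<le>n. (real (n choose l) + real (n choose Suc l)) * a (n - l) (Suc l))"
    by (subst sum.atMost_Suc_shift) simp
  also have "\<dots> = (\<Sum>l\<le>n. real (n choose l) * a (n - l) (Suc l))
       + (a (Suc n) 0 + (\<Sum>l\<le>n. real (n choose Suc l) * a (n - l) (Suc l)))"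
    by (simp add: algebra_simps sum.distrib)
  also have "a (Suc n) 0 + (\<Sum>l\<le>n. real (n choose Suc l) * a (n - l) (Suc l))
       = (\<Sum>l\<le>Suc n. real (n choose l) * a (Suc n - l) l)"
    by (subst sum.atMost_Suc_shift) simp
  also have "\<dots> = (\<Sum>l\<le>n. real (n choose l) * a (Suc (n - l)) l)"
    by (simp add: Suc_diff_le)
  finally show ?thesis by (simp add: algebra_simps sum.distrib)
qed

definition leibniz :: "(nat \<Rightarrow> real \<Rightarrow> real) \<Rightarrow> (nat \<Rightarrow> real \<Rightarrow> real) \<Rightarrow> nat \<Rightarrow> real \<Rightarrow> real" where
  "leibniz f g n x = (\<Sum>l\<le>n. real (n choose l) * (f (n - l) x * g l x))"

lemma leibniz_0 [simp]: "leibniz f g 0 x = f 0 x * g 0 x"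
  by (simp add: leibniz_def)

lemma deriv_seq_mult:
  assumes "deriv_seq S f" "deriv_seq S g"
  shows "deriv_seq S (leibniz f g)"
  unfolding deriv_seq_def
proof (intro allI ballI)
  fix n x assume x: "x \<in> S"
  have "((\<lambda>x. \<Sum>l\<le>n. real (n choose l) * (f (n - l) x * g l x)) has_real_derivative
     (\<Sum>l\<le>n. real (n choose l) * (f (Suc (n - l)) x * g l x + f (n - l) x * g (Suc l) x))) (at x)"
    by (auto intro!: derivative_eq_intros deriv_seqD[OF assms(1) x] deriv_seqD[OF assms(2) x]
        sum.cong simp: mult.commute add.commute)
  also have "(\<Sum>l\<le>n. real (n choose l) * (f (Suc (n - l)) x * g l x + f (n - l) x * g (Suc l) x))
      = leibniz f g (Suc n) x"
    unfolding leibniz_def by (rule sum_binomial_Suc[of n "\<lambda>p l. f p x * g l x"])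
  finally show "(leibniz f g n has_real_derivative leibniz f g (Suc n) x) (at x)"
    by (simp add: leibniz_def[abs_def])
qed

text \<open>For functions this says that \<open>w \<psi>^(n)\<close> is the sum of
  \<open>(-1)^l (n choose l) (w^(l) \<psi>)^(n-l)\<close>, the inner derivatives being expanded.
  Only derivatives of the whole products \<open>w^(l) \<psi>\<close> remain, and these products are
  test functions.\<close>

lemma leibniz_inverse:
  fixes w \<psi> :: "nat \<Rightarrow> real"
  shows "w 0 * \<psi> n = (\<Sum>l\<le>n. real (n choose l) *
           ((-1) ^ l * (\<Sum>i\<le>n - l. real ((n - l) choose i) * (w (l + (n - l - i)) * \<psi> i))))"
proof (induction n arbitrary: \<psi>)
  case (Suc n)
  define L where "L = (\<lambda>\<psi> k l. \<Sum>i\<le>k. real (k choose i) * (w (l + (k - i)) * \<psi> i :: real))"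
  \<comment> \<open>Product rule: \<open>w^(l) \<psi>'\<close> is the derivative of
    \<open>w^(l) \<psi>\<close> minus \<open>w^(l+1) \<psi>\<close>, here after \<open>k\<close>
    further derivatives.\<close>
  have L: "L (\<lambda>i. \<psi> (Suc i)) k l = L \<psi> (Suc k) l - L \<psi> k (Suc l)" for k l
  proof -
    have "L \<psi> (Suc k) l = (\<Sum>i\<le>k. real (k choose i) * (w (l + Suc (k - i)) * \<psi> i + w (l + (k - i)) * \<psi> (Suc i)))"
      unfolding L_def by (rule sum_binomial_Suc[of k "\<lambda>p i. w (l + p) * \<psi> i", symmetric])
    also have "\<dots> = L \<psi> k (Suc l) + L (\<lambda>i. \<psi> (Suc i)) k l"
      unfolding L_def by (simp add: distrib_left sum.distrib)
    finally show ?thesis by simp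
  qed
  have "w 0 * \<psi> (Suc n) = (\<Sum>l\<le>n. real (n choose l) * ((-1) ^ l * L (\<lambda>i. \<psi> (Suc i)) (n - l) l))"
    using Suc.IH[of "\<lambda>i. \<psi> (Suc i)"] by (simp add: L_def)
  also have "\<dots> = (\<Sum>l\<le>n. real (n choose l) * ((-1) ^ l * L \<psi> (Suc (n - l)) l
        + (-1) ^ Suc l * L \<psi> (n - l) (Suc l)))"
    unfolding L by (intro sum.cong) (auto simp: algebra_simps)
  also have "\<dots> = (\<Sum>l\<le>Suc n. real (Suc n choose l) * ((-1) ^ l * L \<psi> (Suc n - l) l))"
    by (rule sum_binomial_Suc[of n "\<lambda>p l. (-1) ^ l * L \<psi> p l"])
  finally show ?case by (simp add: L_def)
qed simp

section \<open>Test functions\<close>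

lemma test_functionD:
  assumes "test_function S \<psi>"
  shows "deriv_seq UNIV (\<lambda>n. (deriv ^^ n) \<psi>)"
    and "\<exists>K. compact K \<and> K \<subseteq> S \<and> (\<forall>n x. x \<notin> K \<longrightarrow> (deriv ^^ n) \<psi> x = 0)"
proof -
  show "deriv_seq UNIV (\<lambda>n. (deriv ^^ n) \<psi>)"
    by (rule deriv_seq_deriv) (use assms in \<open>auto simp: test_function_def\<close>)
  obtain K where K: "compact K" "K \<subseteq> S" "\<And>x. x \<notin> K \<Longrightarrow> \<psi> x = 0"
    using assms by (auto simp: test_function_def)
  have "(deriv ^^ n) \<psi> x = 0" if "x \<notin> K" for n x
    using deriv_seq_iterate[of "- K" "\<lambda>_ _. 0" \<psi> x n] K that
    by (auto simp: deriv_seq_def open_Compl compact_imp_closed)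
  with K show "\<exists>K. compact K \<and> K \<subseteq> S \<and> (\<forall>n x. x \<notin> K \<longrightarrow> (deriv ^^ n) \<psi> x = 0)" by blast
qed

lemma test_functionI:
  assumes "deriv_seq UNIV f" "compact K" "K \<subseteq> S" "\<And>x. x \<notin> K \<Longrightarrow> f 0 x = 0"
  shows "test_function S (f 0)"
proof -
  have "(deriv ^^ n) (f 0) = f n" for n
    using deriv_seq_iterate[OF open_UNIV assms(1)] by auto
  then have "(deriv ^^ n) (f 0) differentiable_on UNIV" for n
    using assms(1) by (auto simp: deriv_seq_def differentiable_on_def real_differentiable_def)
  then show ?thesis using assms(2-4) unfolding test_function_def by blast
qed

lemma test_function_mult:
  assumes S: "open S" and w: "deriv_seq S w" and \<psi>: "test_function S \<psi>"
  shows "test_function S (\<lambda>x. w 0 x * \<psi> x)"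
    and "x \<in> S \<Longrightarrow> (deriv ^^ n) (\<lambda>x. w 0 x * \<psi> x) x = leibniz w (\<lambda>n. (deriv ^^ n) \<psi>) n x"
proof -
  note seq = test_functionD(1)[OF \<psi>]
  obtain K where K: "compact K" "K \<subseteq> S" "\<And>n x. x \<notin> K \<Longrightarrow> (deriv ^^ n) \<psi> x = 0"
    using test_functionD(2)[OF \<psi>] by blast
  let ?L = "leibniz w (\<lambda>n. (deriv ^^ n) \<psi>)"
  have zero: "?L n x = 0" if "x \<notin> K" for n x
    using K(3)[OF that] by (simp add: leibniz_def)
  have "deriv_seq S ?L"
    by (rule deriv_seq_mult[OF w deriv_seq_subset[OF seq]]) simp
  \<comment> \<open>Nothing is known about \<open>w\<close> outside \<open>S\<close>, but off the
    support \<open>K\<close> the product is identically \<open>0\<close>; the open sets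
    \<open>S\<close> and \<open>- K\<close> cover the line.\<close>
  moreover have "deriv_seq (- K) ?L"
    unfolding deriv_seq_def
  proof (intro allI ballI)
    fix n x assume x: "x \<in> - K"
    have "((\<lambda>_. 0) has_real_derivative ?L (Suc n) x) (at x)"
      using zero[of x "Suc n"] x by simp
    then show "(?L n has_real_derivative ?L (Suc n) x) (at x)"
      by (rule has_field_derivative_transform_within_open[of _ _ _ "- K"])
         (use x K zero in \<open>auto simp: open_Compl compact_imp_closed\<close>)
  qed
  ultimately have *: "deriv_seq UNIV ?L"
    using K(2) unfolding deriv_seq_def by (metis ComplI UNIV_I subsetD)
  have **: "?L 0 = (\<lambda>x. w 0 x * \<psi> x)" by (simp add: fun_eq_iff)
  show "test_function S (\<lambda>x. w 0 x * \<psi> x)"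
    using test_functionI[OF * K(1,2)] zero unfolding ** by (metis **)
  show "(deriv ^^ n) (\<lambda>x. w 0 x * \<psi> x) x = ?L n x" if "x \<in> S"
    by (rule deriv_seq_iterate[OF open_UNIV *]) auto
qed

lemma mult_deriv_test_function:
  assumes S: "open S" and w: "deriv_seq S w" and \<psi>: "test_function S \<psi>" and x: "x \<in> S"
  shows "w 0 x * (deriv ^^ n) \<psi> x =
     (\<Sum>l\<le>n. real (n choose l) * ((-1) ^ l * (deriv ^^ (n - l)) (\<lambda>x. w l x * \<psi> x) x))"
proof -
  have "(deriv ^^ k) (\<lambda>x. w l x * \<psi> x) x = (\<Sum>i\<le>k. real (k choose i) * (w (l + (k - i)) x * (deriv ^^ i) \<psi> x))" for k l
    using test_function_mult(2)[OF S deriv_seq_shift[OF w, of l] \<psi> x, of k]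
    by (simp add: leibniz_def add.commute)
  then show ?thesis
    using leibniz_inverse[of "\<lambda>n. w n x" "\<lambda>n. (deriv ^^ n) \<psi> x" n] by simp
qed

lemma test_function_mono: "test_function S \<psi> \<Longrightarrow> S \<subseteq> T \<Longrightarrow> test_function T \<psi>"
  unfolding test_function_def by blast


section \<open>Smooth bump functions\<close>

text \<open>Differentiation keeps this form and replaces \<open>p\<close> by
  \<open>X^2 (p - p')\<close>, so the family is closed under it and all orders are covered by one
  computation.\<close>

definition flat :: "real poly \<Rightarrow> real \<Rightarrow> real" where
  "flat p x = (if x > 0 then poly p (1 / x) * exp (- (1 / x)) else 0)"

lemma flat_tendsto_0: "((\<lambda>x. poly p (1 / x) * exp (- (1 / x))) \<longlongrightarrow> 0) (at_right (0::real))"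
proof -
  have "((\<lambda>x. \<Sum>i\<le>degree p. coeff p i * (x ^ i / exp x)) \<longlongrightarrow> (\<Sum>i\<le>degree p. coeff p i * 0)) at_top"
    by (intro tendsto_intros tendsto_power_div_exp_0)
  moreover have "(\<lambda>x. \<Sum>i\<le>degree p. coeff p i * (x ^ i / exp x)) = (\<lambda>x. poly p x * exp (- x))"
    by (auto simp: poly_altdef exp_minus field_simps sum_distrib_left sum_distrib_right)
  ultimately have "((\<lambda>x. poly p x * exp (- x)) \<longlongrightarrow> 0) at_top"
    by simp
  then have "((\<lambda>x. poly p (inverse x) * exp (- inverse x)) \<longlongrightarrow> 0) (at_right (0::real))"
    by (rule filterlim_compose[OF _ filterlim_inverse_at_top_right])
  then show ?thesis by (simp add: inverse_eq_divide)
qed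

lemma flat_has_derivative:
  "(flat p has_real_derivative flat ([:0, 0, 1:] * (p - pderiv p)) x) (at x)"
proof -
  consider "x > 0" | "x < 0" | "x = 0" by linarith
  then show ?thesis
  proof cases
    case 1
    have "((\<lambda>x. poly p (1 / x) * exp (- (1 / x))) has_real_derivative
       flat ([:0, 0, 1:] * (p - pderiv p)) x) (at x)"
      using 1 by (auto intro!: derivative_eq_intros simp: flat_def field_simps power2_eq_square)
    then show ?thesis
      by (rule has_field_derivative_transform_within_open[of _ _ _ "{0<..}"]) (use 1 in \<open>auto simp: flat_def\<close>)
  next
    case 2
    have "((\<lambda>x. 0) has_real_derivative flat ([:0, 0, 1:] * (p - pderiv p)) x) (at x)"
      using 2 by (simp add: flat_def)
    then show ?thesis
      by (rule has_field_derivative_transform_within_open[of _ _ _ "{..<0}"]) (use 2 in \<open>auto simp: flat_def\<close>)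
  next
    case 3
    \<comment> \<open>To the right of \<open>0\<close> the difference quotient is again of the form
      \<open>flat\<close>, with polynomial \<open>X p\<close>.\<close>
    have "((\<lambda>h. flat p h / h) \<longlongrightarrow> 0) (at_right 0)"
      by (rule tendsto_cong[THEN iffD1, OF _ flat_tendsto_0[of "[:0, 1:] * p"]])
         (rule eventually_mono[OF eventually_at_right_less[of 0]], simp add: flat_def)
    moreover have "((\<lambda>h. flat p h / h) \<longlongrightarrow> 0) (at_left 0)"
      by (rule tendsto_cong[THEN iffD1, OF _ tendsto_const])
         (auto simp: eventually_at_filter flat_def)
    ultimately have "((\<lambda>h. flat p h / h) \<longlongrightarrow> 0) (at 0)"
      by (simp add: filterlim_split_at)
    then show ?thesis
      using 3 by (simp add: DERIV_def flat_def)
  qed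
qed

lemma deriv_seq_affine:
  assumes "deriv_seq UNIV f"
  shows "deriv_seq UNIV (\<lambda>n x. \<alpha> ^ n * f n (\<alpha> * x + \<beta>))"
  unfolding deriv_seq_def
proof (intro allI ballI)
  fix n x
  have "((\<lambda>x. f n (\<alpha> * x + \<beta>)) has_real_derivative f (Suc n) (\<alpha> * x + \<beta>) * \<alpha>) (at x)"
    by (rule DERIV_chain2[OF deriv_seqD[OF assms]]) (auto intro!: derivative_eq_intros)
  from DERIV_cmult[OF this, of "\<alpha> ^ n"]
  show "((\<lambda>x. \<alpha> ^ n * f n (\<alpha> * x + \<beta>)) has_real_derivative \<alpha> ^ Suc n * f (Suc n) (\<alpha> * x + \<beta>)) (at x)"
    by (simp add: mult_ac)
qed

text \<open>\<open>n\<close> controls the steepness: the values stay in \<open>[0, 1]\<close> and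
  tend pointwise to the indicator of the open interval, which suits dominated convergence.\<close>

definition bump :: "real \<Rightarrow> real \<Rightarrow> nat \<Rightarrow> real \<Rightarrow> real" where
  "bump a b n x = flat 1 (real n * (x - a)) * flat 1 (real n * (b - x))"

lemma flat_1_bounds: "0 \<le> flat 1 x" "flat 1 x \<le> 1"
  by (auto simp: flat_def)

lemma test_function_bump:
  assumes "{a..b} \<subseteq> S"
  shows "test_function S (bump a b n)"
proof -
  define \<theta> where "\<theta> = (\<lambda>n. flat (((\<lambda>p. [:0, 0, 1:] * (p - pderiv p)) ^^ n) 1))"
  have \<theta>: "deriv_seq UNIV \<theta>"
    unfolding \<theta>_def deriv_seq_def using flat_has_derivative by auto
  let ?f = "leibniz (\<lambda>k x. real n ^ k * \<theta> k (real n * x + - real n * a))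
       (\<lambda>k x. (- real n) ^ k * \<theta> k (- real n * x + real n * b))"
  have "deriv_seq UNIV ?f"
    by (intro deriv_seq_mult deriv_seq_affine \<theta>)
  moreover have "?f 0 = bump a b n"
    by (auto simp: fun_eq_iff \<theta>_def bump_def algebra_simps)
  moreover have "bump a b n x = 0" if "x \<notin> {a..b}" for x
    using that by (auto simp: bump_def flat_def not_le mult_less_0_iff zero_less_mult_iff)
  ultimately show ?thesis
    using test_functionI[of ?f "{a..b}" S] assms by auto
qed

lemma bump_bounds: "0 \<le> bump a b n x" "bump a b n x \<le> 1"
  using flat_1_bounds by (auto simp: bump_def intro: mult_le_one)

lemma bump_tendsto: "(\<lambda>n. bump a b n x) \<longlonglongrightarrow> indicator {a<..<b} x"
proof (cases "x \<in> {a<..<b}")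
  case True
  have "(\<lambda>n. flat 1 (real n * y)) \<longlonglongrightarrow> 1" if "y > 0" for y :: real
  proof -
    have "(\<lambda>n. exp (- (1 / y * inverse (real n)))) \<longlonglongrightarrow> exp (- (1 / y * 0))"
      by (intro tendsto_intros lim_inverse_n)
    then have "(\<lambda>n. exp (- (1 / y * inverse (real n)))) \<longlonglongrightarrow> 1" by simp
    then show ?thesis
      by (rule Lim_transform_eventually)
         (use that in \<open>auto simp: flat_def field_simps intro!: eventually_sequentiallyI[of 1]\<close>)
  qed
  from tendsto_mult[OF this this, of "x - a" "b - x"] True show ?thesis
    by (simp add: bump_def)
next
  case False
  then have "bump a b n x = 0" for n
    by (auto simp: bump_def flat_def not_less mult_le_0_iff zero_less_mult_iff)
  with False show ?thesis by simp
qed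

section \<open>Weak derivatives\<close>

lemma integrable_lebesgue_on_iff:
  fixes f :: "real \<Rightarrow> real"
  shows "S \<in> sets lebesgue \<Longrightarrow> integrable (lebesgue_on S) f \<longleftrightarrow> integrable lebesgue (\<lambda>x. indicator S x * f x)"
  using integrable_restrict_space[of S lebesgue f] by simp

lemma integral_lebesgue_on_eq:
  fixes f :: "real \<Rightarrow> real"
  shows "S \<in> sets lebesgue \<Longrightarrow> integral\<^sup>L (lebesgue_on S) f = (LINT x|lebesgue. indicator S x * f x)"
  using integral_restrict_space[of S lebesgue f] by simp

lemma integrable_bounded_continuous:
  fixes f g :: "real \<Rightarrow> real"
  assumes K: "compact K" and f: "integrable (lebesgue_on K) f" and g: "continuous_on K g"
  shows "integrable (lebesgue_on K) (\<lambda>x. f x * g x)"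
proof -
  have Kl: "K \<in> sets lebesgue"
    using K by (simp add: compact_imp_closed borel_closed)
  have "(\<lambda>x. g x * f x) absolutely_integrable_on K"
  proof (rule absolutely_integrable_bounded_measurable_product_real)
    show "g \<in> borel_measurable (lebesgue_on K)"
      by (rule continuous_imp_measurable_on_sets_lebesgue[OF g Kl])
    show "bounded (g ` K)"
      by (rule compact_imp_bounded[OF compact_continuous_image[OF g K]])
    show "f absolutely_integrable_on K"
      using f Kl by (simp add: set_integrable_def integrable_lebesgue_on_iff)
  qed (rule Kl)
  then show ?thesis
    using Kl by (simp add: set_integrable_def integrable_lebesgue_on_iff mult_ac)
qed

lemma integrable_compact_support:
  fixes f g :: "real \<Rightarrow> real"
  assumes S: "open S" and f: "locally_integrable_on S f" and g: "continuous_on S g"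
    and K: "compact K" "K \<subseteq> S" and 0: "\<And>x. x \<notin> K \<Longrightarrow> g x = 0"
  shows "integrable (lebesgue_on S) (\<lambda>x. f x * g x)"
proof -
  have sets: "K \<in> sets lebesgue" "S \<in> sets lebesgue"
    using K S by (auto simp: compact_imp_closed borel_closed)
  have "integrable (lebesgue_on K) (\<lambda>x. f x * g x)"
    using f K by (intro integrable_bounded_continuous continuous_on_subset[OF g]) (auto simp: locally_integrable_on_def)
  moreover have "(\<lambda>x. indicator K x * (f x * g x)) = (\<lambda>x. indicator S x * (f x * g x))"
    using 0 K by (auto simp: fun_eq_iff indicator_def)
  ultimately show ?thesis
    using sets by (simp add: integrable_lebesgue_on_iff)
qed

lemma locally_integrable_on_mult:
  assumes "locally_integrable_on S f" "continuous_on S g"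
  shows "locally_integrable_on S (\<lambda>x. f x * g x)"
  unfolding locally_integrable_on_def
proof (intro allI impI, elim conjE)
  fix K assume "compact K" "K \<subseteq> S"
  with assms show "integrable (lebesgue_on K) (\<lambda>x. f x * g x)"
    by (intro integrable_bounded_continuous continuous_on_subset[of S g K]) (auto simp: locally_integrable_on_def)
qed

lemma locally_integrable_on_sum:
  assumes "\<And>i. i \<in> I \<Longrightarrow> locally_integrable_on S (f i)"
  shows "locally_integrable_on S (\<lambda>x. \<Sum>i\<in>I. f i x)"
  using assms unfolding locally_integrable_on_def by auto

lemma locally_integrable_on_cmult:
  "locally_integrable_on S f \<Longrightarrow> locally_integrable_on S (\<lambda>x. c * f x)"
  unfolding locally_integrable_on_def by auto

lemma locally_integrable_on_cong:
  assumes "\<And>x. x \<in> S \<Longrightarrow> f x = g x"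
  shows "locally_integrable_on S f \<longleftrightarrow> locally_integrable_on S g"
proof -
  have "integrable (lebesgue_on K) f \<longleftrightarrow> integrable (lebesgue_on K) g" if "K \<subseteq> S" for K
    using that assms by (intro Bochner_Integration.integrable_cong) auto
  then show ?thesis by (auto simp: locally_integrable_on_def)
qed

lemma test_function_deriv_integrable:
  assumes S: "open S" and f: "locally_integrable_on S f" and \<psi>: "test_function S \<psi>"
  shows "integrable (lebesgue_on S) (\<lambda>x. f x * (deriv ^^ n) \<psi> x)"
proof -
  obtain K where K: "compact K" "K \<subseteq> S" "\<And>n x. x \<notin> K \<Longrightarrow> (deriv ^^ n) \<psi> x = 0"
    using test_functionD(2)[OF \<psi>] by blast
  have "continuous_on S ((deriv ^^ n) \<psi>)"
    using deriv_seq_continuous_on[OF test_functionD(1)[OF \<psi>]] by (rule continuous_on_subset) simp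
  then show ?thesis
    by (rule integrable_compact_support[OF S f _ K(1,2)]) (rule K)
qed

lemma test_function_integrable:
  assumes "open S" "locally_integrable_on S f" "test_function S \<psi>"
  shows "integrable (lebesgue_on S) (\<lambda>x. f x * \<psi> x)"
  using test_function_deriv_integrable[OF assms, of 0] by simp

lemma has_weak_deriv_cong:
  assumes "\<And>x. x \<in> S \<Longrightarrow> f x = f' x" "\<And>x. x \<in> S \<Longrightarrow> g x = g' x"
  shows "has_weak_deriv S k f g \<longleftrightarrow> has_weak_deriv S k f' g'"
proof -
  have "(LINT x|lebesgue_on S. f x * (deriv ^^ k) \<psi> x) = (LINT x|lebesgue_on S. f' x * (deriv ^^ k) \<psi> x)"
    and "(LINT x|lebesgue_on S. g x * \<psi> x) = (LINT x|lebesgue_on S. g' x * \<psi> x)" for \<psi>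
    using assms by (auto intro!: Bochner_Integration.integral_cong)
  moreover have "locally_integrable_on S f \<longleftrightarrow> locally_integrable_on S f'"
    "locally_integrable_on S g \<longleftrightarrow> locally_integrable_on S g'"
    by (intro locally_integrable_on_cong assms; assumption)+
  ultimately show ?thesis
    unfolding has_weak_deriv_def by simp
qed

lemma has_weak_deriv_sum:
  assumes S: "open S" and "\<And>i. i \<in> I \<Longrightarrow> has_weak_deriv S k (f i) (g i)"
  shows "has_weak_deriv S k (\<lambda>x. \<Sum>i\<in>I. f i x) (\<lambda>x. \<Sum>i\<in>I. g i x)"
  unfolding has_weak_deriv_def
proof (intro conjI allI impI)
  have loc: "locally_integrable_on S (f i)" "locally_integrable_on S (g i)" if "i \<in> I" for i
    using assms(2)[OF that] by (auto simp: has_weak_deriv_def)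
  show "locally_integrable_on S (\<lambda>x. \<Sum>i\<in>I. f i x)" "locally_integrable_on S (\<lambda>x. \<Sum>i\<in>I. g i x)"
    by (intro locally_integrable_on_sum loc; assumption)+
  fix \<psi> assume \<psi>: "test_function S \<psi>"
  have "(LINT x|lebesgue_on S. (\<Sum>i\<in>I. f i x) * (deriv ^^ k) \<psi> x)
      = (\<Sum>i\<in>I. LINT x|lebesgue_on S. f i x * (deriv ^^ k) \<psi> x)"
    unfolding sum_distrib_right
    by (intro Bochner_Integration.integral_sum test_function_deriv_integrable[OF S _ \<psi>] loc)
  also have "\<dots> = (\<Sum>i\<in>I. (-1) ^ k * (LINT x|lebesgue_on S. g i x * \<psi> x))"
    using assms(2) \<psi> by (intro sum.cong refl) (simp add: has_weak_deriv_def)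
  also have "\<dots> = (-1) ^ k * (LINT x|lebesgue_on S. (\<Sum>i\<in>I. g i x) * \<psi> x)"
    unfolding sum_distrib_right
    by (subst Bochner_Integration.integral_sum)
       (auto intro!: test_function_integrable[OF S _ \<psi>] loc simp: sum_distrib_left)
  finally show "(LINT x|lebesgue_on S. (\<Sum>i\<in>I. f i x) * (deriv ^^ k) \<psi> x)
      = (-1) ^ k * (LINT x|lebesgue_on S. (\<Sum>i\<in>I. g i x) * \<psi> x)" .
qed

text \<open>The inverted Leibniz rule turns \<open>w \<psi>^(n)\<close> into derivatives of the test
  functions \<open>w^(l) \<psi>\<close>, to which the weak derivative of \<open>f\<close> of order
  \<open>n - l\<close> applies. The signs \<open>(-1)^l\<close> and \<open>(-1)^(n-l)\<close>
  combine to \<open>(-1)^n\<close>.\<close>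

lemma has_weak_deriv_mult:
  assumes S: "open S" and \<phi>: "\<And>k. k \<le> n \<Longrightarrow> has_weak_deriv S k f (\<phi> k)" and w: "deriv_seq S w"
  shows "has_weak_deriv S n (\<lambda>x. f x * w 0 x) (leibniz \<phi> w n)"
  unfolding has_weak_deriv_def
proof (intro conjI allI impI)
  note cont = deriv_seq_continuous_on[OF w]
  have f: "locally_integrable_on S f" and \<phi>_loc: "k \<le> n \<Longrightarrow> locally_integrable_on S (\<phi> k)" for k
    using \<phi> by (auto simp: has_weak_deriv_def)
  show "locally_integrable_on S (\<lambda>x. f x * w 0 x)"
    by (rule locally_integrable_on_mult[OF f cont])
  show "locally_integrable_on S (leibniz \<phi> w n)"
    unfolding leibniz_def[abs_def]
    by (intro locally_integrable_on_sum locally_integrable_on_cmult locally_integrable_on_mult cont \<phi>_loc) auto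
  fix \<psi> assume \<psi>: "test_function S \<psi>"
  have test: "test_function S (\<lambda>x. w l x * \<psi> x)" for l
    using test_function_mult(1)[OF S deriv_seq_shift[OF w, of l] \<psi>] by simp
  have "(LINT x|lebesgue_on S. f x * w 0 x * (deriv ^^ n) \<psi> x) = (LINT x|lebesgue_on S.
      (\<Sum>l\<le>n. real (n choose l) * ((-1) ^ l * (f x * (deriv ^^ (n - l)) (\<lambda>x. w l x * \<psi> x) x))))"
    by (intro Bochner_Integration.integral_cong refl)
       (simp add: mult_deriv_test_function[OF S w \<psi>] sum_distrib_left mult_ac)
  also have "\<dots> = (\<Sum>l\<le>n. real (n choose l) * ((-1) ^ l *
      (LINT x|lebesgue_on S. f x * (deriv ^^ (n - l)) (\<lambda>x. w l x * \<psi> x) x)))"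
    by (subst Bochner_Integration.integral_sum)
       (simp_all add: Bochner_Integration.integrable_mult_right test_function_deriv_integrable[OF S f test])
  also have "\<dots> = (\<Sum>l\<le>n. real (n choose l) * ((-1) ^ n *
      (LINT x|lebesgue_on S. \<phi> (n - l) x * (w l x * \<psi> x))))"
  proof (intro sum.cong refl)
    fix l assume l: "l \<in> {..n}"
    have "(-1) ^ l * (LINT x|lebesgue_on S. f x * (deriv ^^ (n - l)) (\<lambda>x. w l x * \<psi> x) x)
       = (-1) ^ l * ((-1) ^ (n - l) * (LINT x|lebesgue_on S. \<phi> (n - l) x * (w l x * \<psi> x)))"
      using \<phi>[of "n - l"] test[of l] by (simp add: has_weak_deriv_def)
    also have "\<dots> = (-1) ^ n * (LINT x|lebesgue_on S. \<phi> (n - l) x * (w l x * \<psi> x))"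
      using l by (simp flip: mult.assoc power_add)
    finally show "real (n choose l) * ((-1) ^ l * (LINT x|lebesgue_on S. f x * (deriv ^^ (n - l)) (\<lambda>x. w l x * \<psi> x) x))
       = real (n choose l) * ((-1) ^ n * (LINT x|lebesgue_on S. \<phi> (n - l) x * (w l x * \<psi> x)))"
      by simp
  qed
  also have "\<dots> = (-1) ^ n * (LINT x|lebesgue_on S. (\<Sum>l\<le>n. real (n choose l) * (\<phi> (n - l) x * (w l x * \<psi> x))))"
  proof -
    have "integrable (lebesgue_on S) (\<lambda>x. real (n choose l) * (\<phi> (n - l) x * (w l x * \<psi> x)))" if "l \<le> n" for l
      by (rule Bochner_Integration.integrable_mult_right, rule test_function_integrable[OF S \<phi>_loc test]) simp
    then have "(LINT x|lebesgue_on S. (\<Sum>l\<le>n. real (n choose l) * (\<phi> (n - l) x * (w l x * \<psi> x))))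
        = (\<Sum>l\<le>n. LINT x|lebesgue_on S. real (n choose l) * (\<phi> (n - l) x * (w l x * \<psi> x)))"
      by (intro Bochner_Integration.integral_sum) auto
    then have "(LINT x|lebesgue_on S. (\<Sum>l\<le>n. real (n choose l) * (\<phi> (n - l) x * (w l x * \<psi> x))))
        = (\<Sum>l\<le>n. real (n choose l) * (LINT x|lebesgue_on S. \<phi> (n - l) x * (w l x * \<psi> x)))"
      by (simp only: integral_mult_right_zero)
    then show ?thesis by (simp only: sum_distrib_left mult.left_commute)
  qed
  also have "\<dots> = (-1) ^ n * (LINT x|lebesgue_on S. leibniz \<phi> w n x * \<psi> x)"
    by (simp only: leibniz_def sum_distrib_right mult.assoc)
  finally show "(LINT x|lebesgue_on S. f x * w 0 x * (deriv ^^ n) \<psi> x)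
      = (-1) ^ n * (LINT x|lebesgue_on S. leibniz \<phi> w n x * \<psi> x)" .
qed

lemma has_weak_deriv_subset:
  assumes S: "open S" and T: "open T" "T \<subseteq> S" and f: "has_weak_deriv S k f g"
  shows "has_weak_deriv T k f g"
proof -
  have "(LINT x|lebesgue_on T. h x * (deriv ^^ n) \<psi> x) = (LINT x|lebesgue_on S. h x * (deriv ^^ n) \<psi> x)"
    if "test_function T \<psi>" for \<psi> n and h :: "real \<Rightarrow> real"
  proof -
    obtain K where K: "compact K" "K \<subseteq> T" "\<And>n x. x \<notin> K \<Longrightarrow> (deriv ^^ n) \<psi> x = 0"
      using test_functionD(2)[OF \<open>test_function T \<psi>\<close>] by blast
    have "(\<lambda>x. indicator T x * (h x * (deriv ^^ n) \<psi> x)) = (\<lambda>x. indicator S x * (h x * (deriv ^^ n) \<psi> x))"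
      using K T by (auto simp: fun_eq_iff indicator_def)
    with S T show ?thesis by (simp add: integral_lebesgue_on_eq)
  qed
  from this[of _ _ 0] this[of _ _ k] f T show ?thesis
    by (auto simp: has_weak_deriv_def locally_integrable_on_def dest: test_function_mono)
qed

section \<open>Uniqueness and locality of weak derivatives\<close>

text \<open>Open intervals are an intersection-stable generator of the Borel sets, so the integral
  vanishes over every Borel set; the integral over the line enters through complements. A Borel
  representative reduces the claim to uniqueness of densities over \<open>lborel\<close>.\<close>

lemma AE_zero_of_interval_integrals:
  fixes h :: "real \<Rightarrow> real"
  assumes h: "integrable lebesgue h" and 0: "\<And>c d. (LINT x|lebesgue. indicator {c<..<d} x * h x) = 0"
    and all: "(LINT x|lebesgue. h x) = 0"
  shows "AE x in lebesgue. h x = 0"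
proof -
  obtain h' where h'_meas[measurable]: "h' \<in> borel_measurable lborel" and eq: "AE x in lborel. h x = h' x"
    using completion_ex_borel_measurable_real[OF borel_measurable_integrable[OF h]] by auto
  have eq': "AE x in lebesgue. h x = h' x" by (rule AE_completion[OF eq])
  have h'_int: "integrable lborel h'"
  proof -
    have "integrable lebesgue h'"
      by (rule integrable_cong_AE_imp[OF h _ eq']) (simp add: measurable_completion)
    then show ?thesis by (simp add: integrable_completion)
  qed
  have transfer: "(LINT x:A|lborel. h' x) = (LINT x|lebesgue. indicator A x * h x)" if [measurable]: "A \<in> sets borel" for A
  proof -
    have "(LINT x:A|lborel. h' x) = (LINT x|lebesgue. indicator A x * h' x)"
      by (simp add: set_lebesgue_integral_def integral_completion)
    also have "\<dots> = (LINT x|lebesgue. indicator A x * h x)"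
    proof (rule integral_cong_AE)
      show "(\<lambda>x. indicator A x * h' x) \<in> borel_measurable lebesgue"
        by (rule measurable_completion) simp
      show "(\<lambda>x. indicator A x * h x) \<in> borel_measurable lebesgue"
        by (rule borel_measurable_times[OF borel_measurable_indicator borel_measurable_integrable[OF h]])
           (simp add: that)
    qed (use eq' in auto)
    finally show ?thesis .
  qed
  have int_set: "set_integrable lborel A h'" if "A \<in> sets borel" for A
    using integrable_mult_indicator[OF _ h'_int, of A] that by (simp add: set_integrable_def)
  have zero: "(LINT x:A|lborel. h' x) = 0" if "A \<in> sets borel" for A
  proof -
    have "A \<in> sigma_sets UNIV (range (\<lambda>(a, b). box a (b::real)))"
      using that by (simp add: borel_eq_box sets_measure_of)
    then show ?thesis
    proof (induction rule: sigma_sets_induct_disjoint[rotated 2, consumes 1, case_names basic empty compl union])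
      show "Int_stable (range (\<lambda>(a, b). box a (b::real)))"
        by (auto simp: Int_stable_def box_real Int_greaterThanLessThan)
    next
      case (basic A)
      then show ?case using transfer[of A] 0 by (auto simp: box_real)
    next
      case (compl A)
      then have A: "A \<in> sets borel" by (simp add: borel_eq_box sets_measure_of)
      have "(LINT x:(A \<union> (UNIV - A))|lborel. h' x) = (LINT x:A|lborel. h' x) + (LINT x:(UNIV - A)|lborel. h' x)"
        using A int_set by (intro set_integral_Un) auto
      moreover have "A \<union> (UNIV - A) = UNIV" by auto
      ultimately show ?case using compl transfer[of UNIV] all by simp
    next
      case (union A)
      then have A: "A i \<in> sets borel" for i by (auto simp: borel_eq_box sets_measure_of)
      have "(LINT x:(\<Union>i. A i)|lborel. h' x) = (\<Sum>i. (LINT x:(A i)|lborel. h' x))"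
        using A union by (intro lebesgue_integral_countable_add int_set) (auto simp: disjoint_family_on_def)
      then show ?case using union by simp
    qed (auto simp: set_lebesgue_integral_def)
  qed
  have "AE x in lborel. h' x = 0"
    by (rule density_unique_real[OF h'_int]) (use zero in \<open>auto simp: set_lebesgue_integral_def\<close>)
  then have "AE x in lborel. h x = 0" using eq by auto
  then show ?thesis by (rule AE_completion)
qed

text \<open>Fundamental lemma of the calculus of variations. Bump functions approximate indicators
  of intervals inside a compact box in \<open>S\<close>, and countably many boxes exhaust
  \<open>S\<close>.\<close>

lemma AE_zero_of_test_functions:
  assumes S: "open S" and h: "locally_integrable_on S h"
    and 0: "\<And>\<psi>. test_function S \<psi> \<Longrightarrow> (LINT x|lebesgue_on S. h x * \<psi> x) = 0"
  shows "AE x in lebesgue_on S. h x = 0"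
proof -
  have Sl: "S \<in> sets lebesgue" using S by simp
  have box: "AE x in lebesgue. x \<in> {a..b} \<longrightarrow> h x = 0" if ab: "{a..b} \<subseteq> S" for a b
  proof -
    let ?h = "\<lambda>x. indicator {a..b} x * h x"
    have "integrable (lebesgue_on {a..b}) h"
      using h ab by (auto simp: locally_integrable_on_def)
    then have int: "integrable lebesgue ?h"
      by (simp add: integrable_lebesgue_on_iff)
    \<comment> \<open>Inside the box the bump functions are test functions on \<open>S\<close>.
      Arbitrary intervals are later cut down to the box, which changes the integrand at its two
      endpoints only.\<close>
    have sub: "(LINT x|lebesgue. indicator {c<..<d} x * ?h x) = 0" if cd: "a \<le> c" "d \<le> b" for c d
    proof -
      have "(\<lambda>n. LINT x|lebesgue. bump c d n x * ?h x) \<longlonglongrightarrow> (LINT x|lebesgue. indicator {c<..<d} x * ?h x)"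
      proof (rule integral_dominated_convergence)
        have meas: "?h \<in> borel_measurable lebesgue" using int by (rule borel_measurable_integrable)
        show "(\<lambda>x. indicator {c<..<d} x * ?h x) \<in> borel_measurable lebesgue"
          by (rule borel_measurable_times[OF borel_measurable_indicator meas]) simp
        show "(\<lambda>x. bump c d n x * ?h x) \<in> borel_measurable lebesgue" for n
        proof (rule borel_measurable_times[OF _ meas])
          have "continuous_on UNIV (bump c d n)"
            using deriv_seq_continuous_on[OF test_functionD(1)[OF test_function_bump[of c d UNIV n]], of 0] by simp
          then show "bump c d n \<in> borel_measurable lebesgue"
            by (intro measurable_completion) (auto intro: borel_measurable_continuous_onI)
        qed
        show "integrable lebesgue (\<lambda>x. \<bar>?h x\<bar>)" using int by simp
        show "AE x in lebesgue. (\<lambda>n. bump c d n x * ?h x) \<longlonglongrightarrow> indicator {c<..<d} x * ?h x"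
          by (intro AE_I2 tendsto_intros bump_tendsto)
        show "AE x in lebesgue. norm (bump c d n x * ?h x) \<le> \<bar>?h x\<bar>" for n
        proof (rule AE_I2)
          fix x
          have "\<bar>bump c d n x\<bar> * \<bar>?h x\<bar> \<le> 1 * \<bar>?h x\<bar>"
            by (rule mult_right_mono) (use bump_bounds[of c d n x] in auto)
          then show "norm (bump c d n x * ?h x) \<le> \<bar>?h x\<bar>" by (simp add: abs_mult)
        qed
      qed
      moreover have "(LINT x|lebesgue. bump c d n x * ?h x) = 0" for n
      proof -
        have "test_function S (bump c d n)"
          by (rule test_function_bump) (use cd ab in auto)
        then have "(LINT x|lebesgue. indicator S x * (h x * bump c d n x)) = 0"
          using 0 Sl by (simp add: integral_lebesgue_on_eq)
        moreover have "bump c d n x = 0" if "x \<notin> {a..b}" for x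
          using that cd by (auto simp: bump_def flat_def zero_less_mult_iff)
        then have "(\<lambda>x. indicator S x * (h x * bump c d n x)) = (\<lambda>x. bump c d n x * ?h x)"
          using ab by (auto simp: fun_eq_iff indicator_def)
        ultimately show ?thesis by simp
      qed
      ultimately show ?thesis by (simp add: LIMSEQ_const_iff)
    qed
    have "AE x in lebesgue. x \<noteq> a \<and> x \<noteq> b"
      by (intro AE_conjI AE_completion AE_lborel_singleton)
    then have ae: "AE x in lebesgue. ?h x = indicator {a<..<b} x * ?h x"
      by eventually_elim (auto simp: indicator_def)
    have meas: "?h \<in> borel_measurable lebesgue" using int by (rule borel_measurable_integrable)
    have "AE x in lebesgue. ?h x = 0"
    proof (rule AE_zero_of_interval_integrals[OF int])
      fix c d
      have "(LINT x|lebesgue. indicator {c<..<d} x * ?h x) = (LINT x|lebesgue. indicator {max a c<..<min b d} x * ?h x)"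
      proof (rule integral_cong_AE)
        show "(\<lambda>x. indicator {c<..<d} x * ?h x) \<in> borel_measurable lebesgue"
          "(\<lambda>x. indicator {max a c<..<min b d} x * ?h x) \<in> borel_measurable lebesgue"
          by (rule borel_measurable_times[OF borel_measurable_indicator meas], simp)+
        show "AE x in lebesgue. indicator {c<..<d} x * ?h x = indicator {max a c<..<min b d} x * ?h x"
          using \<open>AE x in lebesgue. x \<noteq> a \<and> x \<noteq> b\<close> by eventually_elim (auto simp: indicator_def)
      qed
      then show "(LINT x|lebesgue. indicator {c<..<d} x * ?h x) = 0" using sub by simp
    next
      have "(LINT x|lebesgue. ?h x) = (LINT x|lebesgue. indicator {a<..<b} x * ?h x)"
        by (rule integral_cong_AE[OF meas borel_measurable_times[OF borel_measurable_indicator meas] ae]) simp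
      then show "(LINT x|lebesgue. ?h x) = 0" using sub[of a b] by simp
    qed
    then show ?thesis by eventually_elim (auto simp: indicator_def split: if_splits)
  qed
  obtain \<D> where \<D>: "countable \<D>" "\<D> \<subseteq> Pow S" "\<And>X. X \<in> \<D> \<Longrightarrow> \<exists>a b. X = cbox a b" "\<Union>\<D> = S"
    by (rule open_countable_Union_open_cbox[OF S]) (rule that)
  have "AE x in lebesgue. \<forall>X\<in>\<D>. x \<in> X \<longrightarrow> h x = 0"
    unfolding AE_ball_countable[OF \<D>(1)]
  proof
    fix X assume X: "X \<in> \<D>"
    then obtain a b where "X = {a..b}" using \<D>(3) by fastforce
    then show "AE x in lebesgue. x \<in> X \<longrightarrow> h x = 0" using box[of a b] \<D>(2) X by auto
  qed
  then have "AE x in lebesgue. x \<in> S \<longrightarrow> h x = 0"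
    by eventually_elim (use \<D>(4) in auto)
  then show ?thesis using Sl by (simp add: AE_restrict_space_iff)
qed

lemma has_weak_deriv_unique:
  assumes S: "open S" and "has_weak_deriv S k f g" "has_weak_deriv S k f g'"
  shows "AE x in lebesgue_on S. g x = g' x"
proof -
  have loc: "locally_integrable_on S g" "locally_integrable_on S g'"
    using assms by (auto simp: has_weak_deriv_def)
  have "AE x in lebesgue_on S. g x - g' x = 0"
  proof (rule AE_zero_of_test_functions[OF S])
    show "locally_integrable_on S (\<lambda>x. g x - g' x)"
      using loc by (auto simp: locally_integrable_on_def)
    fix \<psi> assume \<psi>: "test_function S \<psi>"
    have "(LINT x|lebesgue_on S. f x * (deriv ^^ k) \<psi> x) = (-1) ^ k * (LINT x|lebesgue_on S. g x * \<psi> x)"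
      "(LINT x|lebesgue_on S. f x * (deriv ^^ k) \<psi> x) = (-1) ^ k * (LINT x|lebesgue_on S. g' x * \<psi> x)"
      using assms(2,3) \<psi> unfolding has_weak_deriv_def by blast+
    then have "(LINT x|lebesgue_on S. g x * \<psi> x) = (LINT x|lebesgue_on S. g' x * \<psi> x)"
      by simp
    then show "(LINT x|lebesgue_on S. (g x - g' x) * \<psi> x) = 0"
      using Bochner_Integration.integral_diff[OF test_function_integrable[OF S loc(1) \<psi>]
          test_function_integrable[OF S loc(2) \<psi>]]
      by (simp add: left_diff_distrib)
  qed
  then show ?thesis by auto
qed

text \<open>On \<open>T\<close> both \<open>g\<close> and \<open>0\<close> are weak derivatives of
  \<open>f\<close>, so uniqueness applies. This carries the vanishing of a cut-off outside its patch
  over to its derivatives.\<close>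

lemma has_weak_deriv_vanish:
  assumes S: "open S" and T: "open T" "T \<subseteq> S" and f: "has_weak_deriv S k f g"
    and 0: "AE x in lebesgue_on S. x \<in> T \<longrightarrow> f x = 0"
  shows "AE x in lebesgue_on S. x \<in> T \<longrightarrow> g x = 0"
proof -
  have f': "has_weak_deriv T k f g" by (rule has_weak_deriv_subset[OF S T f])
  have "AE x in lebesgue_on T. f x = 0"
    using 0 S T by (auto simp: AE_restrict_space_iff)
  then have "(LINT x|lebesgue_on T. f x * \<psi> x) = 0" for \<psi>
    by (intro integral_eq_zero_AE) auto
  then have "has_weak_deriv T k f (\<lambda>_. 0)"
    using f' by (simp add: has_weak_deriv_def) (simp add: locally_integrable_on_def)
  then have "AE x in lebesgue_on T. g x = 0"
    using has_weak_deriv_unique[OF T(1) f'] by blast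
  then show ?thesis using S T by (auto simp: AE_restrict_space_iff)
qed

text \<open>Local integrability gives measurability on compact sets only; a countable cover of
  \<open>S\<close> by boxes glues the pieces.\<close>

lemma has_weak_deriv_measurable:
  assumes S: "open S" and f: "has_weak_deriv S k f g"
  shows "g \<in> borel_measurable (lebesgue_on S)"
proof -
  obtain \<D> where \<D>: "countable \<D>" "\<D> \<subseteq> Pow S" "\<And>X. X \<in> \<D> \<Longrightarrow> \<exists>a b. X = cbox a b" "\<Union>\<D> = S"
    by (rule open_countable_Union_open_cbox[OF S]) (rule that)
  have *: "X \<subseteq> S \<and> compact X \<and> X \<in> sets lebesgue" if X: "X \<in> \<D>" for X
    using \<D>(3)[OF X] \<D>(2) X by auto
  show ?thesis
  proof (rule measurable_piecewise_restrict[of \<D>])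
    show "countable \<D>" by fact
    show "X \<inter> space (lebesgue_on S) \<in> sets (lebesgue_on S)" if "X \<in> \<D>" for X
      using *[OF that] S by (simp add: sets_restrict_space_iff Int_absorb2)
    show "space (lebesgue_on S) \<subseteq> \<Union>\<D>" using \<D>(4) by simp
    fix X assume X: "X \<in> \<D>"
    have "restrict_space (lebesgue_on S) X = lebesgue_on X"
      using S *[OF X] by (subst restrict_restrict_space) (auto simp: Int_absorb1)
    moreover have "integrable (lebesgue_on X) g"
      using f *[OF X] by (auto simp: has_weak_deriv_def locally_integrable_on_def)
    ultimately show "g \<in> borel_measurable (restrict_space (lebesgue_on S) X)"
      by (simp add: borel_measurable_integrable)
  qed
qed

section \<open>Sobolev norms\<close>

lemma sum_powr_le_powr_sum:
  fixes a :: "'i \<Rightarrow> real"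
  assumes "finite I" "P \<ge> 1" and a: "\<And>i. i \<in> I \<Longrightarrow> a i \<ge> 0"
  shows "(\<Sum>i\<in>I. a i powr P) \<le> (\<Sum>i\<in>I. a i) powr P"
proof -
  let ?S = "\<Sum>i\<in>I. a i"
  have S: "?S \<ge> 0" using a by (rule sum_nonneg)
  have "(\<Sum>i\<in>I. a i powr P) \<le> (\<Sum>i\<in>I. ?S powr (P - 1) * a i)"
  proof (intro sum_mono)
    fix i assume i: "i \<in> I"
    have "a i \<le> ?S" by (rule member_le_sum) (use assms i in auto)
    then have "a i powr (P - 1) * a i \<le> ?S powr (P - 1) * a i"
      using a[OF i] assms by (intro mult_right_mono powr_mono2) auto
    moreover have "a i powr P = a i powr (P - 1) * a i"
      using powr_add[of "a i" "P - 1" 1] a[OF i] by simp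
    ultimately show "a i powr P \<le> ?S powr (P - 1) * a i" by simp
  qed
  also have "\<dots> = ?S powr P"
    using powr_add[of ?S "P - 1" 1] S by (simp flip: sum_distrib_left)
  finally show ?thesis .
qed

lemma powr_sum_le_sum_powr:
  fixes a :: "'i \<Rightarrow> real"
  assumes "finite I" "P \<ge> 0" and a: "\<And>i. i \<in> I \<Longrightarrow> a i \<ge> 0"
  shows "(\<Sum>i\<in>I. a i) powr P \<le> real (card I) powr P * (\<Sum>i\<in>I. a i powr P)"
proof (cases "I = {}")
  case False
  let ?m = "Max (a ` I)"
  have m: "?m \<in> a ` I" using assms(1) False by (intro Max_in) auto
  then obtain i where i: "i \<in> I" "?m = a i" by auto
  have "(\<Sum>i\<in>I. a i) \<le> real (card I) * ?m"
    using assms(1) by (intro sum_bounded_above) auto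
  then have "(\<Sum>i\<in>I. a i) powr P \<le> (real (card I) * ?m) powr P"
    using assms by (intro powr_mono2 sum_nonneg) auto
  also have "\<dots> = real (card I) powr P * a i powr P"
    using a[OF i(1)] by (simp add: i(2) powr_mult)
  also have "\<dots> \<le> real (card I) powr P * (\<Sum>i\<in>I. a i powr P)"
    using assms(1) i by (intro mult_left_mono member_le_sum) auto
  finally show ?thesis .
qed simp

lemma ennreal_root_mono: "a \<le> b \<Longrightarrow> q \<ge> 0 \<Longrightarrow> ennreal_root q a \<le> ennreal_root q b"
  by (auto simp: ennreal_root_def top_unique less_top intro!: ennreal_leI powr_mono2 enn2real_mono)

lemma measurable_ennreal_root [measurable]: "ennreal_root q \<in> borel_measurable borel"
  unfolding ennreal_root_def[abs_def] by measurable

text \<open>The essential supremum exceeds \<open>a\<close> iff the set where the function exceeds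
  \<open>a\<close> has positive measure, and by Tonelli's theorem this measure depends measurably on
  the parameter.\<close>

lemma measurable_esssup:
  fixes f :: "'a \<Rightarrow> 'b \<Rightarrow> ennreal"
  assumes "sigma_finite_measure M" and [measurable]: "case_prod f \<in> borel_measurable (P \<Otimes>\<^sub>M M)"
  shows "(\<lambda>\<omega>. esssup M (f \<omega>)) \<in> borel_measurable P"
proof (rule borel_measurableI_greater)
  interpret sigma_finite_measure M by fact
  fix a :: ennreal
  have *: "a < esssup M (f \<omega>) \<longleftrightarrow> (\<integral>\<^sup>+ x. indicator {a<..} (f \<omega> x) \<partial>M) > 0" if \<omega>: "\<omega> \<in> space P" for \<omega>
  proof -
    have [measurable]: "f \<omega> \<in> borel_measurable M"
      using measurable_Pair2[OF assms(2) \<omega>] by simp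
    have "esssup M (f \<omega>) \<le> a \<longleftrightarrow> (AE x in M. f \<omega> x \<le> a)"
    proof
      assume "esssup M (f \<omega>) \<le> a"
      with esssup_AE[of "f \<omega>" M] show "AE x in M. f \<omega> x \<le> a" by auto
    qed (rule esssup_I, measurable)
    also have "\<dots> \<longleftrightarrow> (AE x in M. indicator {a<..} (f \<omega> x) = (0::ennreal))"
      by (intro AE_cong) (auto simp: indicator_def not_less)
    also have "\<dots> \<longleftrightarrow> (\<integral>\<^sup>+ x. indicator {a<..} (f \<omega> x) \<partial>M) = 0"
      by (subst nn_integral_0_iff_AE) auto
    finally show ?thesis by (simp add: not_le[symmetric] zero_less_iff_neq_zero)
  qed
  have [measurable]: "(\<lambda>\<omega>. \<integral>\<^sup>+ x. indicator {a<..} (f \<omega> x) \<partial>M) \<in> borel_measurable P"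
    by (rule borel_measurable_nn_integral) measurable
  have "{\<omega> \<in> space P. a < esssup M (f \<omega>)} = {\<omega> \<in> space P. (\<integral>\<^sup>+ x. indicator {a<..} (f \<omega> x) \<partial>M) > 0}"
    using * by auto
  also have "\<dots> \<in> sets P" by measurable
  finally show "{\<omega> \<in> space P. a < esssup M (f \<omega>)} \<in> sets P" .
qed

text \<open>The norm with the weak derivatives supplied as data. Derivatives chosen by
  \<open>SOME\<close> for each sample would carry no joint measurability in sample and
  position.\<close>

definition sobolev_sum :: "nat \<Rightarrow> ennreal \<Rightarrow> real set \<Rightarrow> (nat \<Rightarrow> real \<Rightarrow> real) \<Rightarrow> ennreal" where
  "sobolev_sum m p S G = (if p = \<top> then Max ((\<lambda>k. Linf_norm S (G k)) ` {..m})
     else ennreal_root (enn2real p) (\<Sum>k\<le>m. \<integral>\<^sup>+ x. ennreal (\<bar>G k x\<bar> powr enn2real p) \<partial>lebesgue_on S))"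

lemma Linf_norm_cong_AE: 
  assumes "f \<in> borel_measurable (lebesgue_on S)" "g \<in> borel_measurable (lebesgue_on S)"
    "AE x in lebesgue_on S. f x = g x"
  shows "Linf_norm S f = Linf_norm S g"
proof -
  note [measurable] = assms(1,2)
  show ?thesis
    unfolding Linf_norm_def
    by (rule esssup_AE_cong) (use assms(3) in auto)
qed

lemma has_weak_deriv_weak_deriv: "has_weak_deriv S k f g \<Longrightarrow> has_weak_deriv S k f (weak_deriv S k f)"
  unfolding weak_deriv_def by (rule someI[of "has_weak_deriv S k f"])

lemma sobolev_norm_eq_sum:
  assumes S: "open S" and G: "\<And>k. k \<le> m \<Longrightarrow> has_weak_deriv S k f (G k)"
  shows "sobolev_norm m p S f = sobolev_sum m p S G"
proof -
  have weak: "has_weak_deriv S k f (weak_deriv S k f)" if "k \<le> m" for k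
    using has_weak_deriv_weak_deriv G[OF that] by blast
  have AE: "AE x in lebesgue_on S. weak_deriv S k f x = G k x" if "k \<le> m" for k
    by (rule has_weak_deriv_unique[OF S weak[OF that] G[OF that]])
  have "Linf_norm S (weak_deriv S k f) = Linf_norm S (G k)" if "k \<le> m" for k
    by (rule Linf_norm_cong_AE[OF has_weak_deriv_measurable[OF S weak[OF that]]
          has_weak_deriv_measurable[OF S G[OF that]] AE[OF that]])
  moreover have "(\<integral>\<^sup>+ x. ennreal (\<bar>weak_deriv S k f x\<bar> powr P) \<partial>lebesgue_on S)
      = (\<integral>\<^sup>+ x. ennreal (\<bar>G k x\<bar> powr P) \<partial>lebesgue_on S)" if "k \<le> m" for k P
    using AE[OF that] by (intro nn_integral_cong_AE) auto
  moreover have "\<forall>k\<le>m. \<exists>g. has_weak_deriv S k f g" using G by blast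
  ultimately show ?thesis
    unfolding sobolev_norm_def sobolev_sum_def by (auto intro!: arg_cong[of _ _ Max] arg_cong[of _ _ "ennreal_root _"] sum.cong image_cong)
qed

lemma measurable_sobolev_sum:
  assumes S: "S \<in> lmeasurable"
    and G: "\<And>k. k \<le> m \<Longrightarrow> (\<lambda>(\<omega>, x). G \<omega> k x) \<in> borel_measurable (P \<Otimes>\<^sub>M lebesgue_on S)"
  shows "(\<lambda>\<omega>. sobolev_sum m p S (G \<omega>)) \<in> borel_measurable P"
proof -
  interpret finite_measure "lebesgue_on S" by (rule finite_measure_lebesgue_on[OF S])
  have sf: "sigma_finite_measure (lebesgue_on S)" by unfold_locales
  have "(\<lambda>\<omega>. Linf_norm S (G \<omega> k)) \<in> borel_measurable P" if "k \<le> m" for k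
  proof -
    note [measurable] = G[OF that]
    show ?thesis unfolding Linf_norm_def by (rule measurable_esssup[OF sf]) measurable
  qed
  moreover have "(\<lambda>\<omega>. \<integral>\<^sup>+ x. ennreal (\<bar>G \<omega> k x\<bar> powr q) \<partial>lebesgue_on S) \<in> borel_measurable P" if "k \<le> m" for k q
  proof -
    note [measurable] = G[OF that]
    show ?thesis by (rule borel_measurable_nn_integral) measurable
  qed
  ultimately show ?thesis
    unfolding sobolev_sum_def
    by (auto intro!: borel_measurable_Max borel_measurable_sum measurable_compose[OF _ measurable_ennreal_root])
qed

lemma nn_integral_powr_sum_indicator_le:
  fixes B :: "nat \<Rightarrow> real" and I :: "nat \<Rightarrow> real set"
  assumes S: "S \<in> sets lebesgue" and P: "P \<ge> 1" and B: "\<And>j. j < J \<Longrightarrow> B j \<ge> 0" and r: "\<And>j. j < J \<Longrightarrow> r j > 0"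
    and I: "\<And>j. j < J \<Longrightarrow> I j = ball (c j) (r j)"
    and g: "AE x in lebesgue_on S. \<bar>g x\<bar> \<le> (\<Sum>j<J. indicator (I j) x * B j)"
  shows "(\<integral>\<^sup>+ x. ennreal (\<bar>g x\<bar> powr P) \<partial>lebesgue_on S)
     \<le> ennreal (real J powr P * (\<Sum>j<J. B j powr P * (2 * r j)))"
proof -
  have "(\<integral>\<^sup>+ x. ennreal (\<bar>g x\<bar> powr P) \<partial>lebesgue_on S)
     \<le> (\<integral>\<^sup>+ x. (\<Sum>j<J. ennreal (real J powr P * B j powr P) * indicator (I j) x) \<partial>lebesgue_on S)"
  proof (rule nn_integral_mono_AE, use g in eventually_elim)
    case (elim x)
    have "\<bar>g x\<bar> powr P \<le> (\<Sum>j<J. indicator (I j) x * B j) powr P"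
      using elim P by (intro powr_mono2) auto
    also have "\<dots> \<le> real (card {..<J}) powr P * (\<Sum>j<J. (indicator (I j) x * B j) powr P)"
      using P B by (intro powr_sum_le_sum_powr) auto
    also have "\<dots> = (\<Sum>j<J. real J powr P * B j powr P * indicator (I j) x)"
      unfolding sum_distrib_left using P by (intro sum.cong refl) (auto split: split_indicator)
    finally have "ennreal (\<bar>g x\<bar> powr P) \<le> ennreal (\<Sum>j<J. real J powr P * B j powr P * indicator (I j) x)"
      by (rule ennreal_leI)
    also have "\<dots> = (\<Sum>j<J. ennreal (real J powr P * B j powr P) * indicator (I j) x)"
      by (subst sum_ennreal[symmetric]) (auto simp: ennreal_mult ennreal_indicator intro!: sum.cong)
    finally show ?case .
  qed
  also have "\<dots> \<le> (\<integral>\<^sup>+ x. (\<Sum>j<J. ennreal (real J powr P * B j powr P) * indicator (I j) x) \<partial>lebesgue)"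
    using S by (subst nn_integral_restrict_space) (auto intro!: nn_integral_mono split: split_indicator)
  also have "\<dots> = (\<Sum>j<J. ennreal (real J powr P * B j powr P) * emeasure lebesgue (I j))"
  proof -
    have [measurable]: "I j \<in> sets lebesgue" if "j < J" for j
      using I[OF that] by simp
    show ?thesis
      by (subst nn_integral_sum) (simp_all add: nn_integral_cmult_indicator)
  qed
  also have "\<dots> = (\<Sum>j<J. ennreal (real J powr P * B j powr P * (2 * r j)))"
  proof (intro sum.cong refl)
    fix j assume j: "j \<in> {..<J}"
    then have "emeasure lebesgue (I j) = ennreal (2 * r j)"
      using I[of j] r[of j] by (simp add: ball_eq_greaterThanLessThan)
    then show "ennreal (real J powr P * B j powr P) * emeasure lebesgue (I j) = ennreal (real J powr P * B j powr P * (2 * r j))"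
      using j r[of j] by (simp add: ennreal_mult)
  qed
  also have "\<dots> = ennreal (\<Sum>j<J. real J powr P * B j powr P * (2 * r j))"
    using less_imp_le[OF r] by (intro sum_ennreal) (auto intro!: mult_nonneg_nonneg)
  finally show ?thesis by (simp add: sum_distrib_left mult_ac)
qed

text \<open>The power of \<open>r j\<close> is the root of the length of a patch. For
  \<open>p = \<top>\<close> the exponent \<open>1 / p\<close> is \<open>0\<close>, so one formula
  serves both cases.\<close>

lemma sobolev_sum_le:
  fixes B :: "nat \<Rightarrow> real" and I :: "nat \<Rightarrow> real set" and p :: ennreal
  assumes S: "S \<in> sets lebesgue" and p: "p \<ge> 1" and B: "\<And>j. j < J \<Longrightarrow> B j \<ge> 0" and r: "\<And>j. j < J \<Longrightarrow> r j > 0"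
    and I: "\<And>j. j < J \<Longrightarrow> I j = ball (c j) (r j)"
    and meas: "\<And>k. k \<le> m \<Longrightarrow> G k \<in> borel_measurable (lebesgue_on S)"
    and G: "\<And>k. k \<le> m \<Longrightarrow> AE x in lebesgue_on S. \<bar>G k x\<bar> \<le> (\<Sum>j<J. indicator (I j) x * B j)"
  shows "sobolev_sum m p S G \<le> ennreal (2 * (real m + 1) * real J * (\<Sum>j<J. r j powr enn2real (1 / p) * B j))"
proof (cases "J = 0")
  case True
  have "AE x in lebesgue_on S. G k x = 0" if "k \<le> m" for k
    using G[OF that] True by simp
  note 0 = this
  have "Linf_norm S (G k) \<le> 0" if "k \<le> m" for k
    unfolding Linf_norm_def
  proof (rule esssup_I)
    show "AE x in lebesgue_on S. ennreal \<bar>G k x\<bar> \<le> 0"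
      using 0[OF that] by eventually_elim simp
  qed (use meas[OF that] in measurable)
  moreover have "(\<integral>\<^sup>+ x. ennreal (\<bar>G k x\<bar> powr q) \<partial>lebesgue_on S) = 0" if "k \<le> m" for k q
    by (rule nn_integral_zero', use 0[OF that] in eventually_elim) simp
  ultimately show ?thesis
    by (auto simp: sobolev_sum_def ennreal_root_def True)
next
  case False
  show ?thesis
  proof (cases "p = \<top>")
    case True
    have "Linf_norm S (G k) \<le> ennreal (\<Sum>j<J. B j)" if "k \<le> m" for k
      unfolding Linf_norm_def
    proof (rule esssup_I)
      show "AE x in lebesgue_on S. ennreal \<bar>G k x\<bar> \<le> ennreal (\<Sum>j<J. B j)"
        using G[OF that]
      proof eventually_elim
        case (elim x)
        also have "(\<Sum>j<J. indicator (I j) x * B j) \<le> (\<Sum>j<J. B j)"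
          using B by (intro sum_mono) (auto simp: indicator_def)
        finally show ?case by (rule ennreal_leI)
      qed
    qed (use meas[OF that] in measurable)
    then have "sobolev_sum m p S G \<le> ennreal (\<Sum>j<J. B j)"
      by (simp add: sobolev_sum_def True)
    also have "1 * 1 * (\<Sum>j<J. B j) \<le> 2 * (real m + 1) * real J * (\<Sum>j<J. B j)"
      using B False by (intro mult_right_mono mult_mono sum_nonneg) auto
    moreover have "(\<Sum>j<J. r j powr enn2real (1 / p) * B j) = (\<Sum>j<J. B j)"
      using r True by (intro sum.cong) (force simp: divide_ennreal_def)+
    ultimately show ?thesis by (auto intro: order_trans ennreal_leI)
  next
    case fin: False
    define P where "P = enn2real p"
    have pP: "p = ennreal P" using fin by (simp add: P_def less_top)
    have P: "P \<ge> 1" using p fin by (simp add: pP)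
    have P': "enn2real (1 / p) = 1 / P"
      using P by (simp add: pP divide_ennreal flip: ennreal_1)
    \<comment> \<open>\<open>\<gamma> j powr P\<close> is \<open>r j * B j powr P\<close>, the
      contribution of a patch up to constants; as \<open>P \<ge> 1\<close>, the sum of these powers
      is at most the power of the sum.\<close>
    define \<gamma> where "\<gamma> j = r j powr (1 / P) * B j" for j
    have \<gamma>: "\<gamma> j \<ge> 0" if "j < J" for j using B[OF that] by (simp add: \<gamma>_def)
    have \<gamma>P: "\<gamma> j powr P = r j * B j powr P" if "j < J" for j
      using B[OF that] r[OF that] P by (simp add: \<gamma>_def powr_mult powr_powr)
    have "(\<Sum>k\<le>m. \<integral>\<^sup>+ x. ennreal (\<bar>G k x\<bar> powr P) \<partial>lebesgue_on S)
       \<le> (\<Sum>k\<le>m. ennreal (real J powr P * (\<Sum>j<J. B j powr P * (2 * r j))))"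
      using nn_integral_powr_sum_indicator_le[OF S P B r I G] by (intro sum_mono) auto
    also have "\<dots> = ennreal ((real m + 1) * (real J powr P * (\<Sum>j<J. B j powr P * (2 * r j))))"
    proof -
      have "real J powr P * (\<Sum>j<J. B j powr P * (2 * r j)) \<ge> 0"
        using r by (auto intro!: mult_nonneg_nonneg sum_nonneg simp: less_imp_le)
      then show ?thesis by (subst sum_ennreal) (auto simp: add.commute)
    qed
    also have "(real m + 1) * (real J powr P * (\<Sum>j<J. B j powr P * (2 * r j)))
       = (2 * (real m + 1)) * (real J powr P * (\<Sum>j<J. \<gamma> j powr P))"
      unfolding sum_distrib_left by (intro sum.cong refl) (simp add: \<gamma>P)
    \<comment> \<open>The constant is at least \<open>1\<close> and \<open>P \<ge> 1\<close>, so it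
      may be raised to the power \<open>P\<close> too; the final root then leaves a constant
      independent of \<open>P\<close>.\<close>
    also have "\<dots> \<le> (2 * (real m + 1)) powr P * (real J powr P * (\<Sum>j<J. \<gamma> j) powr P)"
    proof (intro mult_mono)
      show "2 * (real m + 1) \<le> (2 * (real m + 1)) powr P"
        using powr_mono[of 1 P "2 * (real m + 1)"] P by simp
      show "(\<Sum>j<J. \<gamma> j powr P) \<le> (\<Sum>j<J. \<gamma> j) powr P"
        using P \<gamma> by (intro sum_powr_le_powr_sum) auto
    qed (auto intro!: sum_nonneg mult_nonneg_nonneg)
    also have "\<dots> = (2 * (real m + 1) * real J * (\<Sum>j<J. \<gamma> j)) powr P"
      using \<gamma> by (simp add: powr_mult sum_nonneg mult_ac)
    finally have *: "(\<Sum>k\<le>m. \<integral>\<^sup>+ x. ennreal (\<bar>G k x\<bar> powr P) \<partial>lebesgue_on S)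
       \<le> ennreal ((2 * (real m + 1) * real J * (\<Sum>j<J. \<gamma> j)) powr P)"
      by (simp add: ennreal_leI)
    have "sobolev_sum m p S G \<le> ennreal_root P (ennreal ((2 * (real m + 1) * real J * (\<Sum>j<J. \<gamma> j)) powr P))"
      using fin P by (simp only: sobolev_sum_def P_def[symmetric] if_False) (intro ennreal_root_mono[OF *], simp)
    also have "\<dots> = ennreal (2 * (real m + 1) * real J * (\<Sum>j<J. \<gamma> j))"
    proof -
      have "0 \<le> 2 * (real m + 1) * real J * (\<Sum>j<J. \<gamma> j)"
        using \<gamma> by (auto intro!: mult_nonneg_nonneg sum_nonneg)
      then show ?thesis using P by (simp only: ennreal_root_def) (simp add: powr_powr)
    qed
    finally show ?thesis by (simp add: \<gamma>_def P')
  qed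
qed

section \<open>Inverting the Vandermonde matrix\<close>

lemma mat_inv_eqI:
  assumes A: "A \<in> carrier_mat n n" and B: "B \<in> carrier_mat n n" and BA: "B * A = 1\<^sub>m n"
  shows "mat_inv A = B"
proof -
  have AB: "A * B = 1\<^sub>m n" by (rule mat_mult_left_right_inverse[OF B A BA])
  have "A \<in> Units (ring_mat TYPE(real) n ())"
    using A B AB BA by (auto simp: Units_def ring_mat_simps)
  then obtain B' where B': "mat_inverse A = Some B'"
    using mat_inverse(1)[OF A, where b = "()"] by (cases "mat_inverse A") auto
  from mat_inverse(2)[OF A this] have "B' * A = 1\<^sub>m n" "B' \<in> carrier_mat n n" by auto
  then have "B' = B' * (A * B)" "(B' * A) * B = B"
    using A B AB by auto
  moreover have "(B' * A) * B = B' * (A * B)"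
    using A B \<open>B' \<in> carrier_mat n n\<close> by (rule assoc_mult_mat[rotated])
  ultimately have "B' = B" by simp
  then show ?thesis by (simp add: mat_inv_def B')
qed

lemma mat_inv_cases:
  assumes A: "A \<in> carrier_mat n n"
  obtains "mat_inv A = 0\<^sub>m n n" | "mat_inv A * A = 1\<^sub>m n" "mat_inv A \<in> carrier_mat n n"
  using assms mat_inverse(2)[OF A] by (cases "mat_inverse A") (auto simp: mat_inv_def)

text \<open>Basis polynomials for the nodes \<open>- (k j)\<^sup>2\<close>, whose powers form the
  columns of \<open>V_mat\<close>. With nodes of this sign the numerator has nonnegative
  coefficients.\<close>

definition lagrange :: "nat \<Rightarrow> (nat \<Rightarrow> real) \<Rightarrow> nat \<Rightarrow> real poly" where
  "lagrange N k i = Polynomial.smult (1 / (\<Prod>j\<in>{..<N} - {i}. (k j)\<^sup>2 - (k i)\<^sup>2)) (\<Prod>j\<in>{..<N} - {i}. [:(k j)\<^sup>2, 1:])"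

lemma poly_eq_sum_lessThan:
  fixes p :: "real poly"
  assumes "degree p < N"
  shows "poly p x = (\<Sum>l<N. coeff p l * x ^ l)"
  unfolding poly_altdef using assms
  by (intro sum.mono_neutral_left) (auto intro: coeff_eq_0)

lemma degree_prod_linear: "degree (\<Prod>j\<in>A. [:(k j)\<^sup>2, 1:] :: real poly) = card A"
proof (cases "finite A")
  case True
  then have "degree (\<Prod>j\<in>A. [:(k j)\<^sup>2, 1:]) = (\<Sum>j\<in>A. degree [:(k j)\<^sup>2, 1::real:])"
    by (intro degree_prod_eq_sum_degree) auto
  then show ?thesis by simp
qed simp

lemma degree_lagrange: "i < N \<Longrightarrow> degree (lagrange N k i) < N"
  unfolding lagrange_def
  by (rule le_less_trans[OF Polynomial.degree_smult_le]) (simp add: degree_prod_linear)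

lemma poly_lagrange:
  assumes inj: "inj_on (\<lambda>j. (k j)\<^sup>2) {..<N}" and "i < N" "l < N"
  shows "poly (lagrange N k i) (- (k l)\<^sup>2) = (if i = l then 1 else 0)"
proof (cases "i = l")
  case True
  then have "(\<Prod>j\<in>{..<N} - {i}. (k j)\<^sup>2 - (k i)\<^sup>2) \<noteq> 0"
    using inj assms by (auto simp: inj_on_def)
  with True show ?thesis by (simp add: lagrange_def poly_prod)
next
  case False
  then show ?thesis using assms by (auto simp: lagrange_def poly_prod)
qed

definition lagrange_mat :: "nat \<Rightarrow> (nat \<Rightarrow> real) \<Rightarrow> real mat" where
  "lagrange_mat N k = Matrix.mat N N (\<lambda>(i, l). coeff (lagrange N k i) l)"

text \<open>A row of coefficients times a column of powers of a node evaluates the basis polynomial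
  at that node.\<close>

lemma lagrange_mat_V:
  assumes "inj_on (\<lambda>j. (k j)\<^sup>2) {..<N}"
  shows "lagrange_mat N k * V_mat N k = 1\<^sub>m N"
proof (rule eq_matI)
  fix i j assume ij: "i < dim_row (1\<^sub>m N)" "j < dim_col (1\<^sub>m N)"
  then have "(lagrange_mat N k * V_mat N k) $$ (i, j) = (\<Sum>l<N. coeff (lagrange N k i) l * (- (k j)\<^sup>2) ^ l)"
    by (auto simp: lagrange_mat_def V_mat_def scalar_prod_def lessThan_atLeast0)
  also have "\<dots> = poly (lagrange N k i) (- (k j)\<^sup>2)"
    using ij by (intro poly_eq_sum_lessThan[symmetric] degree_lagrange) auto
  finally show "(lagrange_mat N k * V_mat N k) $$ (i, j) = 1\<^sub>m N $$ (i, j)"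
    using ij poly_lagrange[OF assms] by auto
qed (auto simp: lagrange_mat_def V_mat_def)

lemma mat_inv_V: "inj_on (\<lambda>j. (k j)\<^sup>2) {..<N} \<Longrightarrow> mat_inv (V_mat N k) = lagrange_mat N k"
  by (rule mat_inv_eqI[OF _ _ lagrange_mat_V]) (auto simp: lagrange_mat_def V_mat_def)

text \<open>With equal columns \<open>i\<close> and \<open>j\<close>, a left inverse would make the
  same number both \<open>1\<close> and \<open>0\<close>. Knowing the degenerate value keeps the
  coefficients explicit, hence measurable, on the whole sample space.\<close>

lemma mat_inv_V_ties:
  assumes "\<not> inj_on (\<lambda>j. (k j)\<^sup>2) {..<N}"
  shows "mat_inv (V_mat N k) = 0\<^sub>m N N"
proof -
  have V: "V_mat N k \<in> carrier_mat N N" by (simp add: V_mat_def)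
  obtain i j where ij: "i < N" "j < N" "i \<noteq> j" "(k i)\<^sup>2 = (k j)\<^sup>2"
    using assms by (auto simp: inj_on_def)
  show ?thesis
  proof (cases rule: mat_inv_cases[OF V])
    case 2
    have "(mat_inv (V_mat N k) * V_mat N k) $$ (i, i) = (mat_inv (V_mat N k) * V_mat N k) $$ (i, j)"
      using ij 2(2) by (simp add: V_mat_def scalar_prod_def)
    with ij show ?thesis by (simp add: 2(1))
  qed
qed

lemma mat_inv_K:
  "mat_inv (K_mat N k) = (if \<forall>i<N. k i \<noteq> 0 then mat_diag N (\<lambda>i. 1 / k i) else 0\<^sub>m N N)"
proof -
  have K: "K_mat N k \<in> carrier_mat N N" by (simp add: K_mat_def mat_diag_def)
  show ?thesis
  proof (cases "\<forall>i<N. k i \<noteq> 0")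
    case True
    have "mat_inv (K_mat N k) = mat_diag N (\<lambda>i. 1 / k i)"
      by (rule mat_inv_eqI[OF K]) (use True in \<open>auto simp: K_mat_def\<close>, auto simp: mat_diag_def intro!: eq_matI)
    then show ?thesis using True by simp
  next
    case False
    then obtain i where i: "i < N" "k i = 0" by auto
    show ?thesis
    proof (cases rule: mat_inv_cases[OF K])
      case 2
      have "(mat_inv (K_mat N k) * K_mat N k) $$ (i, i) = 0"
        using i 2(2) by (auto simp: K_mat_def mat_diag_def scalar_prod_def intro!: sum.neutral)
      with i show ?thesis by (simp add: 2(1))
    qed (use False in auto)
  qed
qed

text \<open>Component \<open>i\<close> of the inverse Vandermonde matrix applied to
  \<open>t\<close>, provided that the squares are distinct.\<close>

definition lag_sum :: "nat \<Rightarrow> (nat \<Rightarrow> real) \<Rightarrow> (nat \<Rightarrow> real) \<Rightarrow> nat \<Rightarrow> real" where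
  "lag_sum N k t i = (\<Sum>l<N. coeff (lagrange N k i) l * t l)"

lemma X_coeff_eq:
  assumes "i < N"
  shows "vec_index (X_coeff N k v) i =
    (if inj_on (\<lambda>j. (k j)\<^sup>2) {..<N} then lag_sum N k (\<lambda>l. (deriv ^^ (2 * l)) v 0) i else 0)"
  using assms
  by (auto simp: X_coeff_def mat_inv_V mat_inv_V_ties lagrange_mat_def T_even_def lag_sum_def scalar_prod_def
      lessThan_atLeast0)

lemma Y_coeff_eq:
  assumes "i < N"
  shows "vec_index (Y_coeff N k v) i =
    (if inj_on (\<lambda>j. (k j)\<^sup>2) {..<N} \<and> (\<forall>j<N. k j \<noteq> 0)
     then lag_sum N k (\<lambda>l. (deriv ^^ (2 * l + 1)) v 0) i / k i else 0)"
proof -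
  let ?z = "mat_inv (V_mat N k) *\<^sub>v T_odd N v"
  have z: "vec_index ?z j =
    (if inj_on (\<lambda>j. (k j)\<^sup>2) {..<N} then lag_sum N k (\<lambda>l. (deriv ^^ (2 * l + 1)) v 0) j else 0)" if "j < N" for j
    using that by (auto simp: mat_inv_V mat_inv_V_ties lagrange_mat_def T_odd_def lag_sum_def scalar_prod_def
      lessThan_atLeast0)
  have dim: "dim_vec ?z = N"
    by (cases "inj_on (\<lambda>j. (k j)\<^sup>2) {..<N}") (auto simp: mat_inv_V mat_inv_V_ties lagrange_mat_def)
  have "vec_index (mat_diag N (\<lambda>i. 1 / k i) *\<^sub>v ?z) i = vec_index ?z i / k i"
  proof -
    have "vec_index (mat_diag N (\<lambda>i. 1 / k i) *\<^sub>v ?z) i =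
      (\<Sum>l\<in>{0..<N}. (if i = l then 1 / k l else 0) * vec_index ?z l)"
      using assms dim by (auto simp: mat_diag_def scalar_prod_def intro!: sum.cong)
    also have "\<dots> = (\<Sum>l\<in>{0..<N}. if i = l then vec_index ?z l / k l else 0)"
      by (intro sum.cong) auto
    also have "\<dots> = vec_index ?z i / k i" using assms by simp
    finally show ?thesis .
  qed
  moreover have "vec_index (0\<^sub>m N N *\<^sub>v ?z) i = 0"
    using assms dim by (simp add: scalar_prod_def)
  ultimately show ?thesis
    using z[OF assms] by (auto simp: Y_coeff_def mat_inv_K)
qed

text \<open>The Lagrange matrix is also a right inverse of the Vandermonde matrix. Row
  \<open>n\<close> of that identity is the interpolation condition on a derivative at the
  center.\<close>

lemma lag_sum_moments:
  assumes inj: "inj_on (\<lambda>j. (k j)\<^sup>2) {..<N}" and "n < N"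
  shows "(\<Sum>i<N. (- (k i)\<^sup>2) ^ n * lag_sum N k t i) = t n"
proof -
  have "V_mat N k * lagrange_mat N k = 1\<^sub>m N"
    by (rule mat_mult_left_right_inverse[OF _ _ lagrange_mat_V[OF inj]]) (auto simp: lagrange_mat_def V_mat_def)
  moreover have "(V_mat N k * lagrange_mat N k) $$ (n, l) = (\<Sum>i<N. (- (k i)\<^sup>2) ^ n * coeff (lagrange N k i) l)"
    if "l < N" for l
    using that assms by (simp add: lagrange_mat_def V_mat_def scalar_prod_def lessThan_atLeast0)
  ultimately have *: "(\<Sum>i<N. (- (k i)\<^sup>2) ^ n * coeff (lagrange N k i) l) = (if n = l then 1 else 0)" if "l < N" for l
    using that assms by simp
  have "(\<Sum>i<N. (- (k i)\<^sup>2) ^ n * lag_sum N k t i) = (\<Sum>l<N. (\<Sum>i<N. (- (k i)\<^sup>2) ^ n * coeff (lagrange N k i) l) * t l)"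
    unfolding lag_sum_def sum_distrib_left sum_distrib_right by (subst sum.swap) (simp add: mult_ac)
  also have "\<dots> = (\<Sum>l<N. if n = l then t l else 0)"
    by (intro sum.cong) (auto simp: *)
  finally show ?thesis using assms by simp
qed

lemma coeff_prod_nonneg:
  assumes "finite A" "\<And>j. j \<in> A \<Longrightarrow> \<forall>l. coeff (p j) l \<ge> (0::real)"
  shows "coeff (\<Prod>j\<in>A. p j) l \<ge> 0"
  using assms by (induction A arbitrary: l) (auto simp: coeff_mult intro!: sum_nonneg)

abbreviation node_prod :: "real \<Rightarrow> (nat \<Rightarrow> real) \<Rightarrow> nat \<Rightarrow> nat \<Rightarrow> real" where
  "node_prod C k N i \<equiv> \<Prod>j\<in>{..<N} - {i}. (C\<^sup>2 + (k j)\<^sup>2) / \<bar>(k i)\<^sup>2 - (k j)\<^sup>2\<bar>"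

lemma lag_sum_bound:
  assumes t: "\<And>l. l < N \<Longrightarrow> \<bar>t l\<bar> \<le> T * (C\<^sup>2) ^ l" and i: "i < N"
  shows "\<bar>lag_sum N k t i\<bar> \<le> T * node_prod C k N i"
proof -
  let ?p = "\<Prod>j\<in>{..<N} - {i}. [:(k j)\<^sup>2, 1:]" and ?d = "\<Prod>j\<in>{..<N} - {i}. (k j)\<^sup>2 - (k i)\<^sup>2"
  have nonneg: "coeff ?p l \<ge> 0" for l
    by (rule coeff_prod_nonneg) (auto simp: coeff_pCons split: nat.split)
  have "\<bar>lag_sum N k t i\<bar> \<le> (\<Sum>l<N. \<bar>coeff (lagrange N k i) l * t l\<bar>)"
    unfolding lag_sum_def by (rule sum_abs)
  also have "\<dots> \<le> (\<Sum>l<N. coeff ?p l / \<bar>?d\<bar> * (T * (C\<^sup>2) ^ l))"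
  proof (intro sum_mono)
    fix l assume "l \<in> {..<N}"
    have "\<bar>coeff (lagrange N k i) l\<bar> = coeff ?p l / \<bar>?d\<bar>"
      using nonneg[of l] by (simp add: lagrange_def abs_mult)
    then show "\<bar>coeff (lagrange N k i) l * t l\<bar> \<le> coeff ?p l / \<bar>?d\<bar> * (T * (C\<^sup>2) ^ l)"
      using t[of l] \<open>l \<in> _\<close> nonneg[of l] by (auto simp: abs_mult intro!: mult_left_mono divide_right_mono)
  qed
  also have "\<dots> = T * ((\<Sum>l<N. coeff ?p l * (C\<^sup>2) ^ l) / \<bar>?d\<bar>)"
    by (simp add: sum_distrib_left sum_divide_distrib mult_ac)
  also have "(\<Sum>l<N. coeff ?p l * (C\<^sup>2) ^ l) = poly ?p (C\<^sup>2)"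
    using i by (intro poly_eq_sum_lessThan[symmetric]) (simp add: degree_prod_linear)
  also have "poly ?p (C\<^sup>2) / \<bar>?d\<bar> = node_prod C k N i"
    by (simp add: poly_prod prod_dividef abs_prod add.commute abs_minus_commute)
  finally show ?thesis .
qed

lemma measurable_coeff_prod:
  fixes f :: "nat \<Rightarrow> 'w \<Rightarrow> real"
  assumes "finite A" and [measurable]: "\<And>j. j \<in> A \<Longrightarrow> f j \<in> borel_measurable P"
  shows "(\<lambda>\<omega>. coeff (\<Prod>j\<in>A. [:f j \<omega>, 1:]) l) \<in> borel_measurable P"
  using assms
proof (induction A arbitrary: l)
  case (insert a A)
  have [measurable]: "f a \<in> borel_measurable P" "(\<lambda>\<omega>. coeff (\<Prod>j\<in>A. [:f j \<omega>, 1:]) l) \<in> borel_measurable P" for l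
    using insert by auto
  have "(\<lambda>\<omega>. coeff [:f a \<omega>, 1:] l) \<in> borel_measurable P" for l
    by (cases l; cases "l - 1") (auto simp: coeff_pCons split: nat.split)
  then show ?case
    using insert by (simp add: coeff_mult del: mult_pCons_left mult_pCons_right)
qed simp

lemma measurable_lag_sum:
  assumes [measurable]: "\<And>j. j < N \<Longrightarrow> k j \<in> borel_measurable P" and i: "i < N"
  shows "(\<lambda>\<omega>. lag_sum N (\<lambda>j. k j \<omega>) t i) \<in> borel_measurable P"
proof -
  have [measurable]: "k i \<in> borel_measurable P" using i by simp
  have "(\<lambda>\<omega>. coeff (\<Prod>j\<in>{..<N} - {i}. [:(k j \<omega>)\<^sup>2, 1:]) l) \<in> borel_measurable P" for l
    by (rule measurable_coeff_prod) auto
  then show ?thesis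
    unfolding lag_sum_def lagrange_def Polynomial.coeff_smult
    by (intro borel_measurable_sum borel_measurable_times borel_measurable_const borel_measurable_divide
        borel_measurable_prod borel_measurable_diff borel_measurable_power) auto
qed

section \<open>Interpolation by random features\<close>

text \<open>Differentiation is a phase shift by a quarter turn, so one formula covers all orders
  \<open>n\<close>.\<close>

definition trig_sum :: "nat \<Rightarrow> (nat \<Rightarrow> real) \<Rightarrow> (nat \<Rightarrow> real) \<Rightarrow> (nat \<Rightarrow> real) \<Rightarrow> nat \<Rightarrow> real \<Rightarrow> real" where
  "trig_sum N k X Y n x =
     (\<Sum>i<N. k i ^ n * (X i * cos (k i * x + real n * (pi / 2)) + Y i * sin (k i * x + real n * (pi / 2))))"

lemma deriv_seq_trig_sum: "deriv_seq UNIV (trig_sum N k X Y)"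
  unfolding deriv_seq_def
proof (intro allI ballI)
  fix n x
  have "cos (a + real (Suc n) * (pi / 2)) = - sin (a + real n * (pi / 2))"
    "sin (a + real (Suc n) * (pi / 2)) = cos (a + real n * (pi / 2))" for a
  proof -
    have *: "a + real (Suc n) * (pi / 2) = (a + real n * (pi / 2)) + pi / 2"
      by (simp add: algebra_simps add_divide_distrib)
    show "cos (a + real (Suc n) * (pi / 2)) = - sin (a + real n * (pi / 2))"
      "sin (a + real (Suc n) * (pi / 2)) = cos (a + real n * (pi / 2))"
      unfolding * cos_add[of "_ + _" "pi / 2"] sin_add[of "_ + _" "pi / 2"] by simp_all
  qed
  then show "(trig_sum N k X Y n has_real_derivative trig_sum N k X Y (Suc n) x) (at x)"
    unfolding trig_sum_def[abs_def] by (auto intro!: derivative_eq_intros sum.cong simp: algebra_simps)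
qed

lemma deriv_seq_translate:
  assumes "deriv_seq UNIV f"
  shows "deriv_seq UNIV (\<lambda>n x. f n (x - a))"
  unfolding deriv_seq_def
proof (intro allI ballI)
  fix n x
  show "((\<lambda>x. f n (x - a)) has_real_derivative f (Suc n) (x - a)) (at x)"
    using deriv_seqD[OF assms, of "x - a" n] DERIV_shift[of "f n" "f (Suc n) (x - a)" x "- a"] by simp
qed

lemma trig_sum_0:
  "trig_sum N k X Y (2 * n) 0 = (\<Sum>i<N. (- (k i)\<^sup>2) ^ n * X i)"
  "trig_sum N k X Y (2 * n + 1) 0 = (\<Sum>i<N. (- (k i)\<^sup>2) ^ n * (k i * Y i))"
proof -
  have pow: "(- (k i)\<^sup>2) ^ n = (-1) ^ n * k i ^ (2 * n)" for i
    by (subst power_minus) (simp add: power_mult)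
  have e: "real (2 * n) * (pi / 2) = real n * pi" and o: "real (2 * n + 1) * (pi / 2) = real n * pi + pi / 2"
    by (simp_all add: algebra_simps)
  show "trig_sum N k X Y (2 * n) 0 = (\<Sum>i<N. (- (k i)\<^sup>2) ^ n * X i)"
    unfolding trig_sum_def e pow by (intro sum.cong) auto
  show "trig_sum N k X Y (2 * n + 1) 0 = (\<Sum>i<N. (- (k i)\<^sup>2) ^ n * (k i * Y i))"
    unfolding trig_sum_def o pow by (intro sum.cong) (auto simp: cos_add sin_add)
qed

text \<open>Taylor's estimate without its factorial: descending from order \<open>n0\<close>, each
  derivative vanishes at the center and the mean value inequality gains one factor
  \<open>r\<close>.\<close>

lemma deriv_seq_vanishing_bound:
  assumes w: "deriv_seq (ball c r) w" and r: "r > 0" and 0: "\<And>n. n < n0 \<Longrightarrow> w n c = 0"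
    and B: "\<And>x. x \<in> ball c r \<Longrightarrow> \<bar>w n0 x\<bar> \<le> B" and "l \<le> n0" and x: "x \<in> ball c r"
  shows "\<bar>w l x\<bar> \<le> r ^ (n0 - l) * B"
  using \<open>l \<le> n0\<close> x
proof (induction l arbitrary: x rule: inc_induct)
  case base
  then show ?case using B by simp
next
  case (step l)
  have "norm (w l x - w l c) \<le> (r ^ (n0 - Suc l) * B) * norm (x - c)"
  proof (rule field_differentiable_bound[of "ball c r"])
    show "(w l has_field_derivative w (Suc l) z) (at z within ball c r)" if "z \<in> ball c r" for z
      using deriv_seqD[OF w that] by (rule has_field_derivative_at_within)
  qed (use step r in auto)
  also have "\<dots> \<le> (r ^ (n0 - Suc l) * B) * r"
  proof (rule mult_left_mono)
    show "norm (x - c) \<le> r" using step.prems by (simp add: dist_real_def)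
    have "0 \<le> B" using B[of c] r by (smt (verit) centre_in_ball)
    then show "0 \<le> r ^ (n0 - Suc l) * B" using r by simp
  qed
  also have "\<dots> = r ^ (n0 - l) * B"
    using step.hyps by (simp add: Suc_diff_Suc flip: power_Suc2)
  finally show ?case using 0[OF step.hyps(2)] by simp
qed

text \<open>At \<open>0\<close> even derivatives see only the cosines and odd ones only
  \<open>k i * Y i\<close>; the division by \<open>k i\<close> undoes the factor produced by
  differentiating a sine.\<close>

lemma trig_sum_interpolates:
  assumes inj: "inj_on (\<lambda>j. (k j)\<^sup>2) {..<N}" and nz: "\<And>i. i < N \<Longrightarrow> k i \<noteq> 0" and "n < 2 * N"
  shows "trig_sum N k (lag_sum N k (\<lambda>l. v (2 * l))) (\<lambda>i. lag_sum N k (\<lambda>l. v (2 * l + 1)) i / k i) n 0 = v n"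
proof (cases "even n")
  case True
  then obtain a where "n = 2 * a" by blast
  with assms show ?thesis
    by (simp only: trig_sum_0) (simp add: lag_sum_moments)
next
  case False
  then obtain a where a: "n = 2 * a + 1" by (blast elim: oddE)
  have "(\<Sum>i<N. (- (k i)\<^sup>2) ^ a * (k i * (lag_sum N k (\<lambda>l. v (2 * l + 1)) i / k i)))
     = (\<Sum>i<N. (- (k i)\<^sup>2) ^ a * lag_sum N k (\<lambda>l. v (2 * l + 1)) i)"
    using nz by (intro sum.cong) auto
  with a assms show ?thesis
    by (simp only: trig_sum_0) (simp add: lag_sum_moments)
qed

lemma fact_powr_mono: "n \<le> n' \<Longrightarrow> s \<ge> 0 \<Longrightarrow> (fact n :: real) powr s \<le> fact n' powr s"
  by (intro powr_mono2 fact_mono) auto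

text \<open>The difference vanishes to order \<open>2 * N\<close> at the center, so only derivatives
  of order \<open>2 * N\<close> have to be bounded, for \<open>u\<close> by the Gevrey estimate and
  for the features through their coefficients.\<close>

lemma trig_interpolation_error:
  fixes c r C M s :: real
  assumes du: "deriv_seq (ball c r) du" and pos: "r > 0" "C > 0" "M \<ge> 0" "s \<ge> 0"
    and bound: "\<And>n x. x \<in> ball c r \<Longrightarrow> \<bar>du n x\<bar> \<le> M * C ^ n * fact n powr s"
    and inj: "inj_on (\<lambda>j. (k j)\<^sup>2) {..<N}" and nz: "\<And>i. i < N \<Longrightarrow> k i \<noteq> 0"
    and q: "\<And>i. i < N \<Longrightarrow> node_prod C k N i \<le> q i"
    and X: "X = lag_sum N k (\<lambda>l. du (2 * l) c)" and Y: "Y = (\<lambda>i. lag_sum N k (\<lambda>l. du (2 * l + 1) c) i / k i)"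
    and l: "l \<le> 2 * N" and x: "x \<in> ball c r"
  shows "\<bar>du l x - trig_sum N k X Y l (x - c)\<bar> \<le>
    r ^ (2 * N - l) * (M * fact (2 * N) powr s * (C ^ (2 * N) + (\<Sum>i<N. q i * (k i ^ (2 * N) + C * \<bar>k i\<bar> ^ (2 * N - 1)))))"
proof (rule deriv_seq_vanishing_bound[where w = "\<lambda>l x. du l x - trig_sum N k X Y l (x - c)", OF _ pos(1) _ _ l x])
  let ?F = "M * fact (2 * N) powr s"
  have c: "c \<in> ball c r" using pos by simp
  have F: "?F \<ge> 0" using pos by simp
  show "deriv_seq (ball c r) (\<lambda>l x. du l x - trig_sum N k X Y l (x - c))"
    using du deriv_seq_translate[OF deriv_seq_trig_sum, of N k X Y c]
    by (auto simp: deriv_seq_def intro!: derivative_intros)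
  show "du n c - trig_sum N k X Y n (c - c) = 0" if "n < 2 * N" for n
    using trig_sum_interpolates[OF inj nz that, of "\<lambda>n. du n c"] by (simp add: X Y)
  fix x assume x: "x \<in> ball c r"
  have summand: "\<bar>k i ^ (2 * N) * (X i * a + Y i * b)\<bar> \<le> ?F * (q i * (k i ^ (2 * N) + C * \<bar>k i\<bar> ^ (2 * N - 1)))"
    if i: "i < N" and ab: "\<bar>a\<bar> \<le> 1" "\<bar>b\<bar> \<le> 1" for i a b
  proof -
    let ?p = "node_prod C k N i"
    have der: "\<bar>du n c\<bar> \<le> ?F * C ^ n" if "n \<le> 2 * N" for n
    proof -
      have "\<bar>du n c\<bar> \<le> M * C ^ n * fact n powr s" by (rule bound[OF c])
      also have "\<dots> \<le> M * C ^ n * fact (2 * N) powr s"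
        using pos that by (intro mult_left_mono fact_powr_mono) auto
      finally show ?thesis by (simp add: mult_ac)
    qed
    have "\<bar>X i\<bar> \<le> ?F * ?p"
      unfolding X using der by (intro lag_sum_bound[OF _ i]) (simp flip: power_mult)
    also have "\<dots> \<le> ?F * q i" using q[OF i] F by (rule mult_left_mono)
    finally have X': "\<bar>X i\<bar> \<le> ?F * q i" .
    have "\<bar>k i * Y i\<bar> = \<bar>lag_sum N k (\<lambda>l. du (2 * l + 1) c) i\<bar>"
      using nz[OF i] by (simp add: Y)
    also have "\<dots> \<le> (?F * C) * ?p"
    proof (intro lag_sum_bound[OF _ i])
      fix l assume "l < N"
      then show "\<bar>du (2 * l + 1) c\<bar> \<le> ?F * C * (C\<^sup>2) ^ l"
        using der[of "2 * l + 1"] by (simp add: mult_ac flip: power_mult)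
    qed
    also have "\<dots> \<le> (?F * C) * q i"
      using q[OF i] F pos by (intro mult_left_mono) auto
    finally have Y': "\<bar>k i * Y i\<bar> \<le> ?F * C * q i" .
    \<comment> \<open>Only the product \<open>k i * Y i\<close> is controlled, so one power of the
      frequency is spent on it. The odd data compensate with one more factor
      \<open>C\<close>.\<close>
    have "k i ^ (2 * N) * (X i * a + Y i * b) = k i ^ (2 * N) * X i * a + k i ^ (2 * N - 1) * (k i * Y i) * b"
      using i by (cases N) (simp_all add: algebra_simps)
    also have "\<bar>\<dots>\<bar> \<le> \<bar>k i ^ (2 * N) * X i\<bar> * \<bar>a\<bar> + \<bar>k i ^ (2 * N - 1) * (k i * Y i)\<bar> * \<bar>b\<bar>"
      by (metis abs_mult abs_triangle_ineq)
    also have "\<dots> \<le> \<bar>k i ^ (2 * N) * X i\<bar> * 1 + \<bar>k i ^ (2 * N - 1) * (k i * Y i)\<bar> * 1"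
      using ab by (intro add_mono mult_left_mono) auto
    also have "\<dots> = k i ^ (2 * N) * \<bar>X i\<bar> + \<bar>k i\<bar> ^ (2 * N - 1) * \<bar>k i * Y i\<bar>"
      by (simp add: abs_mult power_abs power_mult)
    also have "\<dots> \<le> k i ^ (2 * N) * (?F * q i) + \<bar>k i\<bar> ^ (2 * N - 1) * (?F * C * q i)"
      using X' Y' by (intro add_mono mult_left_mono) (auto simp: power_mult)
    finally show ?thesis by (simp add: algebra_simps)
  qed
  have "\<bar>trig_sum N k X Y (2 * N) (x - c)\<bar> \<le> (\<Sum>i<N. ?F * (q i * (k i ^ (2 * N) + C * \<bar>k i\<bar> ^ (2 * N - 1))))"
    unfolding trig_sum_def by (rule order_trans[OF sum_abs]) (intro sum_mono summand, auto)
  moreover have "\<bar>du (2 * N) x\<bar> \<le> ?F * C ^ (2 * N)"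
    using bound[OF x, of "2 * N"] by (simp add: mult_ac)
  ultimately show "\<bar>du (2 * N) x - trig_sum N k X Y (2 * N) (x - c)\<bar>
      \<le> ?F * (C ^ (2 * N) + (\<Sum>i<N. q i * (k i ^ (2 * N) + C * \<bar>k i\<bar> ^ (2 * N - 1))))"
    unfolding distrib_left[of ?F "C ^ (2 * N)"] sum_distrib_left[symmetric] by linarith
qed

text \<open>The event does not involve \<open>x\<close>, so differentiation passes to the feature
  sum.\<close>

definition rf_deriv ::
  "real \<Rightarrow> nat \<Rightarrow> (nat \<Rightarrow> real) \<Rightarrow> real \<Rightarrow> real \<Rightarrow> real \<Rightarrow> (real \<Rightarrow> real) \<Rightarrow> nat \<Rightarrow> real \<Rightarrow> real" where
  "rf_deriv varpi N k \<mu> C c v n x = (if good_event varpi N k \<mu> C c then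
     trig_sum N k (vec_index (X_coeff N k v)) (vec_index (Y_coeff N k v)) n x else 0)"

lemma rf_deriv_0: "rf_deriv varpi N k \<mu> C c v 0 = rf_operator varpi N k \<mu> C c v"
  by (simp add: rf_deriv_def rf_operator_def trig_sum_def fun_eq_iff)

lemma deriv_seq_rf_deriv: "deriv_seq UNIV (rf_deriv varpi N k \<mu> C c v)"
  using deriv_seq_trig_sum by (auto simp: deriv_seq_def rf_deriv_def[abs_def])

lemma trig_sum_cong:
  "(\<And>i. i < N \<Longrightarrow> X i = X' i) \<Longrightarrow> (\<And>i. i < N \<Longrightarrow> Y i = Y' i) \<Longrightarrow> trig_sum N k X Y n x = trig_sum N k X' Y' n x"
  unfolding trig_sum_def by (intro sum.cong) auto

lemma deriv_iterate_shift:
  assumes "open S" "deriv_seq S (\<lambda>n. (deriv ^^ n) u)" "c \<in> S"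
  shows "(deriv ^^ n) (\<lambda>y. u (y + c)) 0 = (deriv ^^ n) u c"
proof -
  let ?T = "(\<lambda>x. x - c) ` S"
  have T: "y \<in> ?T \<Longrightarrow> y + c \<in> S" for y by auto
  have "deriv_seq ?T (\<lambda>n y. (deriv ^^ n) u (y + c))"
    unfolding deriv_seq_def
  proof (intro allI ballI)
    fix n y assume "y \<in> ?T"
    from deriv_seqD[OF assms(2) T[OF this], of n]
    show "((\<lambda>y. (deriv ^^ n) u (y + c)) has_real_derivative (deriv ^^ Suc n) u (y + c)) (at y)"
      by (simp only: DERIV_shift)
  qed
  moreover have "open ?T" using open_translation_subtract[OF assms(1), of c] by simp
  ultimately have "(deriv ^^ n) (\<lambda>y. u (y + c)) 0 = (deriv ^^ n) u (0 + c)"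
    by (intro deriv_seq_iterate[of ?T "\<lambda>n y. (deriv ^^ n) u (y + c)"]) (use assms(3) in \<open>auto simp: image_iff\<close>)
  then show ?thesis by simp
qed

text \<open>The last summand accounts for the complement of the good event, where the operator vanishes
  and \<open>u\<close> itself is the error.\<close>

lemma rf_error_bound:
  fixes c r C M s :: real
  assumes du: "deriv_seq (ball c r) (\<lambda>n. (deriv ^^ n) u)" and pos: "r > 0" "C > 0" "M \<ge> 0" "s \<ge> 0"
    and Cr: "C * r \<le> 1"
    and bound: "\<And>n x. x \<in> ball c r \<Longrightarrow> \<bar>(deriv ^^ n) u x\<bar> \<le> M * C ^ n * fact n powr s"
    and l: "l \<le> 2 * N" and x: "x \<in> ball c r"
    and regular: "good_event varpi N k \<mu> C \<kappa> \<Longrightarrow> inj_on (\<lambda>j. (k j)\<^sup>2) {..<N} \<and> (\<forall>i<N. k i \<noteq> 0)"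
    and q: "\<And>i. i < N \<Longrightarrow> q i = (exp \<kappa> * Q_fun varpi \<kappa> (\<bar>k i\<bar> / \<mu>) (C / \<mu>)) ^ (N - 1)"
  shows "\<bar>(deriv ^^ l) u x - rf_deriv varpi N k \<mu> C \<kappa> (\<lambda>y. u (y + c)) l (x - c)\<bar> \<le>
    M * fact (2 * N) powr s * ((C * r) ^ (2 * N) + r ^ (2 * N) * (\<Sum>i<N. \<bar>q i\<bar> * (k i ^ (2 * N) + C * \<bar>k i\<bar> ^ (2 * N - 1)))
       + (if good_event varpi N k \<mu> C \<kappa> then 0 else 1)) / r ^ l"
proof -
  let ?F = "M * fact (2 * N) powr s"
  let ?S = "\<Sum>i<N. \<bar>q i\<bar> * (k i ^ (2 * N) + C * \<bar>k i\<bar> ^ (2 * N - 1))"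
  have F: "?F \<ge> 0" using pos by simp
  have S: "?S \<ge> 0" using pos by (intro sum_nonneg) (auto simp: power_mult)
  show ?thesis
  proof (cases "good_event varpi N k \<mu> C \<kappa>")
    case True
    with regular have inj: "inj_on (\<lambda>j. (k j)\<^sup>2) {..<N}" and nz: "\<And>i. i < N \<Longrightarrow> k i \<noteq> 0" by auto
    let ?X = "lag_sum N k (\<lambda>l. (deriv ^^ (2 * l)) u c)" and ?Y = "\<lambda>i. lag_sum N k (\<lambda>l. (deriv ^^ (2 * l + 1)) u c) i / k i"
    have shift: "(deriv ^^ n) (\<lambda>y. u (y + c)) 0 = (deriv ^^ n) u c" for n
      using pos by (intro deriv_iterate_shift[OF _ du]) auto
    have "rf_deriv varpi N k \<mu> C \<kappa> (\<lambda>y. u (y + c)) l (x - c) = trig_sum N k ?X ?Y l (x - c)"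
      unfolding rf_deriv_def using True inj nz
      by (simp only: if_True) (intro trig_sum_cong; simp only: X_coeff_eq Y_coeff_eq shift if_True simp_thms; simp)
    moreover have "\<bar>(deriv ^^ l) u x - trig_sum N k ?X ?Y l (x - c)\<bar> \<le> r ^ (2 * N - l) * (?F * (C ^ (2 * N) + ?S))"
    proof (rule trig_interpolation_error[where du = "\<lambda>n. (deriv ^^ n) u", OF du pos bound inj nz _ refl refl l x])
      fix i assume i: "i < N"
      show "node_prod C k N i \<le> \<bar>q i\<bar>"
      \<comment> \<open>For \<open>N = 1\<close> the event is sure and gives no inequality, but the
        product is empty and the threshold has exponent \<open>0\<close>, so both are
        \<open>1\<close>.\<close>
      proof (cases "N = 1")
        case True
        then have "{..<N} - {i} = {}" using i by auto
        then show ?thesis using q[OF i] True by (simp only: prod.empty) simp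
      next
        case False
        then have "node_prod C k N i < q i"
          using True i by (simp add: good_event_def q)
        then show ?thesis by linarith
      qed
    qed
    moreover have "r ^ (2 * N - l) * (?F * (C ^ (2 * N) + ?S)) = ?F * ((C * r) ^ (2 * N) + r ^ (2 * N) * ?S) / r ^ l"
      using pos l by (simp add: power_diff power_mult_distrib algebra_simps add_divide_distrib)
    ultimately show ?thesis using True by simp
  next
    case False
    have "\<bar>(deriv ^^ l) u x\<bar> \<le> M * C ^ l * fact l powr s" by (rule bound[OF x])
    also have "\<dots> \<le> M * C ^ l * fact (2 * N) powr s"
      using pos l by (intro mult_left_mono fact_powr_mono) auto
    also have "\<dots> = ?F * (C * r) ^ l / r ^ l" using pos by (simp add: power_mult_distrib)
    also have "\<dots> \<le> ?F * ((C * r) ^ (2 * N) + r ^ (2 * N) * ?S + 1) / r ^ l"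
    proof -
      \<comment> \<open>Since \<open>C * r \<le> 1\<close>, the powers of all orders
        \<open>l\<close> are absorbed by the summand \<open>1\<close> reserved for the
        complement.\<close>
      have "(C * r) ^ l \<le> 1" using Cr pos by (intro power_le_one) auto
      also have "1 \<le> (C * r) ^ (2 * N) + r ^ (2 * N) * ?S + 1" using S pos by simp
      finally show ?thesis using F pos by (intro divide_right_mono mult_left_mono) auto
    qed
    finally show ?thesis using False by (simp add: rf_deriv_def)
  qed
qed

section \<open>The function Q\<close>

text \<open>Each side of the pole contributes \<open>\<rho> powr (1 - q) / (1 - q)\<close>;
  reflection identifies the two sides.\<close>

lemma nn_integral_singularity:
  fixes \<kappa> \<rho> q :: real
  assumes q: "0 < q" "q < 1" and \<rho>: "\<rho> > 0"
  shows "(\<integral>\<^sup>+ t. ennreal (\<bar>\<kappa> - t\<bar> powr (- q)) * indicator {t. \<bar>t - \<kappa>\<bar> \<le> \<rho>} t \<partial>lborel)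
     \<le> ennreal (2 * \<rho> powr (1 - q) / (1 - q))"
proof -
  let ?g = "\<lambda>t. ennreal (t powr (- q)) * indicator {0..\<rho>} t"
  have I: "(\<integral>\<^sup>+ t. ?g t \<partial>lborel) = ennreal (\<rho> powr (1 - q) / (1 - q))"
  proof (rule nn_integral_has_integral_lebesgue')
    show "((\<lambda>t. t powr (- q)) has_integral (\<rho> powr (1 - q) / (1 - q))) {0..\<rho>}"
      using has_integral_powr_from_0[of "- q" \<rho>] q \<rho> by simp
  qed auto
  have "(\<integral>\<^sup>+ t. ennreal (\<bar>\<kappa> - t\<bar> powr (- q)) * indicator {t. \<bar>t - \<kappa>\<bar> \<le> \<rho>} t \<partial>lborel)
     = (\<integral>\<^sup>+ t. ennreal (\<bar>t\<bar> powr (- q)) * indicator {t. \<bar>t\<bar> \<le> \<rho>} t \<partial>lborel)"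
    by (subst nn_integral_real_affine[where c = 1 and t = \<kappa>])
       (auto intro!: nn_integral_cong split: split_indicator)
  also have "\<dots> \<le> (\<integral>\<^sup>+ t. ?g t + ?g (- t) \<partial>lborel)"
    by (intro nn_integral_mono) (auto split: split_indicator)
  also have "\<dots> = (\<integral>\<^sup>+ t. ?g t \<partial>lborel) + (\<integral>\<^sup>+ t. ?g (- t) \<partial>lborel)"
    by (rule nn_integral_add) auto
  also have "(\<integral>\<^sup>+ t. ?g (- t) \<partial>lborel) = (\<integral>\<^sup>+ t. ?g t \<partial>lborel)"
    using nn_integral_real_affine[where c = "-1" and t = 0 and f = ?g] by simp
  finally show ?thesis
    unfolding I using q by (simp flip: ennreal_plus)
qed

text \<open>\<open>Q_fun\<close> without its power of \<open>varpi\<close>, the only factor that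
  contains \<open>c\<close>.\<close>

definition Q_shape :: "real \<Rightarrow> real \<Rightarrow> real" where
  "Q_shape k w = (let a = max (k - 1/2) 0; b = a + 1 in
      if k > 4/3 then max ((1 + w\<^sup>2) / (2 * (k\<^sup>2 - 1)) + w\<^sup>2 / (2 * k\<^sup>2)) (28 * (1 + w\<^sup>2) / (23 * k\<^sup>2))
      else 2 * max ((w\<^sup>2 + a\<^sup>2) / (k + a)) (max ((w\<^sup>2 + b\<^sup>2) / (k + b)) ((w\<^sup>2 + 1) / (k + 1))))"

lemma Q_fun_eq: "Q_fun varpi c k w = varpi powr (c / (c - 1)) * Q_shape k w"
  by (simp add: Q_fun_def Q_shape_def Let_def)

lemma Q_shape_ge_large: "k > 4/3 \<Longrightarrow> Q_shape k w \<ge> 28 * (1 + w\<^sup>2) / (23 * k\<^sup>2)"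
  by (simp add: Q_shape_def Let_def)

text \<open>For \<open>k \<le> 1/2\<close> the shift \<open>a\<close> is \<open>0\<close> and the
  first quotient is \<open>w\<^sup>2 / k\<close>, which accounts for the growth as \<open>k\<close>
  tends to \<open>0\<close>.\<close>

lemma Q_shape_ge_small:
  assumes "k \<le> 4/3"
  shows "Q_shape k w \<ge> 2 * ((w\<^sup>2 + 1) / (k + 1))"
    and "k \<le> 1/2 \<Longrightarrow> Q_shape k w \<ge> 2 * (w\<^sup>2 / k)"
proof -
  let ?a = "max (k - 1/2) 0"
  let ?A = "(w\<^sup>2 + ?a\<^sup>2) / (k + ?a)" and ?B = "(w\<^sup>2 + (?a + 1)\<^sup>2) / (k + (?a + 1))" and ?C = "(w\<^sup>2 + 1) / (k + 1)"
  have eq: "Q_shape k w = 2 * max ?A (max ?B ?C)"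
    using assms by (simp add: Q_shape_def Let_def)
  have "?C \<le> max ?A (max ?B ?C)"
    by (rule order_trans[OF max.cobounded2 max.cobounded2])
  then show "Q_shape k w \<ge> 2 * ?C"
    unfolding eq by (rule mult_left_mono) simp
  have "?A \<le> max ?A (max ?B ?C)" by (rule max.cobounded1)
  then have "2 * ?A \<le> Q_shape k w"
    unfolding eq by (rule mult_left_mono) simp
  then show "Q_shape k w \<ge> 2 * (w\<^sup>2 / k)" if "k \<le> 1/2"
    using that by (simp add: max_def)
qed

lemma Q_shape_pos: "k > 0 \<Longrightarrow> Q_shape k w > 0"
proof (cases "k > 4/3")
  case True
  have "0 < 28 * (1 + w\<^sup>2) / (23 * k\<^sup>2)" using True by (auto intro!: divide_pos_pos add_pos_nonneg)
  with Q_shape_ge_large[OF True, of w] show ?thesis by linarith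
next
  case False
  assume "k > 0"
  then have "0 < 2 * ((w\<^sup>2 + 1) / (k + 1))" by (auto intro!: divide_pos_pos add_nonneg_pos)
  with Q_shape_ge_small(1)[of k w] False show ?thesis by linarith
qed

text \<open>The quadratic decay pairs each of the \<open>N - 1\<close> factors of the threshold with
  two of the \<open>2 * N\<close> powers of the frequency, which leaves a second moment to
  integrate.\<close>

lemma Q_shape_upper:
  assumes k: "k > 0"
  shows "k\<^sup>2 * Q_shape k w \<le> 11 * (1 + w\<^sup>2)"
proof (cases "k > 4/3")
  case True
  have k2: "k\<^sup>2 > 16/9" using power_strict_mono[OF True, of 2] by (simp add: power2_eq_square)
  have "k\<^sup>2 * ((1 + w\<^sup>2) / (2 * (k\<^sup>2 - 1)) + w\<^sup>2 / (2 * k\<^sup>2)) = (1 + w\<^sup>2) * (k\<^sup>2 / (2 * (k\<^sup>2 - 1))) + w\<^sup>2 / 2"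
  proof -
    have "k\<^sup>2 * ((1 + w\<^sup>2) / (2 * (k\<^sup>2 - 1))) = (1 + w\<^sup>2) * (k\<^sup>2 / (2 * (k\<^sup>2 - 1)))"
      by (simp only: times_divide_eq_right mult.commute)
    moreover have "k\<^sup>2 * (w\<^sup>2 / (2 * k\<^sup>2)) = w\<^sup>2 / 2" using k by simp
    ultimately show ?thesis by (simp only: distrib_left)
  qed
  also have "\<dots> \<le> (1 + w\<^sup>2) * 2 + w\<^sup>2 / 2"
    using k2 by (intro add_mono mult_left_mono) (auto simp: divide_simps)
  also have "\<dots> \<le> 11 * (1 + w\<^sup>2)" by simp
  finally have 1: "k\<^sup>2 * ((1 + w\<^sup>2) / (2 * (k\<^sup>2 - 1)) + w\<^sup>2 / (2 * k\<^sup>2)) \<le> 11 * (1 + w\<^sup>2)" .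
  have 2: "k\<^sup>2 * (28 * (1 + w\<^sup>2) / (23 * k\<^sup>2)) \<le> 11 * (1 + w\<^sup>2)"
    using k by simp
  show ?thesis using 1 2 True by (simp add: Q_shape_def Let_def max_def)
next
  case False
  \<comment> \<open>The values \<open>a\<close>, \<open>a + 1\<close> and \<open>1\<close> all lie
    in \<open>[0, 2]\<close>, so one estimate covers the three quotients. Dropping \<open>y\<close>
    from the denominator uses up one power of \<open>k\<close>.\<close>
  have *: "k\<^sup>2 * ((w\<^sup>2 + y\<^sup>2) / (k + y)) \<le> 11/2 * (1 + w\<^sup>2)" if y: "0 \<le> y" "y \<le> 2" for y
  proof -
    have "k\<^sup>2 * ((w\<^sup>2 + y\<^sup>2) / (k + y)) \<le> k\<^sup>2 * ((w\<^sup>2 + y\<^sup>2) / k)"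
      using k y by (intro mult_left_mono divide_left_mono) auto
    also have "\<dots> = k * (w\<^sup>2 + y\<^sup>2)" using k by (simp add: power2_eq_square)
    also have "\<dots> \<le> 4/3 * (w\<^sup>2 + 4)"
      using y k False power_mono[of y 2 2] by (intro mult_mono add_mono) auto
    also have "\<dots> \<le> 11/2 * (1 + w\<^sup>2)"
      using zero_le_power2[of w] unfolding distrib_left by linarith
    finally show ?thesis .
  qed
  let ?a = "max (k - 1/2) 0"
  have a: "0 \<le> ?a" "?a \<le> 2" "0 \<le> ?a + 1" "?a + 1 \<le> 2" using False by auto
  let ?A = "(w\<^sup>2 + ?a\<^sup>2) / (k + ?a)" and ?B = "(w\<^sup>2 + (?a + 1)\<^sup>2) / (k + (?a + 1))" and ?C = "(w\<^sup>2 + 1) / (k + 1)"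
  have "Q_shape k w = 2 * max ?A (max ?B ?C)"
    using False by (simp add: Q_shape_def Let_def)
  then have "k\<^sup>2 * Q_shape k w = 2 * (k\<^sup>2 * max ?A (max ?B ?C))"
    by (simp only: mult.left_commute)
  moreover have "k\<^sup>2 * max ?A (max ?B ?C) \<le> 11/2 * (1 + w\<^sup>2)"
    using *[OF a(1,2)] *[OF a(3,4)] *[of 1] by (subst max_def, subst max_def) simp
  ultimately show ?thesis by linarith
qed

section \<open>Pole and tail of a single factor\<close>

text \<open>Coefficient of the pole \<open>|k - t| powr (- q)\<close> once the weight
  \<open>max 1 (t ^ 3)\<close> is set aside for the density. For large \<open>k\<close> this weight
  is at least \<open>k ^ 3 / 8\<close> near the pole, whence the exponent \<open>q - 3\<close> and
  the constant \<open>18 = 8 * 9/4\<close>.\<close>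

definition ratio_sing :: "real \<Rightarrow> real \<Rightarrow> real \<Rightarrow> real" where
  "ratio_sing q k w = (if k > 4/3 then 18 * (1 + w\<^sup>2) powr q * k powr (q - 3) else (w\<^sup>2 / k + 10/3) powr q)"

text \<open>The radius that separates pole and tail. For large \<open>k\<close> it is proportional
  to \<open>k\<close>, which keeps \<open>t\<close> comparable to \<open>k\<close> near the pole;
  for small \<open>k\<close> the radius \<open>2\<close> forces \<open>t > 2\<close> on the
  tail.\<close>

definition ratio_rad :: "real \<Rightarrow> real" where
  "ratio_rad k = (if k > 4/3 then k / 2 else 2)"

text \<open>The last quotient has mean \<open>1\<close> as soon as \<open>t\<close> has second
  moment \<open>1\<close>, so the tail is controlled by the normalization alone.\<close>

lemma ratio_far:
  assumes k: "k > 0" and t: "t > 0" and far: "\<bar>t - k\<bar> > ratio_rad k"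
  shows "(w\<^sup>2 + t\<^sup>2) / \<bar>k\<^sup>2 - t\<^sup>2\<bar> \<le> 2 * Q_shape k w * ((w\<^sup>2 + t\<^sup>2) / (w\<^sup>2 + 1))"
proof -
  have pos: "w\<^sup>2 + 1 > 0" "w\<^sup>2 + t\<^sup>2 \<ge> 0" by (auto intro: add_nonneg_pos)
  have "1 / \<bar>k\<^sup>2 - t\<^sup>2\<bar> \<le> 2 * Q_shape k w / (w\<^sup>2 + 1)"
  proof (cases "k > 4/3")
    case True
    have "\<bar>k\<^sup>2 - t\<^sup>2\<bar> \<ge> 3/4 * k\<^sup>2"
    proof (cases "t \<le> k")
      case True
      then have "t \<le> k / 2" using far \<open>k > 4/3\<close> by (auto simp: ratio_rad_def)
      then have "t\<^sup>2 \<le> (k / 2)\<^sup>2" using t by (intro power_mono) auto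
      also have "(k / 2)\<^sup>2 = k\<^sup>2 / 4" by (simp add: power_divide)
      finally show ?thesis using zero_le_power2[of k] by linarith
    next
      case False
      then have "3/2 * k \<le> t" using far \<open>k > 4/3\<close> by (auto simp: ratio_rad_def)
      then have "(3/2 * k)\<^sup>2 \<le> t\<^sup>2" using k by (intro power_mono) auto
      moreover have "(3/2 * k)\<^sup>2 = 9/4 * k\<^sup>2" by (simp add: power_mult_distrib power_divide)
      ultimately show ?thesis using zero_le_power2[of k] by linarith
    qed
    moreover have "0 < 3/4 * k\<^sup>2" using k by simp
    ultimately have "1 / \<bar>k\<^sup>2 - t\<^sup>2\<bar> \<le> 1 / (3/4 * k\<^sup>2)"
      by (intro frac_le) auto
    also have "\<dots> \<le> 2 * (28 * (1 + w\<^sup>2) / (23 * k\<^sup>2)) / (w\<^sup>2 + 1)"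
    proof -
      have "2 * (28 * d / (23 * k\<^sup>2)) / d = 56/23 / k\<^sup>2" if "d > 0" for d :: real
        using that by simp
      from this[OF pos(1)] have "2 * (28 * (1 + w\<^sup>2) / (23 * k\<^sup>2)) / (w\<^sup>2 + 1) = 56/23 / k\<^sup>2"
        by (simp only: add.commute)
      moreover have "1 / (3/4 * k\<^sup>2) = 4/3 / k\<^sup>2" by simp
      moreover have "4/3 / k\<^sup>2 \<le> 56/23 / k\<^sup>2" by (rule divide_right_mono) auto
      ultimately show ?thesis by simp
    qed
    also have "\<dots> \<le> 2 * Q_shape k w / (w\<^sup>2 + 1)"
      by (intro divide_right_mono mult_left_mono Q_shape_ge_large[OF True]) (use pos in auto)
    finally show ?thesis .
  next
    case False
    have "t > 2" using far False k t by (auto simp: ratio_rad_def)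
    then have "t\<^sup>2 > 2\<^sup>2" by (intro power_strict_mono) auto
    moreover have "k\<^sup>2 \<le> (4/3)\<^sup>2" using k False by (intro power_mono) auto
    ultimately have "\<bar>k\<^sup>2 - t\<^sup>2\<bar> \<ge> 1" by (simp add: power2_eq_square)
    then have "1 / \<bar>k\<^sup>2 - t\<^sup>2\<bar> \<le> 1" by (simp add: divide_le_eq)
    also have "\<dots> \<le> 2 * (2 * ((w\<^sup>2 + 1) / (k + 1))) / (w\<^sup>2 + 1)"
    proof -
      have *: "2 * (2 * (d / (k + 1))) / d = 4 / (k + 1)" if "d > 0" for d :: real
        using that by simp
      have "1 \<le> 4 / (k + 1)" using k False by (simp add: le_divide_eq)
      then show ?thesis unfolding *[OF pos(1)] .
    qed
    also have "\<dots> \<le> 2 * Q_shape k w / (w\<^sup>2 + 1)"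
      by (intro divide_right_mono mult_left_mono Q_shape_ge_small(1)) (use False pos in auto)
    finally show ?thesis .
  qed
  from mult_right_mono[OF this pos(2)] show ?thesis by simp
qed

lemma ratio_near:
  assumes q: "0 < q" "q < 1" and k: "k > 0" and t: "t > 0" and near: "\<bar>t - k\<bar> \<le> ratio_rad k"
  shows "((w\<^sup>2 + t\<^sup>2) / \<bar>k\<^sup>2 - t\<^sup>2\<bar>) powr q \<le> ratio_sing q k w * \<bar>k - t\<bar> powr (- q) * max 1 (t ^ 3)"
\<comment> \<open>At \<open>t = k\<close> both sides are \<open>0\<close>, by the values of division
  by zero and of \<open>powr\<close> at base \<open>0\<close>.\<close>
proof (cases "t = k")
  case False
  have fac: "\<bar>k\<^sup>2 - t\<^sup>2\<bar> = (k + t) * \<bar>k - t\<bar>"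
    using k t by (simp add: power2_eq_square square_diff_square_factored abs_mult)
  have d: "\<bar>k - t\<bar> > 0" using False by simp
  show ?thesis
  proof (cases "k > 4/3")
    case True
    have t': "k / 2 \<le> t" "t \<le> 3/2 * k" using near True by (auto simp: ratio_rad_def abs_if split: if_splits)
    have "(k / 2) ^ 3 \<le> t ^ 3" using t' k by (intro power_mono) auto
    then have t3: "k ^ 3 / 8 \<le> max 1 (t ^ 3)" by (simp add: power_divide)
    \<comment> \<open>\<open>k > 4/3\<close> makes \<open>9/4 * k\<^sup>2\<close> at least
      \<open>1\<close>, so it may multiply \<open>w\<^sup>2\<close>; it also bounds
      \<open>t\<^sup>2\<close> because \<open>t \<le> 3/2 * k\<close>.\<close>
    have "w\<^sup>2 + t\<^sup>2 \<le> w\<^sup>2 * (9/4 * k\<^sup>2) + 9/4 * k\<^sup>2"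
    proof (rule add_mono)
      have "1 \<le> 9/4 * k\<^sup>2" using power_mono[of "4/3" k 2] True by (simp add: power2_eq_square)
      then show "w\<^sup>2 \<le> w\<^sup>2 * (9/4 * k\<^sup>2)" using mult_left_mono[of 1 "9/4 * k\<^sup>2" "w\<^sup>2"] by simp
      have "t\<^sup>2 \<le> (3/2 * k)\<^sup>2" using t' t by (intro power_mono) auto
      then show "t\<^sup>2 \<le> 9/4 * k\<^sup>2" by (simp add: power_mult_distrib power_divide)
    qed
    then have "(w\<^sup>2 + t\<^sup>2) / \<bar>k\<^sup>2 - t\<^sup>2\<bar> \<le> (9/4 * k\<^sup>2 * (1 + w\<^sup>2)) / (k * \<bar>k - t\<bar>)"
      unfolding fac using k t d by (intro frac_le) (auto simp: algebra_simps mult_right_mono)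
    also have "\<dots> = 9/4 * (1 + w\<^sup>2) * k / \<bar>k - t\<bar>"
      using k by (simp add: power2_eq_square)
    finally have "((w\<^sup>2 + t\<^sup>2) / \<bar>k\<^sup>2 - t\<^sup>2\<bar>) powr q \<le> (9/4 * (1 + w\<^sup>2) * k / \<bar>k - t\<bar>) powr q"
      using q by (intro powr_mono2) auto
    also have "(9/4 * (1 + w\<^sup>2) * k / \<bar>k - t\<bar>) powr q = (9/4 * ((1 + w\<^sup>2) * k / \<bar>k - t\<bar>)) powr q"
      by (simp only: mult.assoc times_divide_eq_right)
    also have "\<dots> = (9/4) powr q * ((1 + w\<^sup>2) * k / \<bar>k - t\<bar>) powr q"
      by (rule powr_mult)
    also have "((1 + w\<^sup>2) * k / \<bar>k - t\<bar>) powr q = (1 + w\<^sup>2) powr q * k powr q * \<bar>k - t\<bar> powr (- q)"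
      using k by (simp add: powr_mult powr_divide powr_minus_divide)
    also have "(9/4) powr q * ((1 + w\<^sup>2) powr q * k powr q * \<bar>k - t\<bar> powr (- q)) \<le> 9/4 * ((1 + w\<^sup>2) powr q * k powr q * \<bar>k - t\<bar> powr (- q))"
      using powr_mono[of q 1 "9/4"] q by (intro mult_right_mono) auto
    also have "\<dots> = (ratio_sing q k w * \<bar>k - t\<bar> powr (- q)) * (k ^ 3 / 8)"
      using True k by (simp add: ratio_sing_def powr_diff powr_numeral)
    also have "\<dots> \<le> (ratio_sing q k w * \<bar>k - t\<bar> powr (- q)) * max 1 (t ^ 3)"
      using t3 by (intro mult_left_mono) (auto simp: ratio_sing_def)
    finally show ?thesis .
  next
    case kle: False
    have t': "t \<le> 10/3" using near kle by (auto simp: ratio_rad_def)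
    have "(w\<^sup>2 + t\<^sup>2) / \<bar>k\<^sup>2 - t\<^sup>2\<bar> = (w\<^sup>2 / (k + t) + t * (t / (k + t))) / \<bar>k - t\<bar>"
      unfolding fac by (simp add: power2_eq_square add_divide_distrib)
    also have "\<dots> \<le> (w\<^sup>2 / k + 10/3 * 1) / \<bar>k - t\<bar>"
      using k t t' d by (intro divide_right_mono add_mono mult_mono divide_left_mono) auto
    finally have "((w\<^sup>2 + t\<^sup>2) / \<bar>k\<^sup>2 - t\<^sup>2\<bar>) powr q \<le> ((w\<^sup>2 / k + 10/3) / \<bar>k - t\<bar>) powr q"
      using q by (intro powr_mono2) auto
    also have "\<dots> = ratio_sing q k w * \<bar>k - t\<bar> powr (- q)"
      using k kle by (simp add: ratio_sing_def powr_divide powr_minus_divide)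
    also have "\<dots> * 1 \<le> \<dots> * max 1 (t ^ 3)"
      by (intro mult_left_mono) (auto simp: ratio_sing_def)
    finally show ?thesis by simp
  qed
qed simp

text \<open>For large \<open>k\<close> the powers of \<open>k\<close> multiply to
  \<open>k powr (- 2)\<close>, which is at most \<open>k powr (- 2 * q)\<close> as
  \<open>k > 1\<close>. For small \<open>k\<close> both \<open>w\<^sup>2 / k\<close> and the
  constant \<open>10/3\<close> are at most multiples of \<open>Q_shape\<close>.\<close>

lemma ratio_sing_bound:
  assumes q: "0 < q" "q < 1" and k: "k > 0"
  shows "ratio_sing q k w * ratio_rad k powr (1 - q) \<le> 18 * Q_shape k w powr q"
proof (cases "k > 4/3")
  case True
  have "ratio_sing q k w * ratio_rad k powr (1 - q) \<le> ratio_sing q k w * k powr (1 - q)"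
    using True q by (intro mult_left_mono powr_mono2) (auto simp: ratio_rad_def ratio_sing_def)
  also have "\<dots> = 18 * ((1 + w\<^sup>2) powr q * k powr (- 2))"
    using True by (simp add: ratio_sing_def flip: powr_add)
  also have "\<dots> \<le> 18 * ((1 + w\<^sup>2) powr q * k powr (- 2 * q))"
    using True q by (intro mult_left_mono powr_mono) auto
  also have "(1 + w\<^sup>2) powr q * k powr (- 2 * q) = ((1 + w\<^sup>2) / k\<^sup>2) powr q"
    using k by (simp add: powr_divide powr_powr powr_minus_divide flip: powr_numeral)
  also have "18 * ((1 + w\<^sup>2) / k\<^sup>2) powr q \<le> 18 * Q_shape k w powr q"
  proof (intro mult_left_mono powr_mono2)
    have "(1 + w\<^sup>2) / k\<^sup>2 \<le> 28 * (1 + w\<^sup>2) / (23 * k\<^sup>2)" using k by (simp add: field_simps)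
    with Q_shape_ge_large[OF True, of w] show "(1 + w\<^sup>2) / k\<^sup>2 \<le> Q_shape k w" by linarith
  qed (use q in auto)
  finally show ?thesis .
next
  case False
  then have kle: "k \<le> 4/3" by simp
  let ?Z = "Q_shape k w"
  have Z1: "?Z \<ge> 2 * ((w\<^sup>2 + 1) / (k + 1))" by (rule Q_shape_ge_small(1)[OF kle])
  have "6/7 * (w\<^sup>2 + 1) \<le> 2 * ((w\<^sup>2 + 1) / (k + 1))"
    using False k mult_left_mono[of k "4/3" "w\<^sup>2 + 1"] by (simp add: field_simps)
  with Z1 have Z2: "6/7 * (w\<^sup>2 + 1) \<le> ?Z" by linarith
  have "w\<^sup>2 / k \<le> 7/3 * ?Z"
  proof (cases "k \<le> 1/2")
    case True
    have "2 * (w\<^sup>2 / k) \<le> ?Z" by (rule Q_shape_ge_small(2)[OF kle True])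
    moreover have "w\<^sup>2 / k \<ge> 0" using k by simp
    ultimately show ?thesis by linarith
  next
    case False
    then have "w\<^sup>2 / k \<le> w\<^sup>2 / (1/2)" by (intro divide_left_mono) auto
    also have "w\<^sup>2 / (1/2) = 2 * w\<^sup>2" by simp
    also have "2 * w\<^sup>2 \<le> 7/3 * ?Z" using Z2 unfolding distrib_left by linarith
    finally show ?thesis .
  qed
  moreover have "6/7 \<le> ?Z" using Z2 zero_le_power2[of w] unfolding distrib_left by linarith
  ultimately have "w\<^sup>2 / k + 10/3 \<le> 7 * ?Z" by linarith
  then have "(w\<^sup>2 / k + 10/3) powr q \<le> (7 * ?Z) powr q"
    using k q by (intro powr_mono2) (auto intro!: add_nonneg_nonneg)
  also have "\<dots> = 7 powr q * ?Z powr q" using Q_shape_pos[OF k, of w] by (simp add: powr_mult)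
  also have "\<dots> \<le> 7 * ?Z powr q"
    using powr_mono[of q 1 7] q by (intro mult_right_mono) auto
  finally have "ratio_sing q k w * ratio_rad k powr (1 - q) \<le> (7 * ?Z powr q) * 2"
    using False q powr_mono[of "1 - q" 1 2] by (intro mult_mono) (auto simp: ratio_sing_def ratio_rad_def)
  also have "\<dots> \<le> 18 * ?Z powr q" by simp
  finally show ?thesis .
qed

section \<open>Sampling\<close>

lemma sampling_assumptionD:
  assumes "sampling_assumption D \<mu> varpi"
  shows sampling_prob: "prob_space D" and sampling_sets: "sets D = sets borel"
    and sampling_finite: "finite F \<Longrightarrow> AE x in D. x \<notin> F"
    and sampling_mu_pos: "\<mu> > 0" and sampling_varpi: "varpi \<ge> 1"
    and sampling_integrable: "integrable D (\<lambda>x. x\<^sup>2)" and sampling_second_moment: "(LINT x|D. x\<^sup>2) = \<mu>\<^sup>2"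
proof -
  have D: "prob_space D" "sets D = sets borel" "absolutely_continuous lborel D" "integrable D (\<lambda>k. k\<^sup>2)"
    "\<mu> = sqrt (LINT k|D. k\<^sup>2)"
    using assms by (auto simp: sampling_assumption_def)
  then show "prob_space D" "sets D = sets borel" "integrable D (\<lambda>x. x\<^sup>2)" by auto
  interpret prob_space D by fact
  show fin: "AE x in D. x \<notin> F" if "finite F" for F
    using D(3) finite_imp_null_set_lborel[OF that] by (intro AE_not_in) (auto simp: absolutely_continuous_def)
  have nonneg: "(LINT k|D. k\<^sup>2) \<ge> 0" by simp
  \<comment> \<open>A vanishing second moment would concentrate the law at \<open>0\<close>, which
    is a Lebesgue null set.\<close>
  have "(LINT k|D. k\<^sup>2) \<noteq> 0"
  proof
    assume "(LINT k|D. k\<^sup>2) = 0"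
    then have "AE k in D. k\<^sup>2 = 0"
      using integral_nonneg_eq_0_iff_AE[OF D(4)] by auto
    moreover have "AE k in D. k \<notin> {0}" by (rule fin) simp
    ultimately have "AE k in D. False" by eventually_elim simp
    then show False by simp
  qed
  with nonneg have "(LINT k|D. k\<^sup>2) > 0" by (auto simp: less_le)
  with D(5) show "\<mu> > 0" "(LINT x|D. x\<^sup>2) = \<mu>\<^sup>2" by simp_all
  obtain \<pi> where sup: "ennreal varpi = max 1 (SUP x\<in>{0<..}. ennreal (max 1 (x ^ 3)) * \<pi> x)"
    using assms unfolding sampling_assumption_def by blast
  have "ennreal varpi \<ge> 1" unfolding sup by (rule max.cobounded1)
  then show "varpi \<ge> 1" by simp
qed

lemma powr_le_1_plus:
  fixes y q :: real
  assumes "0 \<le> y" "0 \<le> q" "q \<le> 1"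
  shows "y powr q \<le> 1 + y"
proof (cases "y \<le> 1")
  case True
  then have "y powr q \<le> 1 powr q" using assms by (intro powr_mono2) auto
  then show ?thesis using assms by simp
next
  case False
  then have "y powr q \<le> y powr 1" using assms by (intro powr_mono) auto
  then show ?thesis using assms by simp
qed

text \<open>The bound on the density handles the pole and the second moment handles the tail. The
  constant \<open>40\<close> is \<open>4\<close> from the tail plus \<open>2 * 18\<close> from the
  pole.\<close>

lemma nn_integral_ratio:
  assumes samp: "sampling_assumption D \<mu> varpi" and C: "C > 0" and q: "0 < q" "q < 1" and x: "x \<noteq> 0"
  shows "(\<integral>\<^sup>+ y. ennreal (((C\<^sup>2 + y\<^sup>2) / \<bar>x\<^sup>2 - y\<^sup>2\<bar>) powr q) \<partial>D)
    \<le> ennreal (40 * varpi / (1 - q) * Q_shape (\<bar>x\<bar> / \<mu>) (C / \<mu>) powr q)"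
proof -
  note \<mu> = sampling_mu_pos[OF samp] and varpi = sampling_varpi[OF samp]
  have [measurable_cong]: "sets D = sets borel" by (rule sampling_sets[OF samp])
  interpret prob_space D by (rule sampling_prob[OF samp])
  obtain \<pi> where \<pi>: "distributed D lborel (\<lambda>k. \<bar>k\<bar> / \<mu>) \<pi>"
    and sup: "ennreal varpi = max 1 (SUP x\<in>{0<..}. ennreal (max 1 (x ^ 3)) * \<pi> x)"
    using samp by (auto simp: sampling_assumption_def)
  have [measurable]: "\<pi> \<in> borel_measurable borel" using \<pi> by (auto simp: distributed_def)
  define k w where "k = \<bar>x\<bar> / \<mu>" and "w = C / \<mu>"
  define Z where "Z = Q_shape k w"
  have k: "k > 0" using x \<mu> by (simp add: k_def)
  have Z: "Z > 0" unfolding Z_def by (rule Q_shape_pos[OF k])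
  define F where "F t = (w\<^sup>2 + t\<^sup>2) / \<bar>k\<^sup>2 - t\<^sup>2\<bar>" for t
  define y where "y t = (w\<^sup>2 + t\<^sup>2) / (w\<^sup>2 + 1)" for t
  define S where "S = ratio_sing q k w"
  have S: "S \<ge> 0" using k by (simp add: S_def ratio_sing_def)
  have [measurable]: "F \<in> borel_measurable borel" "y \<in> borel_measurable borel"
    unfolding F_def[abs_def] y_def[abs_def] by measurable
  have w1: "w\<^sup>2 + 1 > 0" by (auto intro: add_nonneg_pos)
  have y0: "y t \<ge> 0" for t by (simp add: y_def)
  let ?near = "\<lambda>t. ennreal (\<bar>k - t\<bar> powr (- q)) * indicator {t. \<bar>t - k\<bar> \<le> ratio_rad k} t"
  \<comment> \<open>Near the pole \<open>max 1 (t ^ 3) * \<pi> t \<le> varpi\<close> removes the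
    density. On the tail \<open>y t powr q \<le> 1 + y t\<close> replaces the fractional power by a
    quantity of known mean.\<close>
  have pointwise: "\<pi> t * (ennreal (F t powr q) * indicator {0<..} t)
      \<le> ennreal (2 * Z powr q) * (\<pi> t * ennreal (1 + y t)) + ennreal (varpi * S) * ?near t" for t
  proof (cases "t > 0")
    case True
    show ?thesis
    proof (cases "\<bar>t - k\<bar> \<le> ratio_rad k")
      case near: True
      have "F t powr q \<le> S * \<bar>k - t\<bar> powr (- q) * max 1 (t ^ 3)"
        unfolding F_def S_def by (rule ratio_near[OF q k True near])
      then have "\<pi> t * ennreal (F t powr q) \<le> \<pi> t * ennreal (S * \<bar>k - t\<bar> powr (- q) * max 1 (t ^ 3))"
        by (intro mult_left_mono ennreal_leI) auto
      also have "\<dots> = (ennreal (max 1 (t ^ 3)) * \<pi> t) * ennreal (S * \<bar>k - t\<bar> powr (- q))"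
        using S by (simp add: ennreal_mult' mult_ac)
      also have "\<dots> \<le> ennreal varpi * ennreal (S * \<bar>k - t\<bar> powr (- q))"
        unfolding sup using True by (intro mult_right_mono max.coboundedI2 SUP_upper) auto
      also have "\<dots> = ennreal (varpi * S) * ?near t"
        using S varpi near by (simp add: ennreal_mult' mult_ac)
      finally show ?thesis using True by (simp add: add_increasing)
    next
      case far: False
      have "F t \<le> 2 * Z * y t"
        unfolding F_def Z_def y_def by (rule ratio_far[OF k True]) (use far in simp)
      then have "F t powr q \<le> (2 * Z * y t) powr q"
        using q by (intro powr_mono2) (auto simp: F_def)
      also have "\<dots> = 2 powr q * Z powr q * y t powr q" by (simp add: powr_mult)
      also have "\<dots> \<le> 2 * Z powr q * (1 + y t)"
        using powr_mono[of q 1 2] q y0 powr_le_1_plus[OF y0, of q]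
        by (intro mult_mono mult_right_mono) auto
      finally have "\<pi> t * ennreal (F t powr q) \<le> \<pi> t * ennreal (2 * Z powr q * (1 + y t))"
        by (intro mult_left_mono ennreal_leI) auto
      also have "\<dots> = ennreal (2 * Z powr q) * (\<pi> t * ennreal (1 + y t))"
        by (subst ennreal_mult') (simp_all add: mult_ac)
      finally show ?thesis using True by (simp add: add_increasing2)
    qed
  qed simp
  have F_eq: "(C\<^sup>2 + y\<^sup>2) / \<bar>x\<^sup>2 - y\<^sup>2\<bar> = F (\<bar>y\<bar> / \<mu>)" for y
  proof -
    have "F (\<bar>y\<bar> / \<mu>) = ((C\<^sup>2 + y\<^sup>2) / \<mu>\<^sup>2) / (\<bar>x\<^sup>2 - y\<^sup>2\<bar> / \<mu>\<^sup>2)"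
      by (simp add: F_def k_def w_def power_divide add_divide_distrib diff_divide_distrib[symmetric])
    then show ?thesis using \<mu> by simp
  qed
  have "(\<integral>\<^sup>+ y. ennreal (((C\<^sup>2 + y\<^sup>2) / \<bar>x\<^sup>2 - y\<^sup>2\<bar>) powr q) \<partial>D)
     = (\<integral>\<^sup>+ y. ennreal (F (\<bar>y\<bar> / \<mu>) powr q) * indicator {0<..} (\<bar>y\<bar> / \<mu>) \<partial>D)"
    unfolding F_eq
  proof (rule nn_integral_cong_AE)
    have "AE y in D. y \<notin> {0}" by (rule sampling_finite[OF samp]) simp
    then show "AE y in D. ennreal (F (\<bar>y\<bar> / \<mu>) powr q) = ennreal (F (\<bar>y\<bar> / \<mu>) powr q) * indicator {0<..} (\<bar>y\<bar> / \<mu>)"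
      by eventually_elim (use \<mu> in auto)
  qed
  also have "\<dots> = (\<integral>\<^sup>+ t. \<pi> t * (ennreal (F t powr q) * indicator {0<..} t) \<partial>lborel)"
    by (rule distributed_nn_integral[OF \<pi>, symmetric]) measurable
  also have "\<dots> \<le> (\<integral>\<^sup>+ t. ennreal (2 * Z powr q) * (\<pi> t * ennreal (1 + y t)) + ennreal (varpi * S) * ?near t \<partial>lborel)"
    by (intro nn_integral_mono pointwise)
  also have "\<dots> = ennreal (2 * Z powr q) * (\<integral>\<^sup>+ t. \<pi> t * ennreal (1 + y t) \<partial>lborel)
      + ennreal (varpi * S) * (\<integral>\<^sup>+ t. ?near t \<partial>lborel)"
    by (simp add: nn_integral_add nn_integral_cmult)
  also have "(\<integral>\<^sup>+ t. \<pi> t * ennreal (1 + y t) \<partial>lborel) = (\<integral>\<^sup>+ x. ennreal (1 + y (\<bar>x\<bar> / \<mu>)) \<partial>D)"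
    by (rule distributed_nn_integral[OF \<pi>]) measurable
  \<comment> \<open>Scaled by \<open>\<mu>\<close>, the frequency has second moment
    \<open>1\<close>, so \<open>y\<close> has mean
    \<open>(w\<^sup>2 + 1) / (w\<^sup>2 + 1)\<close>.\<close>
  also have "\<dots> = ennreal 2"
  proof -
    have eq: "1 + y (\<bar>x\<bar> / \<mu>) = (1 + w\<^sup>2 / (w\<^sup>2 + 1)) + x\<^sup>2 * (1 / (\<mu>\<^sup>2 * (w\<^sup>2 + 1)))" for x
      by (simp add: y_def power_divide add_divide_distrib)
    have int: "integrable D (\<lambda>x. 1 + y (\<bar>x\<bar> / \<mu>))"
      unfolding eq using sampling_integrable[OF samp] by simp
    have "(\<integral>\<^sup>+ x. ennreal (1 + y (\<bar>x\<bar> / \<mu>)) \<partial>D) = ennreal (LINT x|D. 1 + y (\<bar>x\<bar> / \<mu>))"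
      by (rule nn_integral_eq_integral[OF int]) (simp add: y0)
    also have "(LINT x|D. 1 + y (\<bar>x\<bar> / \<mu>)) = (1 + w\<^sup>2 / (w\<^sup>2 + 1)) + \<mu>\<^sup>2 * (1 / (\<mu>\<^sup>2 * (w\<^sup>2 + 1)))"
      unfolding eq using sampling_integrable[OF samp] sampling_second_moment[OF samp]
      by (simp add: prob_space)
    also have "\<dots> = 1 + (w\<^sup>2 / (w\<^sup>2 + 1) + 1 / (w\<^sup>2 + 1))" using \<mu> by simp
    also have "\<dots> = 2" using w1 by (simp flip: add_divide_distrib)
    finally show ?thesis .
  qed
  also have "ennreal (2 * Z powr q) * ennreal 2 + ennreal (varpi * S) * (\<integral>\<^sup>+ t. ?near t \<partial>lborel)
      \<le> ennreal (2 * Z powr q) * ennreal 2 + ennreal (varpi * S) * ennreal (2 * ratio_rad k powr (1 - q) / (1 - q))"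
    using nn_integral_singularity[OF q, of "ratio_rad k" k] k
    by (intro add_left_mono mult_left_mono) (auto simp: ratio_rad_def)
  also have "\<dots> = ennreal (4 * Z powr q + varpi * 2 / (1 - q) * (S * ratio_rad k powr (1 - q)))"
  proof -
    have *: "0 \<le> a \<Longrightarrow> 0 \<le> b \<Longrightarrow> 0 \<le> d \<Longrightarrow> ennreal a * ennreal 2 + ennreal b * ennreal d = ennreal (a * 2 + b * d)" for a b d :: real
      by (simp add: ennreal_mult)
    have "ennreal (2 * Z powr q) * ennreal 2 + ennreal (varpi * S) * ennreal (2 * ratio_rad k powr (1 - q) / (1 - q))
      = ennreal (2 * Z powr q * 2 + varpi * S * (2 * ratio_rad k powr (1 - q) / (1 - q)))"
      by (rule *) (use q S varpi in auto)
    also have "2 * Z powr q * 2 + varpi * S * (2 * ratio_rad k powr (1 - q) / (1 - q))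
      = 4 * Z powr q + varpi * 2 / (1 - q) * (S * ratio_rad k powr (1 - q))"
      by simp
    finally show ?thesis .
  qed
  also have "\<dots> \<le> ennreal (4 * (varpi / (1 - q)) * Z powr q + varpi * 2 / (1 - q) * (18 * Z powr q))"
  proof (intro ennreal_leI add_mono mult_left_mono)
    have "1 \<le> varpi / (1 - q)" using q varpi by (simp add: le_divide_eq)
    then show "4 * Z powr q \<le> 4 * (varpi / (1 - q)) * Z powr q" by (intro mult_right_mono) auto
    show "S * ratio_rad k powr (1 - q) \<le> 18 * Z powr q"
      unfolding S_def Z_def by (rule ratio_sing_bound[OF q k])
  qed (use q varpi in auto)
  also have "4 * (varpi / (1 - q)) * Z powr q + varpi * 2 / (1 - q) * (18 * Z powr q) = 40 * varpi / (1 - q) * Z powr q"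
    by (simp add: field_simps)
  finally show ?thesis by (simp add: Z_def k_def w_def)
qed

text \<open>One factor of the node product over its share of the threshold. For
  \<open>N \<noteq> 1\<close> and nonzero frequencies the event fails iff, for some
  \<open>i\<close>, the product of these ratios over \<open>j \<noteq> i\<close> is at least
  \<open>1\<close>.\<close>

definition Q_ratio :: "real \<Rightarrow> real \<Rightarrow> real \<Rightarrow> real \<Rightarrow> real \<Rightarrow> real \<Rightarrow> real" where
  "Q_ratio varpi \<mu> C c x y =
     ((C\<^sup>2 + y\<^sup>2) / \<bar>x\<^sup>2 - y\<^sup>2\<bar>) / (exp c * Q_fun varpi c (\<bar>x\<bar> / \<mu>) (C / \<mu>))"

lemma measurable_Q_fun [measurable]:
  assumes [measurable]: "f \<in> borel_measurable M"
  shows "(\<lambda>x. Q_fun varpi c (f x) w) \<in> borel_measurable M"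
  unfolding Q_fun_def Let_def by measurable

lemma measurable_Q_ratio [measurable]:
  assumes [measurable]: "f \<in> borel_measurable M" "g \<in> borel_measurable M"
  shows "(\<lambda>x. Q_ratio varpi \<mu> C c (f x) (g x)) \<in> borel_measurable M"
  unfolding Q_ratio_def by measurable

lemma Q_fun_pos: "varpi > 0 \<Longrightarrow> k > 0 \<Longrightarrow> Q_fun varpi c k w > 0"
  unfolding Q_fun_eq by (intro mult_pos_pos Q_shape_pos) auto

text \<open>The power \<open>q = 1 - 1 / c\<close> turns \<open>exp c\<close> into
  \<open>exp (c - 1)\<close> and \<open>varpi powr (c / (c - 1))\<close> into \<open>varpi\<close>.
  The latter and \<open>Q_shape powr q\<close> cancel against the moment bound, and
  \<open>1 / (1 - q)\<close> is \<open>c\<close>.\<close>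

lemma nn_integral_Q_ratio:
  assumes samp: "sampling_assumption D \<mu> varpi" and C: "C > 0" and c: "c > 2" and x: "x \<noteq> 0"
  shows "(\<integral>\<^sup>+ y. ennreal (Q_ratio varpi \<mu> C c x y powr (1 - 1 / c)) \<partial>D) \<le> ennreal (40 * c * exp (1 - c))"
proof -
  define q where "q = 1 - 1 / c"
  have q: "0 < q" "q < 1" "1 - q = 1 / c" "c * q = c - 1" "c / (c - 1) * q = 1"
    using c by (auto simp: q_def field_simps)
  note \<mu> = sampling_mu_pos[OF samp] and varpi = sampling_varpi[OF samp]
  have [measurable_cong]: "sets D = sets borel" by (rule sampling_sets[OF samp])
  define Z where "Z = Q_shape (\<bar>x\<bar> / \<mu>) (C / \<mu>)"
  have Z: "Z > 0" unfolding Z_def using x \<mu> by (intro Q_shape_pos) simp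
  let ?d = "exp (c - 1) * (varpi * Z powr q)"
  have d: "?d > 0" using varpi Z by simp
  have "(exp c * Q_fun varpi c (\<bar>x\<bar> / \<mu>) (C / \<mu>)) powr q = ?d"
    unfolding Q_fun_eq Z_def[symmetric] using varpi q(4,5) by (simp add: powr_mult powr_powr exp_powr_real)
  moreover have *: "(a / b) powr q = 1 / (b powr q) * a powr q" for a b :: real
    by (simp add: powr_divide)
  ultimately have "Q_ratio varpi \<mu> C c x y powr q = 1 / ?d * ((C\<^sup>2 + y\<^sup>2) / \<bar>x\<^sup>2 - y\<^sup>2\<bar>) powr q" for y
    by (simp only: Q_ratio_def *[of "(C\<^sup>2 + y\<^sup>2) / \<bar>x\<^sup>2 - y\<^sup>2\<bar>"])
  then have "(\<integral>\<^sup>+ y. ennreal (Q_ratio varpi \<mu> C c x y powr q) \<partial>D)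
     = ennreal (1 / ?d) * (\<integral>\<^sup>+ y. ennreal (((C\<^sup>2 + y\<^sup>2) / \<bar>x\<^sup>2 - y\<^sup>2\<bar>) powr q) \<partial>D)"
    using d by (simp only: ennreal_mult' less_imp_le zero_le_divide_1_iff) (rule nn_integral_cmult, measurable)
  also have "\<dots> \<le> ennreal (1 / ?d) * ennreal (40 * varpi / (1 - q) * Z powr q)"
    unfolding Z_def by (intro mult_left_mono nn_integral_ratio[OF samp C q(1,2) x]) simp
  also have "\<dots> = ennreal (1 / ?d * (40 * varpi / (1 - q) * Z powr q))"
    using d by (intro ennreal_mult'[symmetric]) simp
  also have "1 / ?d * (40 * varpi / (1 - q) * Z powr q) = 40 * c * exp (1 - c)"
    unfolding q(3) using varpi Z by (simp add: exp_diff)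
  finally show ?thesis by (simp add: q_def)
qed

text \<open>Fubini's theorem with coordinate \<open>i\<close> outermost. The bound is asked for
  almost everywhere in that coordinate only, so that the frequency \<open>0\<close> can be
  excluded.\<close>

lemma nn_integral_PiM_row_prod:
  fixes g :: "real \<Rightarrow> real \<Rightarrow> ennreal"
  assumes D: "prob_space D" "sets D = sets borel" and i: "i < N"
    and [measurable]: "case_prod g \<in> borel_measurable (borel \<Otimes>\<^sub>M borel)"
    and b: "AE x in D. (\<integral>\<^sup>+ y. g x y \<partial>D) \<le> b"
  shows "(\<integral>\<^sup>+ k. (\<Prod>j\<in>{..<N} - {i}. g (k i) (k j)) \<partial>PiM {..<N} (\<lambda>_. D)) \<le> b ^ (N - 1)"
proof -
  interpret prob_space D by fact
  interpret product_prob_space "\<lambda>_. D" "{..<N}" by unfold_locales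
  have [measurable_cong]: "sets D = sets borel" by fact
  let ?I = "{..<N} - {i}"
  have ins: "insert i ?I = {..<N}" using i by auto
  have "(\<integral>\<^sup>+ k. (\<Prod>j\<in>?I. g (k i) (k j)) \<partial>PiM (insert i ?I) (\<lambda>_. D))
     = (\<integral>\<^sup>+ x. (\<integral>\<^sup>+ k. (\<Prod>j\<in>?I. g ((k(i := x)) i) ((k(i := x)) j)) \<partial>PiM ?I (\<lambda>_. D)) \<partial>D)"
    by (rule product_nn_integral_insert_rev) (auto, measurable)
  also have "\<dots> = (\<integral>\<^sup>+ x. (\<integral>\<^sup>+ k. (\<Prod>j\<in>?I. g x (k j)) \<partial>PiM ?I (\<lambda>_. D)) \<partial>D)"
    by (intro nn_integral_cong prod.cong) auto
  also have "\<dots> = (\<integral>\<^sup>+ x. (\<Prod>j\<in>?I. (\<integral>\<^sup>+ y. g x y \<partial>D)) \<partial>D)"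
    by (intro nn_integral_cong, subst product_nn_integral_prod) auto
  also have "\<dots> \<le> (\<integral>\<^sup>+ x. b ^ (N - 1) \<partial>D)"
    by (rule nn_integral_mono_AE, use b in eventually_elim) (use i in \<open>auto intro!: power_mono\<close>)
  finally show ?thesis
    unfolding ins by (simp add: prob_space.emeasure_space_1[OF D(1)])
qed

text \<open>For fixed remaining coordinates a tie confines \<open>k i\<close> to the two points
  \<open>k j\<close> and \<open>- k j\<close>, a null set of an absolutely continuous law.\<close>

lemma AE_PiM_distinct_squares:
  fixes N :: nat
  assumes samp: "sampling_assumption D \<mu> varpi"
  shows "AE k in PiM {..<N} (\<lambda>_. D). inj_on (\<lambda>j. (k j)\<^sup>2) {..<N} \<and> (\<forall>i<N. k i \<noteq> 0)"
proof -
  interpret prob_space D by (rule sampling_prob[OF samp])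
  interpret product_prob_space "\<lambda>_. D" "{..<N}" by unfold_locales
  have [measurable_cong]: "sets D = sets borel" by (rule sampling_sets[OF samp])
  let ?M = "PiM {..<N} (\<lambda>_. D)"
  have zero: "AE k in ?M. k i \<noteq> 0" if i: "i < N" for i
    by (rule AE_PiM_component) (use i sampling_finite[OF samp, of "{0}"] in \<open>auto intro: sampling_prob[OF samp]\<close>)
  have tie: "AE k in ?M. (k i)\<^sup>2 \<noteq> (k j)\<^sup>2" if ij: "i < N" "j < N" "i \<noteq> j" for i j
  proof -
    let ?I = "{..<N} - {i}"
    have ins: "insert i ?I = {..<N}" using ij by auto
    let ?f = "\<lambda>k. indicator {0::real} ((k i)\<^sup>2 - (k j)\<^sup>2) :: ennreal"
    have M: "sets ?M = sets (PiM {..<N} (\<lambda>_. borel))"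
      by (intro sets_PiM_cong refl sampling_sets[OF samp])
    have "(\<lambda>k. (k i)\<^sup>2 - (k j)\<^sup>2 :: real) \<in> borel_measurable (PiM {..<N} (\<lambda>_. borel))"
      by (intro borel_measurable_diff borel_measurable_power measurable_component_singleton) (use ij in auto)
    then have "?f \<in> borel_measurable (PiM {..<N} (\<lambda>_. borel))"
      by (rule measurable_compose) simp
    then have meas: "?f \<in> borel_measurable ?M"
      unfolding measurable_cong_sets[OF M refl] .
    have "integral\<^sup>N (PiM (insert i ?I) (\<lambda>_. D)) ?f = (\<integral>\<^sup>+ k. (\<integral>\<^sup>+ x. ?f (k(i := x)) \<partial>D) \<partial>PiM ?I (\<lambda>_. D))"
      by (rule product_nn_integral_insert) (use meas ins in auto)
    then have "(\<integral>\<^sup>+ k. ?f k \<partial>?M) = (\<integral>\<^sup>+ k. (\<integral>\<^sup>+ x. ?f (k(i := x)) \<partial>D) \<partial>PiM ?I (\<lambda>_. D))"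
      unfolding ins .
    also have "\<dots> = (\<integral>\<^sup>+ k. 0 \<partial>PiM ?I (\<lambda>_. D))"
    proof (intro nn_integral_cong)
      fix k :: "nat \<Rightarrow> real"
      show "(\<integral>\<^sup>+ x. ?f (k(i := x)) \<partial>D) = 0"
      proof (rule nn_integral_zero')
        have "AE x in D. x \<notin> {k j, - k j}" by (rule sampling_finite[OF samp]) simp
        then show "AE x in D. ?f (k(i := x)) = 0"
          by eventually_elim (use ij in \<open>auto simp: power2_eq_iff\<close>)
      qed
    qed
    finally have "(\<integral>\<^sup>+ k. ?f k \<partial>?M) = 0" by simp
    then show ?thesis
      by (subst (asm) nn_integral_0_iff_AE[OF meas]) (auto elim!: eventually_mono)
  qed
  have "AE k in ?M. \<forall>i\<in>{..<N}. k i \<noteq> 0"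
    using zero by (intro AE_finite_allI) auto
  moreover have "AE k in ?M. \<forall>i\<in>{..<N}. \<forall>j\<in>{..<N}. i \<noteq> j \<longrightarrow> (k i)\<^sup>2 \<noteq> (k j)\<^sup>2"
    using tie by (intro AE_finite_allI) auto
  ultimately show ?thesis
    by eventually_elim (auto simp: inj_on_def)
qed

text \<open>What one frequency contributes on the event to the derivative of order
  \<open>2 * N\<close> of the feature sum: the threshold that bounds its coefficients, times the
  powers of the frequency.\<close>

abbreviation feature_weight :: "real \<Rightarrow> real \<Rightarrow> real \<Rightarrow> real \<Rightarrow> nat \<Rightarrow> real \<Rightarrow> real" where
  "feature_weight varpi c \<mu> C N x \<equiv>
     \<bar>(exp c * Q_fun varpi c (\<bar>x\<bar> / \<mu>) (C / \<mu>)) ^ (N - 1)\<bar> * (x ^ (2 * N) + C * \<bar>x\<bar> ^ (2 * N - 1))"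

text \<open>The factors regroup as a power of \<open>x\<^sup>2 * Q\<close> times
  \<open>x\<^sup>2 + C * |x|\<close>, and the first is bounded by the decay of \<open>Q\<close>.
  \<open>c > 2\<close> gives the exponent \<open>2\<close> of \<open>varpi\<close>,
  \<open>22\<close> is \<open>2 * 11\<close>, and
  \<open>2 * C * |x| \<le> x\<^sup>2 + C\<^sup>2\<close> handles the mixed term.\<close>

lemma coeff_moment_le:
  assumes varpi: "varpi \<ge> 1" and \<mu>: "\<mu> > 0" and C: "C > 0" and c: "c > 2"
    and N: "N \<ge> 1" and x: "x \<noteq> 0"
  shows "feature_weight varpi c \<mu> C N x
     \<le> (22 * exp c * varpi\<^sup>2 * (max C \<mu>)\<^sup>2) ^ (N - 1) * ((3 * x\<^sup>2 + C\<^sup>2) / 2)"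
proof -
  define L where "L = max C \<mu>"
  define k where "k = \<bar>x\<bar> / \<mu>"
  define Q where "Q = Q_fun varpi c k (C / \<mu>)"
  have k: "k > 0" and xk: "\<bar>x\<bar> = \<mu> * k" using x \<mu> by (auto simp: k_def)
  have Q: "Q > 0" unfolding Q_def using varpi k by (intro Q_fun_pos) auto
  have v: "varpi powr (c / (c - 1)) \<le> varpi\<^sup>2"
  proof -
    have "varpi powr (c / (c - 1)) \<le> varpi powr 2"
      using varpi c by (intro powr_mono) (auto simp: divide_le_eq)
    then show ?thesis using varpi by (simp add: powr_numeral)
  qed
  have "k\<^sup>2 * Q = varpi powr (c / (c - 1)) * (k\<^sup>2 * Q_shape k (C / \<mu>))"
    by (simp add: Q_def Q_fun_eq)
  also have "\<dots> \<le> varpi\<^sup>2 * (11 * (1 + (C / \<mu>)\<^sup>2))"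
    by (rule mult_mono[OF v Q_shape_upper[OF k]]) (use Q_shape_pos[OF k, of "C / \<mu>"] in simp_all)
  finally have "\<mu>\<^sup>2 * (k\<^sup>2 * Q) \<le> \<mu>\<^sup>2 * (varpi\<^sup>2 * (11 * (1 + (C / \<mu>)\<^sup>2)))"
    by (rule mult_left_mono) simp
  also have "\<dots> = varpi\<^sup>2 * 11 * (\<mu>\<^sup>2 + C\<^sup>2)"
    using \<mu> by (simp add: power_divide distrib_left)
  also have "\<dots> \<le> varpi\<^sup>2 * 11 * (L\<^sup>2 + L\<^sup>2)"
    using \<mu> C by (intro mult_left_mono add_mono power_mono) (auto simp: L_def)
  also have "\<mu>\<^sup>2 * (k\<^sup>2 * Q) = x\<^sup>2 * Q"
    using power2_abs[of x] unfolding xk by (simp add: power_mult_distrib)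
  finally have xQ: "x\<^sup>2 * Q \<le> 22 * varpi\<^sup>2 * L\<^sup>2" by simp
  obtain n where n: "N = Suc n" using N by (cases N) auto
  have p1: "x ^ (2 * N) = (x\<^sup>2) ^ n * x\<^sup>2"
    unfolding n power_mult by (rule power_Suc2)
  have "2 * N - 1 = 2 * n + 1" using n by simp
  then have p2: "\<bar>x\<bar> ^ (2 * N - 1) = (x\<^sup>2) ^ n * \<bar>x\<bar>"
    by (simp only: power_add power_one_right power_mult power2_abs)
  have "\<bar>(exp c * Q) ^ (N - 1)\<bar> = (exp c * Q) ^ n" using Q n by simp
  then have "\<bar>(exp c * Q) ^ (N - 1)\<bar> * (x ^ (2 * N) + C * \<bar>x\<bar> ^ (2 * N - 1))
     = (exp c * Q) ^ n * ((x\<^sup>2) ^ n * x\<^sup>2 + C * ((x\<^sup>2) ^ n * \<bar>x\<bar>))"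
    by (simp only: p1 p2)
  also have "\<dots> = (exp c * (x\<^sup>2 * Q)) ^ n * (x\<^sup>2 + C * \<bar>x\<bar>)"
    by (simp only: power_mult_distrib ring_distribs mult_ac)
  also have "\<dots> = (exp c * (x\<^sup>2 * Q)) ^ (N - 1) * (x\<^sup>2 + C * \<bar>x\<bar>)"
    by (simp add: n)
  also have "\<dots> \<le> (exp c * (22 * varpi\<^sup>2 * L\<^sup>2)) ^ (N - 1) * ((3 * x\<^sup>2 + C\<^sup>2) / 2)"
  proof (rule mult_mono)
    show "(exp c * (x\<^sup>2 * Q)) ^ (N - 1) \<le> (exp c * (22 * varpi\<^sup>2 * L\<^sup>2)) ^ (N - 1)"
      using Q by (intro power_mono mult_left_mono[OF xQ]) auto
    have "0 \<le> (\<bar>x\<bar> - C)\<^sup>2" by simp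
    then show "x\<^sup>2 + C * \<bar>x\<bar> \<le> (3 * x\<^sup>2 + C\<^sup>2) / 2"
      by (simp add: power2_diff mult.commute)
  qed (use C Q in auto)
  also have "exp c * (22 * varpi\<^sup>2 * L\<^sup>2) = 22 * exp c * varpi\<^sup>2 * L\<^sup>2"
    by simp
  finally show ?thesis by (simp only: Q_def k_def L_def)
qed

lemma nn_integral_coeff_moment:
  assumes samp: "sampling_assumption D \<mu> varpi" and C: "C > 0" and c: "c > 2" and N: "N \<ge> 1"
  shows "(\<integral>\<^sup>+ x. ennreal (feature_weight varpi c \<mu> C N x) \<partial>D)
     \<le> ennreal (2 * (22 * exp c * varpi\<^sup>2 * (max C \<mu>)\<^sup>2) ^ (N - 1) * (max C \<mu>)\<^sup>2)"
proof -
  note \<mu> = sampling_mu_pos[OF samp] and varpi = sampling_varpi[OF samp]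
  interpret prob_space D by (rule sampling_prob[OF samp])
  let ?b = "(22 * exp c * varpi\<^sup>2 * (max C \<mu>)\<^sup>2) ^ (N - 1)"
  have b: "?b \<ge> 0" using C \<mu> by simp
  have "AE x in D. x \<notin> {0}" by (rule sampling_finite[OF samp]) simp
  then have "(\<integral>\<^sup>+ x. ennreal (feature_weight varpi c \<mu> C N x) \<partial>D)
     \<le> (\<integral>\<^sup>+ x. ennreal (?b * ((3 * x\<^sup>2 + C\<^sup>2) / 2)) \<partial>D)"
    by (intro nn_integral_mono_AE, eventually_elim)
       (intro ennreal_leI coeff_moment_le[OF varpi \<mu> C c N], auto)
  also have "\<dots> = ennreal (LINT x|D. ?b * ((3 * x\<^sup>2 + C\<^sup>2) / 2))"
    using b sampling_integrable[OF samp] by (intro nn_integral_eq_integral) auto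
  also have "(LINT x|D. ?b * ((3 * x\<^sup>2 + C\<^sup>2) / 2)) = ?b * ((3 * \<mu>\<^sup>2 + C\<^sup>2) / 2)"
    using sampling_integrable[OF samp] sampling_second_moment[OF samp] by (simp add: prob_space)
  also have "\<dots> \<le> ?b * (2 * (max C \<mu>)\<^sup>2)"
  proof (intro mult_left_mono b)
    have "\<mu>\<^sup>2 \<le> (max C \<mu>)\<^sup>2" "C\<^sup>2 \<le> (max C \<mu>)\<^sup>2" using C \<mu> by (auto intro!: power_mono)
    then show "(3 * \<mu>\<^sup>2 + C\<^sup>2) / 2 \<le> 2 * (max C \<mu>)\<^sup>2" by simp
  qed
  finally show ?thesis by (simp add: ennreal_leI mult_ac)
qed

text \<open>Markov's inequality before integration: a product of ratios that is at least
  \<open>1\<close> stays so under the power \<open>q\<close>. The sum over \<open>i\<close> is the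
  union bound.\<close>

lemma not_good_event_le:
  assumes varpi: "varpi > 0" and \<mu>: "\<mu> > 0" and q: "q > 0" and nz: "\<forall>i<N. k i \<noteq> 0"
  shows "indicator {k. \<not> good_event varpi N k \<mu> C c} k
    \<le> (\<Sum>i<N. \<Prod>j\<in>{..<N} - {i}. ennreal (Q_ratio varpi \<mu> C c (k i) (k j) powr q))"
proof (cases "good_event varpi N k \<mu> C c")
  case False
  then obtain i where i: "i < N" and
    ge: "node_prod C k N i
          \<ge> (exp c * Q_fun varpi c (\<bar>k i\<bar> / \<mu>) (C / \<mu>)) ^ (N - 1)"
    by (auto simp: good_event_def not_less)
  let ?E = "exp c * Q_fun varpi c (\<bar>k i\<bar> / \<mu>) (C / \<mu>)"
  have E: "?E > 0" using varpi \<mu> nz i by (intro mult_pos_pos Q_fun_pos) auto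
  have Q0: "Q_ratio varpi \<mu> C c (k i) (k j) \<ge> 0" for j
    using E by (auto simp: Q_ratio_def intro!: divide_nonneg_nonneg)
  have "(\<Prod>j\<in>{..<N} - {i}. Q_ratio varpi \<mu> C c (k i) (k j))
     = node_prod C k N i / ?E ^ (N - 1)"
    using i unfolding Q_ratio_def prod_dividef by simp
  also have "\<dots> \<ge> 1" using ge E by (simp add: le_divide_eq)
  finally have "1 \<le> (\<Prod>j\<in>{..<N} - {i}. Q_ratio varpi \<mu> C c (k i) (k j))" .
  then have "1 \<le> (\<Prod>j\<in>{..<N} - {i}. Q_ratio varpi \<mu> C c (k i) (k j)) powr q"
    using q by (intro ge_one_powr_ge_zero) auto
  also have "\<dots> = (\<Prod>j\<in>{..<N} - {i}. Q_ratio varpi \<mu> C c (k i) (k j) powr q)"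
    using Q0 by (simp add: prod_powr_distrib)
  finally have "1 \<le> (\<Prod>j\<in>{..<N} - {i}. ennreal (Q_ratio varpi \<mu> C c (k i) (k j) powr q))"
    by (simp add: prod_ennreal)
  also have "\<dots> \<le> (\<Sum>i<N. \<Prod>j\<in>{..<N} - {i}. ennreal (Q_ratio varpi \<mu> C c (k i) (k j) powr q))"
    using i by (intro member_le_sum) auto
  finally show ?thesis using False by simp
qed simp

lemma measurable_good_event:
  assumes k: "\<And>i. i < N \<Longrightarrow> k i \<in> borel_measurable P"
  shows "Measurable.pred P (\<lambda>\<omega>. good_event varpi N (\<lambda>i. k i \<omega>) \<mu> C c)"
proof -
  have row: "Measurable.pred P (\<lambda>\<omega>. node_prod C (\<lambda>i. k i \<omega>) N i
              < (exp c * Q_fun varpi c (\<bar>k i \<omega>\<bar> / \<mu>) (C / \<mu>)) ^ (N - 1))" if "i < N" for i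
  proof (rule borel_measurable_pred_less)
    have i: "k i \<in> borel_measurable P" by (rule k[OF that])
    show "(\<lambda>\<omega>. node_prod C (\<lambda>i. k i \<omega>) N i) \<in> borel_measurable P"
      by (intro borel_measurable_prod borel_measurable_divide borel_measurable_add borel_measurable_abs
          borel_measurable_diff borel_measurable_power borel_measurable_const k) (use that in auto)
    show "(\<lambda>\<omega>. (exp c * Q_fun varpi c (\<bar>k i \<omega>\<bar> / \<mu>) (C / \<mu>)) ^ (N - 1)) \<in> borel_measurable P"
      by (intro borel_measurable_power borel_measurable_times borel_measurable_const measurable_Q_fun
          borel_measurable_divide borel_measurable_abs i)
  qed
  show ?thesis
  proof (cases "N = 1")
    case True
    then have "good_event varpi N (\<lambda>i. k i \<omega>) \<mu> C c" for \<omega> by (simp add: good_event_def)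
    then show ?thesis by simp
  next
    case False
    then have eq: "good_event varpi N (\<lambda>i. k i \<omega>) \<mu> C c \<longleftrightarrow> (\<forall>i\<in>{..<N}.
        node_prod C (\<lambda>i. k i \<omega>) N i
              < (exp c * Q_fun varpi c (\<bar>k i \<omega>\<bar> / \<mu>) (C / \<mu>)) ^ (N - 1))" for \<omega>
      by (simp only: good_event_def Ball_def lessThan_iff simp_thms)
    show ?thesis
      unfolding eq by (rule pred_intros_finite(3)) (simp, rule row, simp)
  qed
qed

section \<open>Expectations over an independent sample\<close>

context
  fixes P :: "'w measure" and k :: "nat \<Rightarrow> 'w \<Rightarrow> real" and D :: "real measure" and N :: nat and \<mu> varpi :: real
  assumes P: "prob_space P" and indep: "prob_space.indep_vars P (\<lambda>_. borel) k {..<N}"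
    and dist: "\<And>i. i < N \<Longrightarrow> distr P borel (k i) = D"
    and samp: "sampling_assumption D \<mu> varpi" and N: "N \<ge> 1"
begin

lemma sample_measurable: "i < N \<Longrightarrow> k i \<in> borel_measurable P"
  using indep unfolding prob_space.indep_vars_def[OF P] by auto

text \<open>Independence and the common law identify the law of the whole sample as a product
  measure, so that Fubini's theorem becomes available.\<close>

lemma sample_distr: "distr P (PiM {..<N} (\<lambda>_. borel)) (\<lambda>\<omega>. \<lambda>i\<in>{..<N}. k i \<omega>) = PiM {..<N} (\<lambda>_. D)"
proof -
  have "distr P (PiM {..<N} (\<lambda>_. borel)) (\<lambda>\<omega>. \<lambda>i\<in>{..<N}. k i \<omega>) = PiM {..<N} (\<lambda>i. distr P borel (k i))"
    using prob_space.indep_vars_iff_distr_eq_PiM'[OF P, of "{..<N}" k "\<lambda>_. borel"] indep sample_measurable N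
    by (simp add: lessThan_empty_iff)
  also have "\<dots> = PiM {..<N} (\<lambda>_. D)"
    by (intro PiM_cong) (auto simp: dist)
  finally show ?thesis .
qed

lemma sample_tuple_measurable: "(\<lambda>\<omega>. \<lambda>i\<in>{..<N}. k i \<omega>) \<in> P \<rightarrow>\<^sub>M PiM {..<N} (\<lambda>_. borel)"
  using sample_measurable by (intro measurable_restrict) auto

lemma AE_sample_distinct: "AE \<omega> in P. inj_on (\<lambda>j. (k j \<omega>)\<^sup>2) {..<N} \<and> (\<forall>i<N. k i \<omega> \<noteq> 0)"
proof -
  have "AE x in distr P (PiM {..<N} (\<lambda>_. borel)) (\<lambda>\<omega>. \<lambda>i\<in>{..<N}. k i \<omega>).
      inj_on (\<lambda>j. (x j)\<^sup>2) {..<N} \<and> (\<forall>i<N. x i \<noteq> 0)"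
    unfolding sample_distr by (rule AE_PiM_distinct_squares[OF samp])
  from AE_distrD[OF sample_tuple_measurable this] show ?thesis
    by eventually_elim (auto simp: inj_on_def)
qed

lemma nn_integral_not_good:
  assumes C: "C > 0" and c: "c > 2"
  shows "(\<integral>\<^sup>+ \<omega>. indicator {\<omega>. \<not> good_event varpi N (\<lambda>i. k i \<omega>) \<mu> C c} \<omega> \<partial>P)
    \<le> ennreal (real N * (40 * c * exp (1 - c)) ^ (N - 1))"
proof -
  note \<mu> = sampling_mu_pos[OF samp] and varpi = sampling_varpi[OF samp]
  define q where "q = 1 - 1 / c"
  have q: "q > 0" using c by (simp add: q_def)
  define g where "g x y = ennreal (Q_ratio varpi \<mu> C c x y powr q)" for x y
  have g[measurable]: "case_prod g \<in> borel_measurable (borel \<Otimes>\<^sub>M borel)"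
    unfolding g_def case_prod_beta' by measurable
  have PiM_sets: "sets (PiM {..<N} (\<lambda>_. D)) = sets (PiM {..<N} (\<lambda>_. borel))"
    by (intro sets_PiM_cong refl sampling_sets[OF samp])
  have b: "AE x in D. (\<integral>\<^sup>+ y. g x y \<partial>D) \<le> ennreal (40 * c * exp (1 - c))"
  proof -
    have "AE x in D. x \<notin> {0}" by (rule sampling_finite[OF samp]) simp
    then show ?thesis
      unfolding g_def q_def by eventually_elim (auto intro!: nn_integral_Q_ratio[OF samp C c])
  qed
  have row: "(\<integral>\<^sup>+ \<omega>. (\<Prod>j\<in>{..<N} - {i}. g (k i \<omega>) (k j \<omega>)) \<partial>P) \<le> ennreal ((40 * c * exp (1 - c)) ^ (N - 1))"
    if i: "i < N" for i
  proof -
    have meas: "(\<lambda>x. \<Prod>j\<in>{..<N} - {i}. g (x i) (x j)) \<in> borel_measurable (PiM {..<N} (\<lambda>_. borel))"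
    proof (rule borel_measurable_prod_ennreal)
      fix j assume "j \<in> {..<N} - {i}"
      then have "(\<lambda>x. (x i, x j)) \<in> PiM {..<N} (\<lambda>_. borel) \<rightarrow>\<^sub>M borel \<Otimes>\<^sub>M borel"
        using i by (intro measurable_Pair measurable_component_singleton) auto
      from measurable_compose[OF this g] show "(\<lambda>x. g (x i) (x j)) \<in> borel_measurable (PiM {..<N} (\<lambda>_. borel))"
        by simp
    qed
    have "(\<integral>\<^sup>+ \<omega>. (\<Prod>j\<in>{..<N} - {i}. g (k i \<omega>) (k j \<omega>)) \<partial>P)
       = (\<integral>\<^sup>+ \<omega>. (\<Prod>j\<in>{..<N} - {i}. g ((\<lambda>i\<in>{..<N}. k i \<omega>) i) ((\<lambda>i\<in>{..<N}. k i \<omega>) j)) \<partial>P)"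
      using i by (intro nn_integral_cong prod.cong) auto
    also have "\<dots> = (\<integral>\<^sup>+ x. (\<Prod>j\<in>{..<N} - {i}. g (x i) (x j)) \<partial>PiM {..<N} (\<lambda>_. D))"
      unfolding sample_distr[symmetric] by (subst nn_integral_distr) (use meas sample_tuple_measurable in simp_all)
    also have "\<dots> \<le> ennreal (40 * c * exp (1 - c)) ^ (N - 1)"
      by (rule nn_integral_PiM_row_prod[OF sampling_prob[OF samp] sampling_sets[OF samp] i g b])
    finally show ?thesis using c by (simp add: ennreal_power)
  qed
  have k_meas: "(\<lambda>\<omega>. \<Prod>j\<in>{..<N} - {i}. g (k i \<omega>) (k j \<omega>)) \<in> borel_measurable P" if i: "i < N" for i
  proof (rule borel_measurable_prod_ennreal)
    fix j assume "j \<in> {..<N} - {i}"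
    then have "(\<lambda>\<omega>. (k i \<omega>, k j \<omega>)) \<in> P \<rightarrow>\<^sub>M borel \<Otimes>\<^sub>M borel"
      using i by (intro measurable_Pair sample_measurable) auto
    from measurable_compose[OF this g] show "(\<lambda>\<omega>. g (k i \<omega>) (k j \<omega>)) \<in> borel_measurable P" by simp
  qed
  have "(\<integral>\<^sup>+ \<omega>. indicator {\<omega>. \<not> good_event varpi N (\<lambda>i. k i \<omega>) \<mu> C c} \<omega> \<partial>P)
     \<le> (\<integral>\<^sup>+ \<omega>. (\<Sum>i<N. \<Prod>j\<in>{..<N} - {i}. g (k i \<omega>) (k j \<omega>)) \<partial>P)"
  proof (rule nn_integral_mono_AE, use AE_sample_distinct in eventually_elim)
    case (elim \<omega>)
    then show ?case
      using not_good_event_le[of varpi \<mu> q N "\<lambda>i. k i \<omega>" C c] varpi \<mu> q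
      by (simp add: g_def indicator_def)
  qed
  also have "\<dots> = (\<Sum>i<N. \<integral>\<^sup>+ \<omega>. (\<Prod>j\<in>{..<N} - {i}. g (k i \<omega>) (k j \<omega>)) \<partial>P)"
    using k_meas by (intro nn_integral_sum) auto
  also have "\<dots> \<le> (\<Sum>i<N. ennreal ((40 * c * exp (1 - c)) ^ (N - 1)))"
    using row by (intro sum_mono) auto
  also have "\<dots> = ennreal (real N * (40 * c * exp (1 - c)) ^ (N - 1))"
    using c by (subst sum_ennreal) auto
  finally show ?thesis .
qed

lemma nn_integral_error:
  assumes C: "C > 0" and c: "c > 2" and r: "r > 0"
  defines "L \<equiv> max C \<mu>"
  shows "(\<integral>\<^sup>+ \<omega>. ennreal ((C * r) ^ (2 * N) + r ^ (2 * N) *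
        (\<Sum>i<N. feature_weight varpi c \<mu> C N (k i \<omega>))
        + (if good_event varpi N (\<lambda>i. k i \<omega>) \<mu> C c then 0 else 1)) \<partial>P)
    \<le> ennreal ((C * r) ^ (2 * N) + r ^ (2 * N) * (real N * (2 * (22 * exp c * varpi\<^sup>2 * L\<^sup>2) ^ (N - 1) * L\<^sup>2))
        + (if N = 1 then 0 else real N * (40 * c * exp (1 - c)) ^ (N - 1)))"
proof -
  note \<mu> = sampling_mu_pos[OF samp] and varpi = sampling_varpi[OF samp]
  define h where "h x = feature_weight varpi c \<mu> C N x" for x
  define bad where "bad \<omega> = (indicator {\<omega>. \<not> good_event varpi N (\<lambda>i. k i \<omega>) \<mu> C c} \<omega> :: ennreal)" for \<omega>
  have h0: "h x \<ge> 0" for x using C by (simp add: h_def power_mult)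
  have h_meas[measurable]: "h \<in> borel_measurable borel" unfolding h_def[abs_def] by measurable
  have bad_meas[measurable]: "bad \<in> borel_measurable P"
    unfolding bad_def[abs_def]
    using measurable_good_event[of N k P varpi \<mu> C c] sample_measurable
    by (intro borel_measurable_indicator') auto
  have h_k[measurable]: "(\<lambda>\<omega>. ennreal (h (k i \<omega>))) \<in> borel_measurable P" if "i < N" for i
    using measurable_compose[OF sample_measurable[OF that] h_meas] by simp
  have sum_meas[measurable]: "(\<lambda>\<omega>. \<Sum>i<N. ennreal (h (k i \<omega>))) \<in> borel_measurable P"
    by (rule borel_measurable_sum) (use h_k in simp)
  have h_int: "(\<integral>\<^sup>+ \<omega>. ennreal (h (k i \<omega>)) \<partial>P) \<le> ennreal (2 * (22 * exp c * varpi\<^sup>2 * L\<^sup>2) ^ (N - 1) * L\<^sup>2)" if i: "i < N" for i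
  proof -
    have "(\<integral>\<^sup>+ \<omega>. ennreal (h (k i \<omega>)) \<partial>P) = (\<integral>\<^sup>+ x. ennreal (h x) \<partial>D)"
      unfolding dist[OF i, symmetric] by (subst nn_integral_distr) (use sample_measurable[OF i] in auto)
    then show ?thesis
      using nn_integral_coeff_moment[OF samp C c N] by (simp add: h_def L_def)
  qed
  \<comment> \<open>For \<open>N = 1\<close> the complement is empty. The general estimate would
    give \<open>1\<close> there, which does not become small with \<open>A\<close>.\<close>
  have bad_int: "(\<integral>\<^sup>+ \<omega>. bad \<omega> \<partial>P) \<le> ennreal (if N = 1 then 0 else real N * (40 * c * exp (1 - c)) ^ (N - 1))"
  proof (cases "N = 1")
    case True
    then have "bad \<omega> = 0" for \<omega> by (simp add: bad_def good_event_def)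
    then show ?thesis by simp
  next
    case False
    then show ?thesis using nn_integral_not_good[OF C c] by (simp add: bad_def)
  qed
  have split: "ennreal ((C * r) ^ (2 * N) + r ^ (2 * N) * (\<Sum>i<N. h (k i \<omega>))
        + (if good_event varpi N (\<lambda>i. k i \<omega>) \<mu> C c then 0 else 1))
      = ennreal ((C * r) ^ (2 * N)) + ennreal (r ^ (2 * N)) * (\<Sum>i<N. ennreal (h (k i \<omega>))) + bad \<omega>" for \<omega>
  proof -
    have "(\<Sum>i<N. h (k i \<omega>)) \<ge> 0" by (intro sum_nonneg h0)
    then have "ennreal ((C * r) ^ (2 * N) + r ^ (2 * N) * (\<Sum>i<N. h (k i \<omega>))
        + (if good_event varpi N (\<lambda>i. k i \<omega>) \<mu> C c then 0 else 1))
      = ennreal ((C * r) ^ (2 * N)) + ennreal (r ^ (2 * N)) * ennreal (\<Sum>i<N. h (k i \<omega>)) + bad \<omega>"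
      using C r by (simp add: bad_def ennreal_mult)
    then show ?thesis using h0 by (simp add: sum_ennreal)
  qed
  have "(\<integral>\<^sup>+ \<omega>. ennreal ((C * r) ^ (2 * N) + r ^ (2 * N) * (\<Sum>i<N. h (k i \<omega>))
        + (if good_event varpi N (\<lambda>i. k i \<omega>) \<mu> C c then 0 else 1)) \<partial>P)
    = ennreal ((C * r) ^ (2 * N)) + ennreal (r ^ (2 * N)) * (\<Sum>i<N. \<integral>\<^sup>+ \<omega>. ennreal (h (k i \<omega>)) \<partial>P) + (\<integral>\<^sup>+ \<omega>. bad \<omega> \<partial>P)"
  proof -
    have "(\<integral>\<^sup>+ \<omega>. ennreal (r ^ (2 * N)) * (\<Sum>i<N. ennreal (h (k i \<omega>))) \<partial>P)
       = ennreal (r ^ (2 * N)) * (\<Sum>i<N. \<integral>\<^sup>+ \<omega>. ennreal (h (k i \<omega>)) \<partial>P)"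
      by (subst nn_integral_cmult[OF sum_meas], subst nn_integral_sum) (use h_k in auto)
    moreover have "(\<integral>\<^sup>+ \<omega>. ennreal ((C * r) ^ (2 * N)) \<partial>P) = ennreal ((C * r) ^ (2 * N))"
      by (simp add: prob_space.emeasure_space_1[OF P])
    ultimately show ?thesis
      unfolding split by (simp add: nn_integral_add)
  qed
  also have "\<dots> \<le> ennreal ((C * r) ^ (2 * N)) + ennreal (r ^ (2 * N))
      * (\<Sum>i<N. ennreal (2 * (22 * exp c * varpi\<^sup>2 * L\<^sup>2) ^ (N - 1) * L\<^sup>2))
      + ennreal (if N = 1 then 0 else real N * (40 * c * exp (1 - c)) ^ (N - 1))"
    by (intro add_mono mult_left_mono sum_mono bad_int order_refl) (use h_int in auto)
  also have "(\<Sum>i<N. ennreal (2 * (22 * exp c * varpi\<^sup>2 * L\<^sup>2) ^ (N - 1) * L\<^sup>2))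
      = ennreal (real N * (2 * (22 * exp c * varpi\<^sup>2 * L\<^sup>2) ^ (N - 1) * L\<^sup>2))"
    by (subst sum_ennreal) auto
  also have "ennreal ((C * r) ^ (2 * N)) + ennreal (r ^ (2 * N)) * \<dots>
      + ennreal (if N = 1 then 0 else real N * (40 * c * exp (1 - c)) ^ (N - 1))
    = ennreal ((C * r) ^ (2 * N) + r ^ (2 * N) * (real N * (2 * (22 * exp c * varpi\<^sup>2 * L\<^sup>2) ^ (N - 1) * L\<^sup>2))
        + (if N = 1 then 0 else real N * (40 * c * exp (1 - c)) ^ (N - 1)))"
  proof -
    have *: "0 \<le> x \<Longrightarrow> 0 \<le> y \<Longrightarrow> 0 \<le> z \<Longrightarrow> 0 \<le> v \<Longrightarrow> ennreal x + ennreal y * ennreal z + ennreal v = ennreal (x + y * z + v)"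
      for x y z v :: real by (simp add: ennreal_mult)
    show ?thesis by (rule *) (use C r c in auto)
  qed
  finally show ?thesis by (simp only: h_def)
qed

end

section \<open>The choice of the parameter c\<close>

text \<open>For \<open>0 < A < 1\<close> and \<open>N > 1\<close>, the solution of
  \<open>exp (c * (N - 1)) = A powr (- N)\<close>. For \<open>N = 1\<close> the exponent disappears
  and any value above \<open>2\<close> will do.\<close>

definition feature_param :: "nat \<Rightarrow> real \<Rightarrow> real" where
  "feature_param N A = (if N = 1 then 3 else real N / real (N - 1) * \<bar>ln A\<bar>)"

text \<open>One summand for each part of the error: the derivative of \<open>u\<close>, the features
  on the event, and the complement.\<close>

definition feature_const :: "nat \<Rightarrow> real" where
  "feature_const N = 1 + 2 * real N * 22 ^ (N - 1) + real N * (80 * exp 1) ^ (N - 1)"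

lemma feature_const_pos: "feature_const N > 0"
  unfolding feature_const_def by (intro add_pos_nonneg) auto

lemma abs_ln_ge_2:
  fixes A :: real
  assumes "0 < A" "A \<le> exp (-2)"
  shows "\<bar>ln A\<bar> \<ge> 2" "ln A = - \<bar>ln A\<bar>"
proof -
  have "ln A \<le> ln (exp (-2))" using assms by (subst ln_le_cancel_iff) auto
  then show "\<bar>ln A\<bar> \<ge> 2" "ln A = - \<bar>ln A\<bar>" by auto
qed

text \<open>The factor \<open>N / (N - 1)\<close> exceeds \<open>1\<close>, which makes the
  inequality strict even at \<open>A = exp (-2)\<close>, where \<open>|ln A|\<close> is exactly
  \<open>2\<close>.\<close>

lemma feature_param_gt_2:
  assumes "0 < A" "A \<le> exp (-2)" "N \<ge> 1"
  shows "feature_param N A > 2"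
proof (cases "N = 1")
  case False
  then have N: "real (N - 1) > 0" using assms by simp
  have "2 < real N / real (N - 1) * 2" using N assms(3) by (simp add: less_divide_eq of_nat_diff)
  also have "\<dots> \<le> real N / real (N - 1) * \<bar>ln A\<bar>"
    using abs_ln_ge_2(1)[OF assms(1,2)] N by (intro mult_left_mono) auto
  finally show ?thesis using False by (simp add: feature_param_def)
qed (simp add: feature_param_def)

text \<open>The choice of the parameter balances the error \<open>A ^ (2N) exp (c (N - 1))\<close> on the good event
  against the probability \<open>exp (- c (N - 1)) c ^ (N - 1)\<close> of its complement.\<close>

lemma feature_param_balance:
  assumes A: "A = varpi * L * r" "0 < A" "A \<le> exp (-2)" and N: "N \<ge> 1"
    and varpi: "varpi \<ge> 1" and L: "0 < C" "C \<le> L" and r: "r > 0"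
  defines "c \<equiv> feature_param N A"
  shows "(C * r) ^ (2 * N) + r ^ (2 * N) * (real N * (2 * (22 * exp c * varpi\<^sup>2 * L\<^sup>2) ^ (N - 1) * L\<^sup>2))
        + (if N = 1 then 0 else real N * (40 * c * exp (1 - c)) ^ (N - 1))
    \<le> feature_const N * (A ^ N * \<bar>ln A\<bar> ^ (N - 1))"
proof -
  define T where "T = A ^ N * \<bar>ln A\<bar> ^ (N - 1)"
  note ln2 = abs_ln_ge_2[OF A(2,3)]
  have "exp (-2) \<le> (1::real)" by simp
  then have A1: "A \<le> 1" using A(3) by linarith
  have AT: "A ^ N \<le> T"
    using mult_left_mono[of 1 "\<bar>ln A\<bar> ^ (N - 1)" "A ^ N"] ln2 A by (simp add: T_def one_le_power)
  have "C * r \<le> A"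
  proof -
    have "C * r \<le> L * r" using L r by (intro mult_right_mono) auto
    also have "\<dots> \<le> varpi * (L * r)" using varpi L r mult_right_mono[of 1 varpi "L * r"] by simp
    finally show ?thesis by (simp add: A mult_ac)
  qed
  then have "(C * r) ^ (2 * N) \<le> A ^ (2 * N)" using L r by (intro power_mono) auto
  also have "\<dots> \<le> A ^ N" using A A1 by (intro power_decreasing) auto
  finally have 1: "(C * r) ^ (2 * N) \<le> T" using AT by linarith
  obtain n where n: "N = Suc n" using N by (cases N) auto
  have cN: "exp c ^ n * A ^ N = 1" if "N \<noteq> 1"
  proof -
    have n0: "real n > 0" using that n by simp
    have "exp c ^ n = exp (real n * c)" by (rule exp_of_nat_mult[symmetric])
    also have "real n * c = - (real N * ln A)"
      using that n0 ln2(2) by (simp add: c_def feature_param_def n)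
    also have "exp (- (real N * ln A)) = 1 / A ^ N"
      using A(2) by (simp add: exp_minus exp_of_nat_mult inverse_eq_divide)
    finally show ?thesis using A(2) by simp
  qed
  have eA: "exp c ^ n * A ^ (2 * N) \<le> A ^ N"
  proof (cases "N = 1")
    case True
    then show ?thesis
      using n A1 A(2) mult_left_mono[of A 1 A] by (simp add: power2_eq_square)
  next
    case False
    have "exp c ^ n * A ^ (2 * N) = (exp c ^ n * A ^ N) * A ^ N"
      by (simp only: mult_2 power_add mult.assoc)
    then show ?thesis using cN[OF False] by simp
  qed
  have "r ^ (2 * N) * (real N * (2 * (22 * exp c * varpi\<^sup>2 * L\<^sup>2) ^ (N - 1) * L\<^sup>2))
      = 2 * real N * 22 ^ n * (exp c ^ n * ((varpi\<^sup>2) ^ n * ((L\<^sup>2) ^ N * (r\<^sup>2) ^ N)))"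
  proof -
    have "N - 1 = n" "(L\<^sup>2) ^ N = (L\<^sup>2) ^ n * L\<^sup>2" by (simp_all only: n diff_Suc_1 power_Suc2)
    moreover have "r ^ (2 * N) = (r\<^sup>2) ^ N" by (rule power_mult)
    ultimately show ?thesis by (simp only: power_mult_distrib mult_ac)
  qed
  \<comment> \<open>\<open>varpi \<ge> 1\<close> allows one more factor
    \<open>varpi\<^sup>2\<close>, which completes the product to a power of
    \<open>A\<close>.\<close>
  also have "\<dots> \<le> 2 * real N * 22 ^ n * (exp c ^ n * ((varpi\<^sup>2) ^ N * ((L\<^sup>2) ^ N * (r\<^sup>2) ^ N)))"
    using varpi by (intro mult_left_mono mult_right_mono power_increasing) (auto simp: n one_le_power)
  also have "(varpi\<^sup>2) ^ N * ((L\<^sup>2) ^ N * (r\<^sup>2) ^ N) = A ^ (2 * N)"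
    by (simp only: A(1) power_mult_distrib power_mult mult.assoc)
  also have "2 * real N * 22 ^ n * (exp c ^ n * A ^ (2 * N)) \<le> 2 * real N * 22 ^ n * T"
    using eA AT by (intro mult_left_mono) auto
  finally have 2: "r ^ (2 * N) * (real N * (2 * (22 * exp c * varpi\<^sup>2 * L\<^sup>2) ^ (N - 1) * L\<^sup>2)) \<le> 2 * real N * 22 ^ (N - 1) * T"
    by (simp add: n)
  have 3: "(if N = 1 then 0 else real N * (40 * c * exp (1 - c)) ^ (N - 1)) \<le> real N * (80 * exp 1) ^ (N - 1) * T"
  proof (cases "N = 1")
    case True
    then show ?thesis using A ln2 by (simp add: T_def)
  next
    case False
    then have n1: "n \<ge> 1" using n by simp
    \<comment> \<open>\<open>N \<ge> 2\<close> in this case, so replacing \<open>c\<close> by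
      \<open>2 * |ln A|\<close> turns the constant \<open>40\<close> into \<open>80\<close>.\<close>
    have N2: "real N / real n \<le> 2" using n1 n by (simp add: divide_le_eq)
    have "c = real N / real n * \<bar>ln A\<bar>"
      using False by (simp add: c_def feature_param_def n)
    also have "\<dots> \<le> 2 * \<bar>ln A\<bar>" by (rule mult_right_mono[OF N2]) simp
    finally have c_le: "c \<le> 2 * \<bar>ln A\<bar>" .
    have c0: "c > 0" using feature_param_gt_2[OF A(2,3) N] by (simp add: c_def)
    have "(40 * c * exp (1 - c)) ^ n = (40 * exp 1) ^ n * c ^ n * (1 / exp c ^ n)"
      by (simp add: exp_diff power_mult_distrib power_divide)
    also have "1 / exp c ^ n = A ^ N" using cN[OF False] by (simp add: field_simps)
    also have "(40 * exp 1) ^ n * c ^ n * A ^ N \<le> (40 * exp 1) ^ n * (2 * \<bar>ln A\<bar>) ^ n * A ^ N"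
      using c_le c0 A by (intro mult_right_mono mult_left_mono power_mono) auto
    also have "\<dots> = (80 * exp 1) ^ n * T"
    proof -
      have "(80 * exp 1 :: real) = (40 * exp 1) * 2" by simp
      then have "(80 * exp 1 :: real) ^ n = (40 * exp 1) ^ n * 2 ^ n" by (simp only: power_mult_distrib)
      moreover have "(2 * \<bar>ln A\<bar>) ^ n = 2 ^ n * \<bar>ln A\<bar> ^ n" by (rule power_mult_distrib)
      moreover have "T = A ^ N * \<bar>ln A\<bar> ^ n" by (simp only: T_def n diff_Suc_1)
      ultimately show ?thesis by (simp only: mult.assoc) (simp only: mult.left_commute mult.commute)
    qed
    finally have "(40 * c * exp (1 - c)) ^ n \<le> (80 * exp 1) ^ n * T" .
    then have "real N * (40 * c * exp (1 - c)) ^ n \<le> real N * ((80 * exp 1) ^ n * T)"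
      by (intro mult_left_mono) auto
    then show ?thesis using False by (simp only: n diff_Suc_1 if_False mult.assoc)
  qed
  have "(C * r) ^ (2 * N) + r ^ (2 * N) * (real N * (2 * (22 * exp c * varpi\<^sup>2 * L\<^sup>2) ^ (N - 1) * L\<^sup>2))
        + (if N = 1 then 0 else real N * (40 * c * exp (1 - c)) ^ (N - 1))
     \<le> T + 2 * real N * 22 ^ (N - 1) * T + real N * (80 * exp 1) ^ (N - 1) * T"
    using 1 2 3 by (intro add_mono)
  also have "\<dots> = feature_const N * T"
    by (simp only: feature_const_def distrib_right mult_1)
  finally show ?thesis by (simp only: T_def)
qed

section \<open>Localization\<close>

lemma deriv_on_interior:
  assumes "x \<in> interior I"
  shows "deriv_on I f x = deriv f x"
proof -
  have "at x within I = at x" using assms by (rule at_within_interior)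
  then show ?thesis
    by (simp add: deriv_on_def deriv_def vector_derivative_def has_real_derivative_iff_has_vector_derivative)
qed

text \<open>On an open set the derivatives within \<open>I\<close> are the ordinary ones, so Gevrey
  bounds on a closed patch apply to \<open>deriv\<close> on the open patch.\<close>

lemma deriv_on_iterate:
  assumes T: "open T" "T \<subseteq> I" and "x \<in> T"
  shows "(deriv_on I ^^ n) f x = (deriv ^^ n) f x"
  using \<open>x \<in> T\<close>
proof (induction n arbitrary: x)
  case (Suc n)
  have "x \<in> interior I" using T Suc.prems by (meson interior_maximal subsetD)
  then have "(deriv_on I ^^ Suc n) f x = deriv ((deriv_on I ^^ n) f) x"
    by (simp add: deriv_on_interior)
  also have "\<dots> = deriv ((deriv ^^ n) f) x"
    using Suc.IH Suc.prems T(1) by (intro deriv_cong_ev refl) (auto simp: eventually_nhds)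
  finally show ?case by simp
qed simp

lemma smooth_on_deriv_seq:
  assumes f: "smooth_on I f" and T: "open T" "T \<subseteq> I"
  shows "deriv_seq T (\<lambda>n. (deriv ^^ n) f)"
proof (rule deriv_seq_deriv[OF T(1)])
  fix n
  show "(deriv ^^ n) f differentiable_on T"
    unfolding differentiable_on_def
  proof
    fix x assume x: "x \<in> T"
    have int: "x \<in> interior I" using T x by (meson interior_maximal subsetD)
    have "(deriv_on I ^^ n) f differentiable (at x within I)"
      using f x T by (auto simp: smooth_on_def differentiable_on_def)
    then have "(deriv_on I ^^ n) f differentiable (at x)"
      using at_within_interior[OF int] by simp
    then have "((deriv_on I ^^ n) f has_real_derivative deriv ((deriv_on I ^^ n) f) x) (at x)"
      by (simp add: DERIV_deriv_iff_real_differentiable)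
    then have "((deriv ^^ n) f has_real_derivative deriv ((deriv_on I ^^ n) f) x) (at x)"
      by (rule has_field_derivative_transform_within_open[OF _ T(1) x]) (rule deriv_on_iterate[OF T])
    then have "(deriv ^^ n) f differentiable (at x)"
      unfolding real_differentiable_def by blast
    then show "(deriv ^^ n) f differentiable (at x within T)"
      by (rule differentiable_at_withinI)
  qed
qed

section \<open>Joint measurability in sample and position\<close>

lemma measurable_inj_on_squares:
  fixes k :: "nat \<Rightarrow> 'w \<Rightarrow> real"
  assumes k: "\<And>i. i < N \<Longrightarrow> k i \<in> borel_measurable P"
  shows "Measurable.pred P (\<lambda>\<omega>. inj_on (\<lambda>j. (k j \<omega>)\<^sup>2) {..<N})"
proof -
  have "Measurable.pred P (\<lambda>\<omega>. (k i \<omega>)\<^sup>2 = (k j \<omega>)\<^sup>2 \<longrightarrow> i = j)" if "i < N" "j < N" for i j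
  proof -
    have [measurable]: "k i \<in> borel_measurable P" "k j \<in> borel_measurable P" using k that by auto
    show ?thesis by measurable
  qed
  then show ?thesis
    unfolding inj_on_def by (intro pred_intros_finite(3)) auto
qed

text \<open>The formulas for the coefficients hold for every sample, degenerate ones included, so
  measurability needs no exceptional set.\<close>

lemma measurable_rf_deriv:
  fixes k :: "nat \<Rightarrow> 'w \<Rightarrow> real" and S :: "real set"
  assumes k: "\<And>i. i < N \<Longrightarrow> k i \<in> borel_measurable P"
  shows "(\<lambda>(\<omega>, x). rf_deriv varpi N (\<lambda>i. k i \<omega>) \<mu> C c v n (x - a)) \<in> borel_measurable (P \<Otimes>\<^sub>M lebesgue_on S)"
proof -
  let ?M = "P \<Otimes>\<^sub>M lebesgue_on S"
  have inj: "Measurable.pred P (\<lambda>\<omega>. inj_on (\<lambda>j. (k j \<omega>)\<^sup>2) {..<N})"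
    by (rule measurable_inj_on_squares[OF k])
  have nz: "Measurable.pred P (\<lambda>\<omega>. \<forall>j\<in>{..<N}. k j \<omega> \<noteq> 0)"
  proof (rule pred_intros_finite(3))
    fix j assume "j \<in> {..<N}"
    then have [measurable]: "k j \<in> borel_measurable P" using k by auto
    show "Measurable.pred P (\<lambda>\<omega>. k j \<omega> \<noteq> 0)" by measurable
  qed simp
  have good: "Measurable.pred P (\<lambda>\<omega>. good_event varpi N (\<lambda>i. k i \<omega>) \<mu> C c)"
    by (rule measurable_good_event[OF k])
  have X: "(\<lambda>\<omega>. vec_index (X_coeff N (\<lambda>i. k i \<omega>) v) i) \<in> borel_measurable P" if i: "i < N" for i
    unfolding X_coeff_eq[OF i]
    by (intro measurable_If measurable_lag_sum k i borel_measurable_const) (use inj in \<open>simp_all add: pred_def\<close>)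
  have Y: "(\<lambda>\<omega>. vec_index (Y_coeff N (\<lambda>i. k i \<omega>) v) i) \<in> borel_measurable P" if i: "i < N" for i
  proof -
    have "Measurable.pred P (\<lambda>\<omega>. inj_on (\<lambda>j. (k j \<omega>)\<^sup>2) {..<N} \<and> (\<forall>j\<in>{..<N}. k j \<omega> \<noteq> 0))"
      using inj nz by (rule pred_intros_logic(3))
    then have "{\<omega> \<in> space P. inj_on (\<lambda>j. (k j \<omega>)\<^sup>2) {..<N} \<and> (\<forall>j<N. k j \<omega> \<noteq> 0)} \<in> sets P"
      by (simp add: pred_def Ball_def)
    then show ?thesis
      unfolding Y_coeff_eq[OF i]
      by (intro measurable_If borel_measurable_divide measurable_lag_sum k i borel_measurable_const)
  qed
  have k': "(\<lambda>z. k i (fst z)) \<in> borel_measurable ?M" if "i < N" for i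
    by (rule measurable_compose[OF measurable_fst k[OF that]])
  have x: "(\<lambda>z. snd z) \<in> borel_measurable ?M"
  proof (rule measurable_compose[OF measurable_snd])
    show "(\<lambda>x. x) \<in> borel_measurable (lebesgue_on S)"
      by (intro measurable_restrict_space1 measurable_completion) simp
  qed
  have arg: "(\<lambda>z. k i (fst z) * (snd z - a) + real n * (pi / 2)) \<in> borel_measurable ?M" if "i < N" for i
    by (intro borel_measurable_add borel_measurable_times borel_measurable_diff borel_measurable_const k'[OF that] x)
  have trig: "(\<lambda>z. trig_sum N (\<lambda>i. k i (fst z)) (vec_index (X_coeff N (\<lambda>i. k i (fst z)) v))
      (vec_index (Y_coeff N (\<lambda>i. k i (fst z)) v)) n (snd z - a)) \<in> borel_measurable ?M"
    unfolding trig_sum_def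
  proof (intro borel_measurable_sum)
    fix i assume "i \<in> {..<N}"
    then have i: "i < N" by simp
    have cs: "(\<lambda>z. cos (k i (fst z) * (snd z - a) + real n * (pi / 2))) \<in> borel_measurable ?M"
      "(\<lambda>z. sin (k i (fst z) * (snd z - a) + real n * (pi / 2))) \<in> borel_measurable ?M"
      using arg[OF i] by measurable
    show "(\<lambda>z. k i (fst z) ^ n * (vec_index (X_coeff N (\<lambda>i. k i (fst z)) v) i * cos (k i (fst z) * (snd z - a) + real n * (pi / 2))
        + vec_index (Y_coeff N (\<lambda>i. k i (fst z)) v) i * sin (k i (fst z) * (snd z - a) + real n * (pi / 2)))) \<in> borel_measurable ?M"
      by (intro borel_measurable_times borel_measurable_add borel_measurable_power k'[OF i] cs
          measurable_compose[OF measurable_fst X[OF i]] measurable_compose[OF measurable_fst Y[OF i]])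
  qed
  have "{z \<in> space ?M. good_event varpi N (\<lambda>i. k i (fst z)) \<mu> C c} \<in> sets ?M"
    using measurable_compose[OF measurable_fst good, of "lebesgue_on S"] by (simp add: pred_def)
  with trig show ?thesis
    unfolding rf_deriv_def case_prod_beta' by (intro measurable_If borel_measurable_const)
qed

section \<open>Patches and gluing\<close>

lemma partition_of_unity_patch:
  assumes pu: "partition_of_unity_assumption m {-R<..<R} J \<phi> patch ctr r M C\<phi>" and j: "j < J" and R: "R > 0"
  shows "patch j = ball (ctr j) (r j)" "r j > 0" "patch j \<subseteq> {-R<..<R}" "r j \<le> R"
proof -
  have p: "patch j = interior (closure {x \<in> {-R<..<R}. \<phi> j x \<noteq> 0})" "patch j \<noteq> {}" "patch j = ball (ctr j) (r j)"
    using pu j unfolding partition_of_unity_assumption_def by blast+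
  have r0: "r j > 0" using p(2) unfolding p(3) by (simp add: not_le)
  show "patch j = ball (ctr j) (r j)" by (rule p(3))
  show "r j > 0" by (rule r0)
  have "closure {x \<in> {-R<..<R}. \<phi> j x \<noteq> 0} \<subseteq> closure {-R<..<R}" by (intro closure_mono) auto
  then have "patch j \<subseteq> interior (closure {-R<..<R})" unfolding p(1) by (rule interior_mono)
  also have "\<dots> = {-R<..<R}" using R by simp
  finally show sub: "patch j \<subseteq> {-R<..<R}" .
  have "closure (ball (ctr j) (r j)) \<subseteq> closure {-R<..<R}" using sub unfolding p(3) by (rule closure_mono)
  then have "cball (ctr j) (r j) \<subseteq> {-R..R}" using R r0 by simp
  moreover have "ctr j - r j \<in> cball (ctr j) (r j)" "ctr j + r j \<in> cball (ctr j) (r j)"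
    using r0 by (auto simp: dist_real_def)
  ultimately have "ctr j - r j \<in> {-R..R}" "ctr j + r j \<in> {-R..R}" by blast+
  then show "r j \<le> R" by auto
qed

text \<open>Three regions: the assumed bound on the patch, vanishing off the closed patch by
  locality, and the two endpoints, which form a null set.\<close>

lemma partition_of_unity_weak_deriv:
  assumes pu: "partition_of_unity_assumption m {-R<..<R} J \<phi> patch ctr r M C\<phi>" and j: "j < J" and k: "k \<le> m" and R: "R > 0"
  shows "has_weak_deriv {-R<..<R} k (\<phi> j) (weak_deriv {-R<..<R} k (\<phi> j))" (is ?weak)
    and "AE x in lebesgue_on {-R<..<R}. \<bar>weak_deriv {-R<..<R} k (\<phi> j) x\<bar> \<le> indicator (patch j) x * (\<bar>C\<phi>\<bar> / r j ^ k)"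
proof -
  let ?\<Omega> = "{-R<..<R}" and ?g = "weak_deriv {-R<..<R} k (\<phi> j)"
  note P = partition_of_unity_patch[OF pu j R]
  have "\<phi> j \<in> sobolev_space m \<top> ?\<Omega>"
    using pu j unfolding partition_of_unity_assumption_def by blast
  then have "\<exists>g. has_weak_deriv ?\<Omega> k (\<phi> j) g"
    using k unfolding sobolev_space_def sobolev_norm_def by (auto split: if_splits)
  then show weak: ?weak by (auto intro: has_weak_deriv_weak_deriv)
  have sets: "patch j \<in> sets lebesgue" using P(1) by simp
  have 0: "AE x in lebesgue_on ?\<Omega>. x \<notin> patch j \<longrightarrow> \<phi> j x = 0"
    using pu j unfolding partition_of_unity_assumption_def by blast
  let ?T = "?\<Omega> - cball (ctr j) (r j)"
  have "AE x in lebesgue_on ?\<Omega>. x \<in> ?T \<longrightarrow> \<phi> j x = 0"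
    using 0 by eventually_elim (use P(1) in auto)
  then have T: "AE x in lebesgue_on ?\<Omega>. x \<in> ?T \<longrightarrow> ?g x = 0"
    by (intro has_weak_deriv_vanish[OF _ _ _ weak]) auto
  have "AE x in lebesgue. x \<noteq> ctr j - r j \<and> x \<noteq> ctr j + r j"
    by (intro AE_conjI AE_completion AE_lborel_singleton)
  then have bdry: "AE x in lebesgue_on ?\<Omega>. x \<noteq> ctr j - r j \<and> x \<noteq> ctr j + r j"
    by (simp add: AE_restrict_space_iff) (auto elim: eventually_mono)
  have "Linf_norm (patch j) ?g \<le> ennreal (C\<phi> / r j ^ k)"
    using pu j k unfolding partition_of_unity_assumption_def by blast
  also have "\<dots> \<le> ennreal (\<bar>C\<phi>\<bar> / r j ^ k)"
    using P(2) by (intro ennreal_leI divide_right_mono) auto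
  finally have L: "esssup (lebesgue_on (patch j)) (\<lambda>x. ennreal \<bar>?g x\<bar>) \<le> ennreal (\<bar>C\<phi>\<bar> / r j ^ k)"
    by (simp add: Linf_norm_def)
  have "AE x in lebesgue_on (patch j). \<bar>?g x\<bar> \<le> \<bar>C\<phi>\<bar> / r j ^ k"
    using esssup_AE[of "\<lambda>x. ennreal \<bar>?g x\<bar>" "lebesgue_on (patch j)"]
  proof eventually_elim
    case (elim x)
    from order_trans[OF elim L] show ?case using P(2) by (subst (asm) ennreal_le_iff) auto
  qed
  then have "AE x in lebesgue. x \<in> patch j \<longrightarrow> \<bar>?g x\<bar> \<le> \<bar>C\<phi>\<bar> / r j ^ k"
    using sets by (simp add: AE_restrict_space_iff)
  then have "AE x in lebesgue_on ?\<Omega>. x \<in> patch j \<longrightarrow> \<bar>?g x\<bar> \<le> \<bar>C\<phi>\<bar> / r j ^ k"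
    by (simp add: AE_restrict_space_iff) (auto elim: eventually_mono)
  moreover have "AE x in lebesgue_on ?\<Omega>. x \<in> ?\<Omega>"
    using AE_space[of "lebesgue_on ?\<Omega>"] by simp
  ultimately show "AE x in lebesgue_on ?\<Omega>. \<bar>?g x\<bar> \<le> indicator (patch j) x * (\<bar>C\<phi>\<bar> / r j ^ k)"
    using T bdry
  proof eventually_elim
    case (elim x)
    show ?case
    proof (cases "x \<in> patch j")
      case False
      then have "x \<notin> cball (ctr j) (r j)" using elim P(1) by (auto simp: dist_real_def abs_if split: if_splits)
      then show ?thesis using elim False by simp
    qed (use elim in simp)
  qed
qed

lemma leibniz_bound:
  assumes \<phi>: "\<And>k. k \<le> n \<Longrightarrow> \<bar>\<phi> k x\<bar> \<le> a / r ^ k" and w: "\<And>l. l \<le> n \<Longrightarrow> \<bar>w l x\<bar> \<le> b / r ^ l"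
    and "r > 0" "a \<ge> 0" "b \<ge> 0"
  shows "\<bar>leibniz \<phi> w n x\<bar> \<le> 2 ^ n * (a * b) / r ^ n"
proof -
  have "\<bar>leibniz \<phi> w n x\<bar> \<le> (\<Sum>l\<le>n. \<bar>real (n choose l) * (\<phi> (n - l) x * w l x)\<bar>)"
    unfolding leibniz_def by (rule sum_abs)
  also have "\<dots> \<le> (\<Sum>l\<le>n. real (n choose l) * (a * b / r ^ n))"
  proof (intro sum_mono)
    fix l assume "l \<in> {..n}"
    then have l: "l \<le> n" by simp
    have "\<bar>\<phi> (n - l) x\<bar> * \<bar>w l x\<bar> \<le> (a / r ^ (n - l)) * (b / r ^ l)"
      using assms l by (intro mult_mono) auto
    also have "\<dots> = a * b / r ^ n"
      using l by (simp add: power_add[symmetric])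
    finally show "\<bar>real (n choose l) * (\<phi> (n - l) x * w l x)\<bar> \<le> real (n choose l) * (a * b / r ^ n)"
      using mult_left_mono[of _ _ "real (n choose l)"] by (simp add: abs_mult del: times_divide_eq_right)
  qed
  also have "\<dots> = (\<Sum>l\<le>n. real (n choose l)) * (a * b / r ^ n)" by (rule sum_distrib_right[symmetric])
  also have "(\<Sum>l\<le>n. real (n choose l)) = 2 ^ n"
    using choose_row_sum[of n] by (metis of_nat_numeral of_nat_power of_nat_sum)
  finally show ?thesis by simp
qed

text \<open>\<open>2 ^ m\<close> bounds the binomial sums in Leibniz' rule, and
  \<open>(1 + R) ^ (m + 1)\<close> pays for bringing all orders to the denominator
  \<open>r ^ (m + 1)\<close>; the rest comes from \<open>sobolev_sum_le\<close>.\<close>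

definition localization_const :: "nat \<Rightarrow> nat \<Rightarrow> real \<Rightarrow> real \<Rightarrow> real" where
  "localization_const m J C R = 2 * (real m + 1) * real J * (2 ^ m * \<bar>C\<bar> * (1 + R) ^ (m + 1))"

lemma localization_const_nonneg: "R > 0 \<Longrightarrow> localization_const m J C R \<ge> 0"
  by (simp add: localization_const_def)

text \<open>The identity holds for every sample and serves measurability, while the estimate relies
  on bounds that are available almost surely; hence two separate conclusions.\<close>

lemma partition_of_unity_sobolev:
  fixes w :: "nat \<Rightarrow> nat \<Rightarrow> real \<Rightarrow> real" and p :: ennreal
  assumes pu: "partition_of_unity_assumption m {-R<..<R} J \<phi> patch ctr r M C\<phi>" and R: "R > 0" and p: "p \<ge> 1"
    and w: "\<And>j. j < J \<Longrightarrow> deriv_seq {-R<..<R} (w j)"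
    and f: "\<And>x. x \<in> {-R<..<R} \<Longrightarrow> f x = (\<Sum>j<J. \<phi> j x * w j 0 x)"
  defines "G \<equiv> \<lambda>n x. \<Sum>j<J. leibniz (\<lambda>k. weak_deriv {-R<..<R} k (\<phi> j)) (w j) n x"
  shows "sobolev_norm m p {-R<..<R} f = sobolev_sum m p {-R<..<R} G" (is ?eq)
    and "(\<And>j. j < J \<Longrightarrow> b j \<ge> 0) \<Longrightarrow>
         (\<And>j l x. j < J \<Longrightarrow> l \<le> m \<Longrightarrow> x \<in> patch j \<Longrightarrow> \<bar>w j l x\<bar> \<le> b j / r j ^ l) \<Longrightarrow>
         sobolev_norm m p {-R<..<R} f \<le> ennreal (localization_const m J C\<phi> R * (\<Sum>j<J. r j powr (enn2real (1 / p) - real m - 1) * b j))"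
proof -
  let ?\<Omega> = "{-R<..<R}"
  have weak: "has_weak_deriv ?\<Omega> n f (G n)" if n: "n \<le> m" for n
  proof -
    have "has_weak_deriv ?\<Omega> n (\<lambda>x. \<Sum>j<J. \<phi> j x * w j 0 x) (G n)"
      unfolding G_def
      by (intro has_weak_deriv_sum has_weak_deriv_mult w partition_of_unity_weak_deriv(1)[OF pu _ _ R])
         (use n in auto)
    then show ?thesis
      using has_weak_deriv_cong[of ?\<Omega> f "\<lambda>x. \<Sum>j<J. \<phi> j x * w j 0 x" "G n" "G n" n] f by auto
  qed
  show eq: ?eq by (rule sobolev_norm_eq_sum[OF _ weak]) auto
  assume b: "\<And>j. j < J \<Longrightarrow> b j \<ge> 0"
    and bound: "\<And>j l x. j < J \<Longrightarrow> l \<le> m \<Longrightarrow> x \<in> patch j \<Longrightarrow> \<bar>w j l x\<bar> \<le> b j / r j ^ l"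
  define B where "B j = 2 ^ m * \<bar>C\<phi>\<bar> * (1 + R) ^ (m + 1) * b j / r j ^ (m + 1)" for j
  note P = partition_of_unity_patch[OF pu _ R]
  have AE: "AE x in lebesgue_on ?\<Omega>. \<bar>G n x\<bar> \<le> (\<Sum>j<J. indicator (patch j) x * B j)" if n: "n \<le> m" for n
  proof -
    have "AE x in lebesgue_on ?\<Omega>. \<forall>j\<in>{..<J}. \<forall>k\<in>{..n}.
        \<bar>weak_deriv ?\<Omega> k (\<phi> j) x\<bar> \<le> indicator (patch j) x * (\<bar>C\<phi>\<bar> / r j ^ k)"
      using n by (intro AE_finite_allI partition_of_unity_weak_deriv(2)[OF pu _ _ R]) auto
    then show ?thesis
    proof eventually_elim
      case (elim x)
      have "\<bar>leibniz (\<lambda>k. weak_deriv ?\<Omega> k (\<phi> j)) (w j) n x\<bar> \<le> indicator (patch j) x * B j" if j: "j < J" for j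
      proof (cases "x \<in> patch j")
        case True
        have r: "r j > 0" "r j \<le> R" using P[OF j] by auto
        have "\<bar>leibniz (\<lambda>k. weak_deriv ?\<Omega> k (\<phi> j)) (w j) n x\<bar> \<le> 2 ^ n * (\<bar>C\<phi>\<bar> * b j) / r j ^ n"
        proof (rule leibniz_bound)
          show "\<bar>weak_deriv ?\<Omega> k (\<phi> j) x\<bar> \<le> \<bar>C\<phi>\<bar> / r j ^ k" if "k \<le> n" for k
            using bspec[OF bspec[OF elim, of j], of k] j that True by simp
          show "\<bar>w j l x\<bar> \<le> b j / r j ^ l" if "l \<le> n" for l
            using bound[OF j _ True] that n by auto
        qed (use r b[OF j] in auto)
        \<comment> \<open>All orders \<open>n \<le> m\<close> get the denominator
          \<open>r j ^ (m + 1)\<close>; the surplus powers of \<open>r j \<le> R\<close> move into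
          the constant.\<close>
        also have "\<dots> = 2 ^ n * (\<bar>C\<phi>\<bar> * b j) * (r j ^ (m + 1 - n) / r j ^ (m + 1))"
          using r n by (simp add: power_diff field_simps)
        also have "\<dots> \<le> 2 ^ m * (\<bar>C\<phi>\<bar> * b j) * ((1 + R) ^ (m + 1) / r j ^ (m + 1))"
        proof (intro mult_mono divide_right_mono)
          have "r j ^ (m + 1 - n) \<le> (1 + R) ^ (m + 1 - n)" using r R by (intro power_mono) auto
          also have "\<dots> \<le> (1 + R) ^ (m + 1)" using R by (intro power_increasing) auto
          finally show "r j ^ (m + 1 - n) \<le> (1 + R) ^ (m + 1)" .
        qed (use n r R b[OF j] in \<open>auto intro: power_increasing\<close>)
        also have "\<dots> = B j" by (simp add: B_def)
        finally show ?thesis using True by simp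
      next
        case False
        have "weak_deriv ?\<Omega> (n - l) (\<phi> j) x = 0" for l
        proof -
          have "\<bar>weak_deriv ?\<Omega> (n - l) (\<phi> j) x\<bar> \<le> indicator (patch j) x * (\<bar>C\<phi>\<bar> / r j ^ (n - l))"
            using bspec[OF bspec[OF elim, of j], of "n - l"] j by simp
          then show ?thesis using False by simp
        qed
        then show ?thesis using False by (simp add: leibniz_def)
      qed
      then show ?case
        unfolding G_def by (intro order_trans[OF sum_abs] sum_mono) auto
    qed
  qed
  have "sobolev_sum m p ?\<Omega> G \<le> ennreal (2 * (real m + 1) * real J * (\<Sum>j<J. r j powr enn2real (1 / p) * B j))"
  proof (rule sobolev_sum_le[OF _ p _ _ P(1) _ AE])
    show "B j \<ge> 0" if "j < J" for j
      using b[OF that] P(2)[OF that] R by (simp add: B_def)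
    show "G n \<in> borel_measurable (lebesgue_on ?\<Omega>)" if "n \<le> m" for n
      by (rule has_weak_deriv_measurable[OF _ weak[OF that]]) simp
  qed (use P(2) in auto)
  also have "(\<Sum>j<J. r j powr enn2real (1 / p) * B j)
      = (2 ^ m * \<bar>C\<phi>\<bar> * (1 + R) ^ (m + 1)) * (\<Sum>j<J. r j powr (enn2real (1 / p) - real m - 1) * b j)"
    unfolding sum_distrib_left
  proof (intro sum.cong refl)
    fix j assume "j \<in> {..<J}"
    then have r: "r j > 0" using P(2) by simp
    have "r j powr (enn2real (1 / p) - real m - 1) = r j powr (enn2real (1 / p) - real (m + 1))"
      by (simp add: algebra_simps)
    also have "\<dots> = r j powr enn2real (1 / p) / r j ^ (m + 1)"
      using r by (subst powr_diff, subst powr_realpow) auto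
    finally show "r j powr enn2real (1 / p) * B j
        = 2 ^ m * \<bar>C\<phi>\<bar> * (1 + R) ^ (m + 1) * (r j powr (enn2real (1 / p) - real m - 1) * b j)"
      by (simp add: B_def)
  qed
  finally show "sobolev_norm m p ?\<Omega> f \<le> ennreal (localization_const m J C\<phi> R * (\<Sum>j<J. r j powr (enn2real (1 / p) - real m - 1) * b j))"
    unfolding eq by (simp only: localization_const_def mult.assoc)
qed

section \<open>Expected error\<close>

lemma measurable_feature_error:
  fixes k :: "nat \<Rightarrow> 'w \<Rightarrow> real"
  assumes k: "\<And>i. i < N \<Longrightarrow> k i \<in> borel_measurable P"
  shows "(\<lambda>\<omega>. a + b * (\<Sum>i<N. feature_weight varpi c \<mu> C N (k i \<omega>))
      + (if good_event varpi N (\<lambda>i. k i \<omega>) \<mu> C c then 0 else 1)) \<in> borel_measurable P" (is "?E \<in> _")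
proof -
  have "(\<lambda>\<omega>. \<Sum>i<N. feature_weight varpi c \<mu> C N (k i \<omega>)) \<in> borel_measurable P"
  proof (rule borel_measurable_sum)
    fix i assume "i \<in> {..<N}"
    then have i: "k i \<in> borel_measurable P" by (intro k) simp
    show "(\<lambda>\<omega>. feature_weight varpi c \<mu> C N (k i \<omega>)) \<in> borel_measurable P"
      by (intro borel_measurable_times borel_measurable_abs borel_measurable_power borel_measurable_add
          borel_measurable_const borel_measurable_divide measurable_Q_fun i)
  qed
  moreover have "(\<lambda>\<omega>. if good_event varpi N (\<lambda>i. k i \<omega>) \<mu> C c then 0 else 1 :: real) \<in> borel_measurable P"
    using measurable_good_event[of N k P varpi \<mu> C c] k
    by (intro measurable_If borel_measurable_const) (auto simp: pred_def)
  ultimately show ?thesis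
    by (intro borel_measurable_add borel_measurable_times borel_measurable_const)
qed

text \<open>By linearity the expectation acts on each patch separately. The constants stay explicit,
  so that they are visibly independent of \<open>u\<close>, of the partition and of the laws; the
  maximum is formed afterwards.\<close>

lemma random_feature_expected_error:
  fixes R s C\<phi> Mu varpi :: real and p :: ennreal and m M J :: nat and N :: "nat \<Rightarrow> nat"
    and u :: "real \<Rightarrow> real" and P :: "'w measure" and k :: "nat \<Rightarrow> nat \<Rightarrow> 'w \<Rightarrow> real"
    and \<phi> :: "nat \<Rightarrow> real \<Rightarrow> real" and patch :: "nat \<Rightarrow> real set" and ctr r A C \<mu> :: "nat \<Rightarrow> real"
  assumes R: "R > 0" and s: "s \<ge> 0" and p: "p \<ge> 1" and N: "\<And>j. j < J \<Longrightarrow> m + 1 \<le> N j"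
    and u: "smooth_on {-R..R} u" and Mu: "Mu > 0"
    and pu: "partition_of_unity_assumption m {-R<..<R} J \<phi> patch ctr r M C\<phi>"
    and C: "\<And>j. j < J \<Longrightarrow> C j > 0"
    and gev: "\<And>j n x. j < J \<Longrightarrow> x \<in> patch j \<Longrightarrow> \<bar>(deriv ^^ n) u x\<bar> \<le> Mu * C j ^ n * fact n powr s"
    and P: "prob_space P"
    and indep: "\<And>j. j < J \<Longrightarrow> prob_space.indep_vars P (\<lambda>_. borel) (k j) {..<N j}"
    and dist: "\<And>j q. j < J \<Longrightarrow> q < N j \<Longrightarrow> distr P borel (k j q) = D j"
    and samp: "\<And>j. j < J \<Longrightarrow> sampling_assumption (D j) (\<mu> j) varpi"
    and A: "\<And>j. j < J \<Longrightarrow> A j = varpi * max (C j) (\<mu> j) * r j" "\<And>j. j < J \<Longrightarrow> A j \<le> exp (-2)"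
  defines "c \<equiv> \<lambda>j. feature_param (N j) (A j)"
  defines "err \<equiv> \<lambda>\<omega>. sobolev_norm m p {-R<..<R} (\<lambda>x. u x - u_RF J \<phi> ctr varpi N (\<lambda>j q. k j q \<omega>) \<mu> C c u x)"
  shows "j < J \<Longrightarrow> c j > 2" and "err \<in> borel_measurable P"
    and "(\<integral>\<^sup>+ \<omega>. err \<omega> \<partial>P) \<le> ennreal (localization_const m J C\<phi> R * Mu * (\<Sum>j<J. fact (2 * N j) powr s * feature_const (N j)
        * (r j powr (enn2real (1 / p) - real m - 1) * A j ^ N j * \<bar>ln (A j)\<bar> ^ (N j - 1))))"
proof -
  let ?\<Omega> = "{-R<..<R}"
  note patch = partition_of_unity_patch[OF pu _ R]
  have N1: "N j \<ge> 1" if "j < J" for j using N[OF that] by simp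
  have varpi: "varpi \<ge> 1" if "j < J" for j by (rule sampling_varpi[OF samp[OF that]])
  have k_meas: "k j q \<in> borel_measurable P" if "j < J" "q < N j" for j q
    using indep[OF that(1)] that(2) unfolding prob_space.indep_vars_def[OF P] by auto
  have A0: "A j > 0" if j: "j < J" for j
    unfolding A(1)[OF j] using varpi[OF j] C[OF j] patch(2)[OF j] by (intro mult_pos_pos) auto
  show c2: "c j > 2" if "j < J" for j
    unfolding c_def by (rule feature_param_gt_2[OF A0[OF that] A(2)[OF that] N1[OF that]])
  have Cr: "C j * r j \<le> 1" if j: "j < J" for j
  proof -
    have "C j * r j \<le> max (C j) (\<mu> j) * r j" using patch(2)[OF j] by (intro mult_right_mono) auto
    also have "\<dots> \<le> varpi * (max (C j) (\<mu> j) * r j)"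
      using varpi[OF j] C[OF j] patch(2)[OF j] mult_right_mono[of 1 varpi "max (C j) (\<mu> j) * r j"] by simp
    also have "\<dots> = A j" using A(1)[OF j] by simp
    also have "\<dots> \<le> exp (-2)" by (rule A(2)[OF j])
    also have "\<dots> \<le> 1" by simp
    finally show ?thesis .
  qed
  define w where "w \<omega> j l x = (deriv ^^ l) u x
      - rf_deriv varpi (N j) (\<lambda>q. k j q \<omega>) (\<mu> j) (C j) (c j) (\<lambda>y. u (y + ctr j)) l (x - ctr j)" for \<omega> j l x
  have du: "deriv_seq ?\<Omega> (\<lambda>n. (deriv ^^ n) u)"
    by (rule smooth_on_deriv_seq[OF u]) auto
  have w: "deriv_seq ?\<Omega> (w \<omega> j)" for \<omega> j
    using du deriv_seq_translate[OF deriv_seq_rf_deriv, of varpi "N j" "\<lambda>q. k j q \<omega>" "\<mu> j" "C j" "c j" "\<lambda>y. u (y + ctr j)" "ctr j"]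
    unfolding deriv_seq_def w_def by (auto intro!: derivative_intros)
  \<comment> \<open>The partition distributes \<open>u\<close> over the patches, so the error is the
    sum of the local errors cut off by \<open>\<phi> j\<close>.\<close>
  have f: "u x - u_RF J \<phi> ctr varpi N (\<lambda>j q. k j q \<omega>) \<mu> C c u x = (\<Sum>j<J. \<phi> j x * w \<omega> j 0 x)"
    if x: "x \<in> ?\<Omega>" for x \<omega>
  proof -
    have "(\<Sum>j<J. \<phi> j x) = 1"
      using pu x unfolding partition_of_unity_assumption_def by blast
    then have "u x = (\<Sum>j<J. \<phi> j x * u x)" by (simp flip: sum_distrib_right)
    then show ?thesis
      by (simp add: u_RF_def w_def rf_deriv_0 right_diff_distrib sum_subtractf)
  qed
  define G where "G \<omega> = (\<lambda>n x. \<Sum>j<J. leibniz (\<lambda>k. weak_deriv ?\<Omega> k (\<phi> j)) (w \<omega> j) n x)" for \<omega>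
  have err: "err \<omega> = sobolev_sum m p ?\<Omega> (G \<omega>)" for \<omega>
    unfolding err_def G_def by (rule partition_of_unity_sobolev(1)[OF pu R p w f])
  have w_meas: "(\<lambda>z. w (fst z) j l (snd z)) \<in> borel_measurable (P \<Otimes>\<^sub>M lebesgue_on ?\<Omega>)" if j: "j < J" for j l
  proof -
    have "(deriv ^^ l) u \<in> borel_measurable (lebesgue_on ?\<Omega>)"
      by (rule continuous_imp_measurable_on_sets_lebesgue[OF deriv_seq_continuous_on[OF du]]) simp
    then have "(\<lambda>z. (deriv ^^ l) u (snd z)) \<in> borel_measurable (P \<Otimes>\<^sub>M lebesgue_on ?\<Omega>)"
      by (rule measurable_compose[OF measurable_snd])
    moreover have "(\<lambda>z. rf_deriv varpi (N j) (\<lambda>q. k j q (fst z)) (\<mu> j) (C j) (c j) (\<lambda>y. u (y + ctr j)) l (snd z - ctr j))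
        \<in> borel_measurable (P \<Otimes>\<^sub>M lebesgue_on ?\<Omega>)"
      using measurable_rf_deriv[of "N j" "k j" P] k_meas[OF j] by (simp add: case_prod_beta')
    ultimately show ?thesis unfolding w_def by (rule borel_measurable_diff)
  qed
  have G_meas: "(\<lambda>(\<omega>, x). G \<omega> n x) \<in> borel_measurable (P \<Otimes>\<^sub>M lebesgue_on ?\<Omega>)" if n: "n \<le> m" for n
    unfolding G_def leibniz_def case_prod_beta'
  proof (intro borel_measurable_sum borel_measurable_times borel_measurable_const)
    fix j l assume "j \<in> {..<J}" "l \<in> {..n}"
    then have j: "j < J" by simp
    have "weak_deriv ?\<Omega> (n - l) (\<phi> j) \<in> borel_measurable (lebesgue_on ?\<Omega>)"
      by (rule has_weak_deriv_measurable[OF _ partition_of_unity_weak_deriv(1)[OF pu j _ R]]) (use n in auto)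
    then show "(\<lambda>z. weak_deriv ?\<Omega> (n - l) (\<phi> j) (snd z)) \<in> borel_measurable (P \<Otimes>\<^sub>M lebesgue_on ?\<Omega>)"
      by (rule measurable_compose[OF measurable_snd])
    show "(\<lambda>z. w (fst z) j l (snd z)) \<in> borel_measurable (P \<Otimes>\<^sub>M lebesgue_on ?\<Omega>)"
      by (rule w_meas[OF j])
  qed
  show "err \<in> borel_measurable P"
    unfolding err by (rule measurable_sobolev_sum[OF _ G_meas]) simp
  define E where "E j \<omega> = (C j * r j) ^ (2 * N j) + r j ^ (2 * N j) *
        (\<Sum>i<N j. feature_weight varpi (c j) (\<mu> j) (C j) (N j) (k j i \<omega>))
        + (if good_event varpi (N j) (\<lambda>i. k j i \<omega>) (\<mu> j) (C j) (c j) then 0 else 1)" for j \<omega>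
  have E0: "E j \<omega> \<ge> 0" if j: "j < J" for j \<omega>
    unfolding E_def using C[OF j] patch(2)[OF j]
    by (intro add_nonneg_nonneg mult_nonneg_nonneg sum_nonneg) (auto simp: power_mult)
  have E_meas: "E j \<in> borel_measurable P" if j: "j < J" for j
    unfolding E_def[abs_def] by (rule measurable_feature_error[OF k_meas[OF j]])
  define F where "F j = fact (2 * N j) powr s" for j
  have F0: "F j \<ge> 0" for j by (simp add: F_def)
  define \<rho> where "\<rho> j = r j powr (enn2real (1 / p) - real m - 1)" for j
  let ?H = "localization_const m J C\<phi> R"
  have H0: "?H \<ge> 0" by (rule localization_const_nonneg[OF R])
  \<comment> \<open>Interpolation requires distinct squares and nonzero frequencies on all patches
    at once; finitely many null sets are removed.\<close>
  have "AE \<omega> in P. \<forall>j\<in>{..<J}. inj_on (\<lambda>q. (k j q \<omega>)\<^sup>2) {..<N j} \<and> (\<forall>q<N j. k j q \<omega> \<noteq> 0)"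
    by (intro AE_finite_allI AE_sample_distinct[OF P indep dist samp N1]) auto
  then have AE_err: "AE \<omega> in P. err \<omega> \<le> ennreal (?H * (\<Sum>j<J. \<rho> j * (Mu * F j * E j \<omega>)))"
  proof eventually_elim
    case (elim \<omega>)
    show ?case
      unfolding err_def \<rho>_def
    proof (rule partition_of_unity_sobolev(2)[OF pu R p w f])
      show "Mu * F j * E j \<omega> \<ge> 0" if "j < J" for j
        using Mu F0 E0[OF that] by simp
      fix j l x assume j: "j < J" and l: "l \<le> m" and x: "x \<in> patch j"
      have reg: "inj_on (\<lambda>q. (k j q \<omega>)\<^sup>2) {..<N j} \<and> (\<forall>q<N j. k j q \<omega> \<noteq> 0)"
        using elim j by blast
      have x': "x \<in> ball (ctr j) (r j)" using x patch(1)[OF j] by simp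
      have du': "deriv_seq (ball (ctr j) (r j)) (\<lambda>n. (deriv ^^ n) u)"
        using deriv_seq_subset[OF du patch(3)[OF j]] patch(1)[OF j] by simp
      have "\<bar>(deriv ^^ l) u x - rf_deriv varpi (N j) (\<lambda>q. k j q \<omega>) (\<mu> j) (C j) (c j) (\<lambda>y. u (y + ctr j)) l (x - ctr j)\<bar>
          \<le> Mu * fact (2 * N j) powr s * ((C j * r j) ^ (2 * N j) + r j ^ (2 * N j) *
        (\<Sum>i<N j. feature_weight varpi (c j) (\<mu> j) (C j) (N j) (k j i \<omega>))
        + (if good_event varpi (N j) (\<lambda>i. k j i \<omega>) (\<mu> j) (C j) (c j) then 0 else 1)) / r j ^ l"
      proof (rule rf_error_bound[OF du' patch(2)[OF j] C[OF j] _ s Cr[OF j] _ _ x'])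
        show "0 \<le> Mu" using Mu by simp
        show "\<bar>(deriv ^^ n) u y\<bar> \<le> Mu * C j ^ n * fact n powr s" if "y \<in> ball (ctr j) (r j)" for n y
          using gev[OF j, of y n] that patch(1)[OF j] by simp
        show "l \<le> 2 * N j" using l N[OF j] by simp
      qed (use reg in auto)
      then show "\<bar>w \<omega> j l x\<bar> \<le> Mu * F j * E j \<omega> / r j ^ l"
        by (simp only: w_def F_def E_def)
    qed
  qed
  have split: "ennreal (?H * (\<Sum>j<J. \<rho> j * (Mu * F j * E j \<omega>))) = (\<Sum>j<J. ennreal (?H * \<rho> j * Mu * F j) * ennreal (E j \<omega>))" for \<omega>
  proof -
    have "?H * (\<Sum>j<J. \<rho> j * (Mu * F j * E j \<omega>)) = (\<Sum>j<J. ?H * \<rho> j * Mu * F j * E j \<omega>)"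
      by (simp only: sum_distrib_left mult.assoc)
    also have "ennreal \<dots> = (\<Sum>j<J. ennreal (?H * \<rho> j * Mu * F j * E j \<omega>))"
      using H0 Mu F0 E0 by (intro sum_ennreal[symmetric]) (auto simp: \<rho>_def)
    also have "\<dots> = (\<Sum>j<J. ennreal (?H * \<rho> j * Mu * F j) * ennreal (E j \<omega>))"
      using H0 Mu F0 by (intro sum.cong refl ennreal_mult') (auto simp: \<rho>_def)
    finally show ?thesis .
  qed
  have E_int: "(\<integral>\<^sup>+ \<omega>. ennreal (E j \<omega>) \<partial>P) \<le> ennreal (feature_const (N j) * (A j ^ N j * \<bar>ln (A j)\<bar> ^ (N j - 1)))"
    if j: "j < J" for j
  proof -
    note nn_integral_error[OF P indep[OF j] dist[OF j] samp[OF j] N1[OF j] C[OF j] c2[OF j] patch(2)[OF j]]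
    also have "ennreal ((C j * r j) ^ (2 * N j) + r j ^ (2 * N j) * (real (N j) *
          (2 * (22 * exp (c j) * varpi\<^sup>2 * (max (C j) (\<mu> j))\<^sup>2) ^ (N j - 1) * (max (C j) (\<mu> j))\<^sup>2))
          + (if N j = 1 then 0 else real (N j) * (40 * c j * exp (1 - c j)) ^ (N j - 1)))
      \<le> ennreal (feature_const (N j) * (A j ^ N j * \<bar>ln (A j)\<bar> ^ (N j - 1)))"
      unfolding c_def
      by (intro ennreal_leI feature_param_balance[OF A(1)[OF j] A0[OF j] A(2)[OF j] N1[OF j] varpi[OF j] C[OF j] _ patch(2)[OF j]]) simp
    finally show ?thesis by (simp only: E_def)
  qed
  have "(\<integral>\<^sup>+ \<omega>. err \<omega> \<partial>P) \<le> (\<integral>\<^sup>+ \<omega>. ennreal (?H * (\<Sum>j<J. \<rho> j * (Mu * F j * E j \<omega>))) \<partial>P)"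
    by (rule nn_integral_mono_AE[OF AE_err])
  also have "\<dots> = (\<Sum>j<J. \<integral>\<^sup>+ \<omega>. ennreal (?H * \<rho> j * Mu * F j) * ennreal (E j \<omega>) \<partial>P)"
    unfolding split using E_meas by (intro nn_integral_sum) auto
  also have "\<dots> = (\<Sum>j<J. ennreal (?H * \<rho> j * Mu * F j) * (\<integral>\<^sup>+ \<omega>. ennreal (E j \<omega>) \<partial>P))"
    using E_meas by (intro sum.cong refl nn_integral_cmult) auto
  also have "\<dots> \<le> (\<Sum>j<J. ennreal (?H * \<rho> j * Mu * F j) * ennreal (feature_const (N j) * (A j ^ N j * \<bar>ln (A j)\<bar> ^ (N j - 1))))"
    using E_int by (intro sum_mono mult_left_mono) auto
  also have "\<dots> = (\<Sum>j<J. ennreal (?H * \<rho> j * Mu * F j * (feature_const (N j) * (A j ^ N j * \<bar>ln (A j)\<bar> ^ (N j - 1)))))"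
    using H0 Mu F0 by (intro sum.cong refl ennreal_mult'[symmetric]) (auto simp: \<rho>_def)
  also have "\<dots> = ennreal (\<Sum>j<J. ?H * \<rho> j * Mu * F j * (feature_const (N j) * (A j ^ N j * \<bar>ln (A j)\<bar> ^ (N j - 1))))"
  proof (rule sum_ennreal)
    fix j assume "j \<in> {..<J}"
    then have "A j > 0" using A0 by simp
    then show "0 \<le> ?H * \<rho> j * Mu * F j * (feature_const (N j) * (A j ^ N j * \<bar>ln (A j)\<bar> ^ (N j - 1)))"
      using H0 Mu F0[of j] feature_const_pos[of "N j"] by (intro mult_nonneg_nonneg) (auto simp: \<rho>_def)
  qed
  also have "(\<Sum>j<J. ?H * \<rho> j * Mu * F j * (feature_const (N j) * (A j ^ N j * \<bar>ln (A j)\<bar> ^ (N j - 1))))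
     = ?H * Mu * (\<Sum>j<J. F j * feature_const (N j) * (\<rho> j * A j ^ N j * \<bar>ln (A j)\<bar> ^ (N j - 1)))"
    by (simp only: sum_distrib_left mult_ac)
  finally show "(\<integral>\<^sup>+ \<omega>. err \<omega> \<partial>P) \<le> ennreal (?H * Mu * (\<Sum>j<J. fact (2 * N j) powr s * feature_const (N j)
        * (r j powr (enn2real (1 / p) - real m - 1) * A j ^ N j * \<bar>ln (A j)\<bar> ^ (N j - 1))))"
    by (simp only: F_def \<rho>_def)
qed

text \<open>The implied constant is quantified before the function, the partition, the laws and the
  sample, which enforces its permitted dependences. Measurability is part of the claim because only
  then is the nonnegative integral an expectation.\<close>

theorem theorem2p9:
  fixes R s C\<^sub>\<phi> :: real and p :: ennreal and m M J :: nat and N :: "nat \<Rightarrow> nat"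
  assumes "R > 0" and "s \<ge> 0" and "p \<ge> 1"
    and "\<forall>j<J. m + 1 \<le> N j"
  shows "\<exists>K>0. \<forall>(u :: real \<Rightarrow> real) M\<^sub>u C\<^sub>u (\<phi> :: nat \<Rightarrow> real \<Rightarrow> real) patch ctr r M\<^sub>\<Omega> C\<^sub>\<Omega>
           (P :: 'w measure) (k :: nat \<Rightarrow> nat \<Rightarrow> 'w \<Rightarrow> real) D \<mu> varpi A.
      u \<in> gevrey s {-R..R} \<and> gevrey_const s {-R..R} u M\<^sub>u C\<^sub>u \<and>
      partition_of_unity_assumption m {-R<..<R} J \<phi> patch ctr r M C\<^sub>\<phi> \<and>
      (\<forall>j<J. gevrey_const s (closure (patch j)) u (M\<^sub>\<Omega> j) (C\<^sub>\<Omega> j) \<and> M\<^sub>\<Omega> j \<le> M\<^sub>u) \<and>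
      prob_space P \<and>
      (\<forall>j<J. prob_space.indep_vars P (\<lambda>_. borel) (k j) {..<N j} \<and>
             (\<forall>q<N j. distr P borel (k j q) = D j) \<and> sampling_assumption (D j) (\<mu> j) varpi) \<and>
      (\<forall>j<J. A j = varpi * max (C\<^sub>\<Omega> j) (\<mu> j) * r j \<and> A j \<le> exp (-2))
      \<longrightarrow>
      (\<exists>c. (\<forall>j<J. c j > 2) \<and>
         (let err = (\<lambda>\<omega>. sobolev_norm m p {-R<..<R}
                (\<lambda>x. u x - u_RF J \<phi> ctr varpi N (\<lambda>j q. k j q \<omega>) \<mu> C\<^sub>\<Omega> c u x))
          in err \<in> borel_measurable P \<and>
             (\<integral>\<^sup>+ \<omega>. err \<omega> \<partial>P) \<le> ennreal (K * M\<^sub>u *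
               Max ((\<lambda>j. r j powr (enn2real (1 / p) - real m - 1) * A j ^ N j * \<bar>ln (A j)\<bar> ^ (N j - 1))
                    ` {..<J}))))"
proof -
  let ?H = "localization_const m J C\<^sub>\<phi> R"
  define F where "F j = fact (2 * N j) powr s * feature_const (N j)" for j
  \<comment> \<open>The summand \<open>1\<close> keeps \<open>K\<close> positive when the
    localization constant is \<open>0\<close>, for instance for
    \<open>C\<^sub>\<phi> = 0\<close>.\<close>
  define K where "K = ?H * (\<Sum>j<J. F j) + 1"
  have F0: "F j \<ge> 0" for j
    unfolding F_def using feature_const_pos[of "N j"] by (intro mult_nonneg_nonneg) auto
  have H0: "?H \<ge> 0" by (rule localization_const_nonneg[OF assms(1)])
  have K: "K > 0" unfolding K_def using H0 F0 by (intro add_nonneg_pos mult_nonneg_nonneg sum_nonneg) auto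
  show ?thesis
  proof (intro exI[of _ K] conjI K allI impI; elim conjE)
    fix u :: "real \<Rightarrow> real" and Mu Cu :: real and \<phi> :: "nat \<Rightarrow> real \<Rightarrow> real" and patch :: "nat \<Rightarrow> real set"
      and ctr r M\<Omega> C\<Omega> :: "nat \<Rightarrow> real" and P :: "'w measure" and k :: "nat \<Rightarrow> nat \<Rightarrow> 'w \<Rightarrow> real"
      and D :: "nat \<Rightarrow> real measure" and \<mu> :: "nat \<Rightarrow> real" and varpi :: real and A :: "nat \<Rightarrow> real"
    assume u: "u \<in> gevrey s {-R..R}" and Mu: "gevrey_const s {-R..R} u Mu Cu"
      and pu: "partition_of_unity_assumption m {-R<..<R} J \<phi> patch ctr r M C\<^sub>\<phi>"
      and gev: "\<forall>j<J. gevrey_const s (closure (patch j)) u (M\<Omega> j) (C\<Omega> j) \<and> M\<Omega> j \<le> Mu"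
      and P: "prob_space P"
      and k: "\<forall>j<J. prob_space.indep_vars P (\<lambda>_. borel) (k j) {..<N j} \<and>
             (\<forall>q<N j. distr P borel (k j q) = D j) \<and> sampling_assumption (D j) (\<mu> j) varpi"
      and A: "\<forall>j<J. A j = varpi * max (C\<Omega> j) (\<mu> j) * r j \<and> A j \<le> exp (-2)"
    define c where "c = (\<lambda>j. feature_param (N j) (A j))"
    define T where "T j = r j powr (enn2real (1 / p) - real m - 1) * A j ^ N j * \<bar>ln (A j)\<bar> ^ (N j - 1)" for j
    have smooth: "smooth_on {-R..R} u" using u by (simp add: gevrey_def)
    have Mu0: "Mu > 0" using Mu by (simp add: gevrey_const_def)
    have C0: "C\<Omega> j > 0" if "j < J" for j using gev that by (simp add: gevrey_const_def)
    \<comment> \<open>The local constants concern derivatives within the closed patch; on the open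
      patch these are the ordinary ones, and \<open>M\<Omega> j \<le> Mu\<close> passes to the
      global factor.\<close>
    have bound: "\<bar>(deriv ^^ n) u x\<bar> \<le> Mu * C\<Omega> j ^ n * fact n powr s" if j: "j < J" and x: "x \<in> patch j" for j n x
    proof -
      have "open (patch j)" using partition_of_unity_patch(1)[OF pu j assms(1)] by simp
      then have "(deriv ^^ n) u x = (deriv_on (closure (patch j)) ^^ n) u x"
        by (rule deriv_on_iterate[OF _ closure_subset x, symmetric])
      also have "\<bar>\<dots>\<bar> \<le> M\<Omega> j * C\<Omega> j ^ n * fact n powr s"
        using gev j x closure_subset[of "patch j"] unfolding gevrey_const_def by blast
      also have "\<dots> \<le> Mu * C\<Omega> j ^ n * fact n powr s"
        using gev j C0[OF j] by (intro mult_right_mono) auto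
      finally show ?thesis .
    qed
    note result = random_feature_expected_error[where N = N and k = k and D = D and \<mu> = \<mu> and varpi = varpi and A = A,
        OF assms(1-3) _ smooth Mu0 pu C0 bound P, folded c_def]
    \<comment> \<open>An empty family cannot sum to \<open>1\<close> at the point \<open>0\<close>;
      hence the maximum is taken over a nonempty set.\<close>
    have J: "J \<noteq> 0"
    proof
      assume "J = 0"
      moreover have "(0::real) \<in> {-R<..<R}" using assms(1) by simp
      ultimately show False using pu unfolding partition_of_unity_assumption_def by fastforce
    qed
    \<comment> \<open>The constant may depend on all the numbers \<open>N j\<close>, hence on
      \<open>J\<close>, so the sum over the patches is bounded by the maximum times the sum of the
      factors \<open>F j\<close>.\<close>
    have "?H * Mu * (\<Sum>j<J. F j * T j) \<le> K * Mu * Max (T ` {..<J})"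
    proof -
      have T_le: "T j \<le> Max (T ` {..<J})" if "j < J" for j using that by (intro Max_ge) auto
      \<comment> \<open>The sign of the maximum matters because of the summand \<open>1\<close> in
        \<open>K\<close>.\<close>
      have T0: "Max (T ` {..<J}) \<ge> 0"
      proof -
        have "varpi \<ge> 1" using sampling_varpi k J by blast
        moreover have "r 0 > 0" using partition_of_unity_patch(2)[OF pu _ assms(1)] J by simp
        ultimately have "A 0 \<ge> 0" using A J C0[of 0] by (auto intro!: mult_nonneg_nonneg simp: le_max_iff_disj less_imp_le)
        then have "T 0 \<ge> 0" by (simp add: T_def)
        also have "\<dots> \<le> Max (T ` {..<J})" using J by (intro T_le) simp
        finally show ?thesis .
      qed
      have "(\<Sum>j<J. F j * T j) \<le> (\<Sum>j<J. F j * Max (T ` {..<J}))"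
        using T_le F0 by (intro sum_mono mult_left_mono) auto
      then have "?H * (\<Sum>j<J. F j * T j) \<le> ?H * ((\<Sum>j<J. F j) * Max (T ` {..<J}))"
        using H0 by (intro mult_left_mono) (simp_all add: sum_distrib_right)
      also have "\<dots> \<le> K * Max (T ` {..<J})"
        using T0 by (simp add: K_def distrib_right)
      finally have "Mu * (?H * (\<Sum>j<J. F j * T j)) \<le> Mu * (K * Max (T ` {..<J}))"
        using Mu0 by (intro mult_left_mono) auto
      then show ?thesis by (simp only: mult_ac)
    qed
    then have le: "ennreal (?H * Mu * (\<Sum>j<J. F j * T j)) \<le> ennreal (K * Mu * Max (T ` {..<J}))"
      by (rule ennreal_leI)
    show "\<exists>c. (\<forall>j<J. c j > 2) \<and>
         (let err = (\<lambda>\<omega>. sobolev_norm m p {-R<..<R}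
                (\<lambda>x. u x - u_RF J \<phi> ctr varpi N (\<lambda>j q. k j q \<omega>) \<mu> C\<Omega> c u x))
          in err \<in> borel_measurable P \<and>
             (\<integral>\<^sup>+ \<omega>. err \<omega> \<partial>P) \<le> ennreal (K * Mu *
               Max ((\<lambda>j. r j powr (enn2real (1 / p) - real m - 1) * A j ^ N j * \<bar>ln (A j)\<bar> ^ (N j - 1))
                    ` {..<J})))"
      unfolding Let_def T_def[symmetric]
    proof (intro exI[of _ c] conjI allI impI)
      show "c j > 2" if "j < J" for j
        unfolding c_def by (rule result(1)) (use assms(4) k A that in auto)
      show "(\<lambda>\<omega>. sobolev_norm m p {-R<..<R} (\<lambda>x. u x - u_RF J \<phi> ctr varpi N (\<lambda>j q. k j q \<omega>) \<mu> C\<Omega> c u x)) \<in> borel_measurable P"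
        by (rule result(2)) (use assms(4) k A in auto)
      have "(\<integral>\<^sup>+ \<omega>. sobolev_norm m p {-R<..<R} (\<lambda>x. u x - u_RF J \<phi> ctr varpi N (\<lambda>j q. k j q \<omega>) \<mu> C\<Omega> c u x) \<partial>P)
          \<le> ennreal (?H * Mu * (\<Sum>j<J. F j * T j))"
        unfolding F_def T_def by (rule result(3)) (use assms(4) k A in auto)
      also note le
      finally show "(\<integral>\<^sup>+ \<omega>. sobolev_norm m p {-R<..<R} (\<lambda>x. u x - u_RF J \<phi> ctr varpi N (\<lambda>j q. k j q \<omega>) \<mu> C\<Omega> c u x) \<partial>P)
          \<le> ennreal (K * Mu * Max (T ` {..<J}))" .
    qed
  qed
qed

end
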